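(* Let $F(x,y)\in\mathbb{Z}[x,y]$ be a diagonalizable form of degree $r\geq 5$ with discriminant $\Delta$, let $h$ be a positive integer and let $m\geq 3$ be an integer. Put $$\Delta'=\frac{|\Delta|}{2^{r^2-r}r^r h^{2r-2}},\qquad \alpha_1=\frac{7r^2(r-1)}{(r-1)^{m-1}-2r-1},\qquad \alpha_2=\frac{(r-1)(r^2+r+2)}{(r-1)^{m-1}-2r-1},$$ and assume that $$\Delta'\geq r^{\alpha_1}h^{\alpha_2}.$$ Then $$N_F(h)\leq \begin{cases} rm & \text{if } D<0,\\ 2m & \text{if } D>0,\ r \text{ is even and } F \text{ is indefinite},\\ m & \text{if } D>0,\ r \text{ is odd and } F \text{ is indefinite},\\ 1 & \text{if } D>0 \text{ and } F \text{ is definite}.\end{cases}$$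
   Context: A binary form $F(x,y)\in\mathbb{Z}[x,y]$ of degree $r$ is called diagonalizable if it can be written as $F(x,y)=(\alpha x+\beta y)^r-(\gamma x+\delta y)^r$ with (complex) constants $\alpha,\beta,\gamma,\delta$ satisfying $j=\alpha\delta-\beta\gamma\neq 0$. For such a form one can write $(\alpha x+\beta y)(\gamma x+\delta y)=\chi(Ax^2+Bxy+Cy^2)$ with $A,B,C\in\mathbb{Z}$ and a constant $\chi$; put $D=D(F)=B^2-4AC$ (which is nonzero). $F$ is definite if $F(x,y)$ takes values of only one strict sign for real $(x,y)\neq(0,0)$, and indefinite if it takes both signs. A solution $(x,y)\in\mathbb{Z}^2$ is primitive if $\gcd(x,y)=1$. $N_F(h)$ is the number of primitive solutions $(x,y)\in\mathbb{Z}^2$ of $0<|F(x,y)|\leq h$, where $(x,y)$ and $(-x,-y)$ are counted as one solution. *)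

theory Defs
  imports "HOL-Computational_Algebra.Computational_Algebra"
begin

section \<open>Binary forms\<close>

text \<open>The integral binary form of degree \<open>r\<close> with coefficients \<open>a 0, \<dots>, a r\<close>, i.e.
  \<open>F(x, y) = a 0 x^r + a 1 x^(r-1) y + \<dots> + a r y^r\<close>; the values \<open>a i\<close> for \<open>i > r\<close> are
  irrelevant.  It is evaluated at integer, real and complex arguments below.\<close>

definition form_eval :: "nat \<Rightarrow> (nat \<Rightarrow> int) \<Rightarrow> 'a::comm_ring_1 \<Rightarrow> 'a \<Rightarrow> 'a" where
  "form_eval r a x y = (\<Sum>i\<le>r. of_int (a i) * x ^ (r - i) * y ^ i)"

definition linear_factorization ::
    "nat \<Rightarrow> (nat \<Rightarrow> int) \<Rightarrow> (nat \<Rightarrow> complex) \<Rightarrow> (nat \<Rightarrow> complex) \<Rightarrow> bool" where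
  "linear_factorization r a p q \<longleftrightarrow>
     (\<forall>x y :: complex. form_eval r a x y = (\<Prod>i<r. p i * x + q i * y))"

definition factor_disc :: "nat \<Rightarrow> (nat \<Rightarrow> complex) \<Rightarrow> (nat \<Rightarrow> complex) \<Rightarrow> complex" where
  "factor_disc r p q = (\<Prod>j<r. \<Prod>i<j. (p i * q j - p j * q i)\<^sup>2)"

text \<open>The discriminant is the product of the squared determinants of the pairs of linear factors
  over the complex numbers.  If \<open>a 0 \<noteq> 0\<close> and the \<open>\<theta> i\<close> are the roots of \<open>F(x, 1)\<close>, this is
  \<open>(a 0)^(2 r - 2)\<close> times the product of the \<open>(\<theta> i - \<theta> j)^2\<close>; unlike that formula it also covers
  \<open>a 0 = 0\<close>.  The value does not depend on the factorization, see \<open>form_disc_eq\<close>.\<close>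

definition form_disc :: "nat \<Rightarrow> (nat \<Rightarrow> int) \<Rightarrow> complex" where
  "form_disc r a = (THE d. \<exists>p q. linear_factorization r a p q \<and> d = factor_disc r p q)"

definition definite_form :: "nat \<Rightarrow> (nat \<Rightarrow> int) \<Rightarrow> bool" where
  "definite_form r a \<longleftrightarrow>
     (\<forall>x y :: real. (x, y) \<noteq> (0, 0) \<longrightarrow> form_eval r a x y > 0) \<or>
     (\<forall>x y :: real. (x, y) \<noteq> (0, 0) \<longrightarrow> form_eval r a x y < 0)"

definition indefinite_form :: "nat \<Rightarrow> (nat \<Rightarrow> int) \<Rightarrow> bool" where
  "indefinite_form r a \<longleftrightarrow>
     (\<exists>x y :: real. form_eval r a x y > 0) \<and> (\<exists>x y :: real. form_eval r a x y < 0)"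


section \<open>Diagonalizable forms\<close>

definition diagonalization ::
    "nat \<Rightarrow> (nat \<Rightarrow> int) \<Rightarrow> complex \<Rightarrow> complex \<Rightarrow> complex \<Rightarrow> complex \<Rightarrow> bool" where
  "diagonalization r a \<alpha> \<beta> \<gamma> \<delta> \<longleftrightarrow>
     \<alpha> * \<delta> - \<beta> * \<gamma> \<noteq> 0 \<and>
     (\<forall>x y. form_eval r a x y = (\<alpha> * x + \<beta> * y) ^ r - (\<gamma> * x + \<delta> * y) ^ r)"

definition diagonalizable :: "nat \<Rightarrow> (nat \<Rightarrow> int) \<Rightarrow> bool" where
  "diagonalizable r a \<longleftrightarrow> (\<exists>\<alpha> \<beta> \<gamma> \<delta>. diagonalization r a \<alpha> \<beta> \<gamma> \<delta>)"

text \<open>The integers \<open>A, B, C\<close> belong to \<open>F\<close> if \<open>A x^2 + B x y + C y^2\<close> is, up to a constant, the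
  product of the two linear forms of a diagonalization of \<open>F\<close>.  Such integers exist for every
  diagonalizable form of degree at least \<open>3\<close> (\<open>quadratic_of_exists\<close> below).  They are not unique
  (they can be scaled).\<close>

definition quadratic_of :: "nat \<Rightarrow> (nat \<Rightarrow> int) \<Rightarrow> int \<Rightarrow> int \<Rightarrow> int \<Rightarrow> bool" where
  "quadratic_of r a A B C \<longleftrightarrow>
     (\<exists>\<alpha> \<beta> \<gamma> \<delta> \<kappa>. diagonalization r a \<alpha> \<beta> \<gamma> \<delta> \<and>
        (\<forall>x y :: complex. (\<alpha> * x + \<beta> * y) * (\<gamma> * x + \<delta> * y) =
           \<kappa> * (of_int A * x\<^sup>2 + of_int B * x * y + of_int C * y\<^sup>2)))"


section \<open>Counting primitive solutions\<close>

definition primitive_solutions :: "nat \<Rightarrow> (nat \<Rightarrow> int) \<Rightarrow> nat \<Rightarrow> (int \<times> int) set" where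
  "primitive_solutions r a h =
     {(x, y). gcd x y = 1 \<and> 0 < \<bar>form_eval r a x y\<bar> \<and> \<bar>form_eval r a x y\<bar> \<le> int h}"

text \<open>\<open>(x, y)\<close> and \<open>(-x, -y)\<close> count as one solution.  As \<open>card\<close> of an infinite set is \<open>0\<close>, bounds on
  this number are to be accompanied by finiteness of \<open>primitive_solutions\<close>.\<close>

definition num_primitive_solutions :: "nat \<Rightarrow> (nat \<Rightarrow> int) \<Rightarrow> nat \<Rightarrow> nat" where
  "num_primitive_solutions r a h =
     card ((\<lambda>(x, y). {(x, y), (- x, - y)}) ` primitive_solutions r a h)"


section \<open>The discriminant is well defined\<close>

context
begin

private definition ordered_disc ::
    "nat set \<Rightarrow> (nat \<Rightarrow> complex) \<Rightarrow> (nat \<Rightarrow> complex) \<Rightarrow> complex" where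
  "ordered_disc I p q = (\<Prod>i\<in>I. \<Prod>j\<in>I - {i}. p i * q j - p j * q i)"

private lemma ordered_disc_insert:
  assumes "finite I" "k \<notin> I"
  shows "ordered_disc (insert k I) p q =
    (-1) ^ card I * ordered_disc I p q * (\<Prod>j\<in>I. p j * q k + q j * (- p k))\<^sup>2"
proof -
  have 1: "(\<Prod>j\<in>insert k I - {i}. p i * q j - p j * q i) =
      (p i * q k - p k * q i) * (\<Prod>j\<in>I - {i}. p i * q j - p j * q i)" if "i \<in> I" for i
  proof -
    have "insert k I - {i} = insert k (I - {i})" using that assms by auto
    then show ?thesis using assms by simp
  qed
  have 2: "(\<Prod>j\<in>I. p k * q j - p j * q k) = (-1) ^ card I * (\<Prod>j\<in>I. p j * q k + q j * (- p k))"
  proof -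
    have "(\<Prod>j\<in>I. p k * q j - p j * q k) = (\<Prod>j\<in>I. (-1) * (p j * q k + q j * (- p k)))"
      by (intro prod.cong) (auto simp: algebra_simps)
    then show ?thesis by (simp only: prod.distrib prod_constant)
  qed
  have 3: "insert k I - {k} = I" using assms by auto
  have "ordered_disc (insert k I) p q =
      (\<Prod>j\<in>I. p k * q j - p j * q k) *
      (\<Prod>i\<in>I. (p i * q k - p k * q i) * (\<Prod>j\<in>I - {i}. p i * q j - p j * q i))"
    unfolding ordered_disc_def using assms 1 3 by simp
  also have "\<dots> = (-1) ^ card I * ordered_disc I p q * (\<Prod>j\<in>I. p j * q k + q j * (- p k))\<^sup>2"
    unfolding prod.distrib 2 ordered_disc_def
    by (simp add: power2_eq_square mult_ac)
  finally show ?thesis .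
qed

private lemma factor_disc_ordered:
  "\<exists>e. e \<noteq> 0 \<and> (\<forall>p q. ordered_disc {..<r} p q = e * factor_disc r p q)"
proof (induction r)
  case 0
  show ?case by (rule exI[of _ 1]) (simp add: ordered_disc_def factor_disc_def)
next
  case (Suc r)
  then obtain e where e: "e \<noteq> 0" "\<And>p q. ordered_disc {..<r} p q = e * factor_disc r p q"
    by blast
  have "ordered_disc {..<Suc r} p q = ((-1) ^ r * e) * factor_disc (Suc r) p q" for p q
    unfolding lessThan_Suc
    by (subst ordered_disc_insert)
      (simp_all add: e factor_disc_def prod_power_distrib algebra_simps)
  then show ?case using e(1) by (intro exI[of _ "(-1) ^ r * e"]) auto
qed

private lemma linear_forms_nonvanishing:
  fixes p q :: "nat \<Rightarrow> complex"
  assumes "finite I" "\<And>i. i \<in> I \<Longrightarrow> p i \<noteq> 0 \<or> q i \<noteq> 0"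
  shows "\<exists>x y. (\<Prod>i\<in>I. p i * x + q i * y) \<noteq> 0"
proof -
  have "(\<Prod>i\<in>I. [:p i, q i:]) \<noteq> 0" using assms by auto
  then obtain y where "poly (\<Prod>i\<in>I. [:p i, q i:]) y \<noteq> 0"
    using poly_all_0_iff_0 by blast
  then show ?thesis by (intro exI[of _ 1] exI[of _ y]) (simp add: poly_prod mult.commute)
qed

private lemma ordered_disc_zero:
  assumes "finite I" "k \<in> I" "p k = 0" "q k = 0" "card I \<ge> 2"
  shows "ordered_disc I p q = 0"
proof -
  have "card (I - {k}) \<ge> 1" using assms by simp
  then obtain l where "l \<in> I - {k}" by (metis One_nat_def card.empty ex_in_conv not_one_le_zero)
  then have "(\<Prod>j\<in>I - {k}. p k * q j - p j * q k) = 0" using assms by auto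
  then show ?thesis unfolding ordered_disc_def using assms(1,2) by (auto intro: prod_zero)
qed

private lemma cancel_linear:
  fixes G H :: "'i set" and p q :: "'i \<Rightarrow> complex"
  assumes fin: "finite G" "finite H" and nz: "u \<noteq> 0 \<or> v \<noteq> 0"
    and eq: "\<And>x y. (u * x + v * y) * (\<Prod>i\<in>G. p i * x + q i * y) =
                (u * x + v * y) * (c * (\<Prod>i\<in>H. p' i * x + q' i * y))"
  shows "(\<Prod>i\<in>G. p i * x + q i * y) = c * (\<Prod>i\<in>H. p' i * x + q' i * y)"
proof -
  obtain s t where st: "u * s + v * t \<noteq> 0"
    using nz by (metis add.right_neutral add_0 mult.right_neutral mult_zero_right)
  let ?L = "[:u * x + v * y, u * s + v * t:]"
  let ?P = "\<Prod>i\<in>G. [:p i * x + q i * y, p i * s + q i * t:]"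
  let ?Q = "smult c (\<Prod>i\<in>H. [:p' i * x + q' i * y, p' i * s + q' i * t:])"
  have "poly (?L * ?P) z = poly (?L * ?Q) z" for z
    using eq[of "x + z * s" "y + z * t"] by (simp add: poly_prod algebra_simps)
  then have LPQ: "?L * ?P = ?L * ?Q" by (simp add: poly_eq_poly_eq_iff[symmetric] fun_eq_iff)
  have "?L \<noteq> 0" using st by simp
  then have "?P = ?Q" by (rule mult_left_cancel[THEN iffD1, OF _ LPQ])
  then have "poly ?P 0 = poly ?Q 0" by simp
  then show ?thesis by (simp add: poly_prod)
qed

private lemma ordered_disc_unique:
  assumes "finite I" "finite J" "card I = card J"
    and "\<And>x y. (\<Prod>i\<in>I. p i * x + q i * y) = c * (\<Prod>i\<in>J. p' i * x + q' i * y)"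
    and "\<And>i. i \<in> I \<Longrightarrow> p i \<noteq> 0 \<or> q i \<noteq> 0"
  shows "ordered_disc I p q = c ^ (2 * (card I - 1)) * ordered_disc J p' q'"
  using assms
proof (induction I arbitrary: J c rule: finite_induct)
  case empty
  then show ?case by (simp add: ordered_disc_def)
next
  case (insert k I)
  note fac = insert.prems(3)
  have nzk: "p k \<noteq> 0 \<or> q k \<noteq> 0" using insert.prems(4) by simp
  obtain x0 y0 where "(\<Prod>i\<in>insert k I. p i * x0 + q i * y0) \<noteq> 0"
    using linear_forms_nonvanishing[of "insert k I" p q] insert by blast
  then have c0: "c \<noteq> 0" using fac[of x0 y0] by auto
  have "(\<Prod>i\<in>insert k I. p i * q k + q i * (- p k)) = 0" using insert.hyps by simp
  then obtain l where l: "l \<in> J" "p' l * q k + q' l * (- p k) = 0"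
    using fac[of "q k" "- p k"] c0 insert.prems(1) by auto
  obtain \<mu> where \<mu>: "p' l = \<mu> * p k" "q' l = \<mu> * q k"
  proof (cases "p k = 0")
    case True
    then show ?thesis using nzk l(2) that[of "q' l / q k"] by auto
  next
    case False
    then show ?thesis using l(2) that[of "p' l / p k"] by (auto simp: field_simps)
  qed
  define J' where "J' = J - {l}"
  have J: "J = insert l J'" "finite J'" "l \<notin> J'" using l(1) insert.prems(1) by (auto simp: J'_def)
  have card: "card I = card J'" using insert.prems(2) insert.hyps J by simp
  have red: "(\<Prod>i\<in>I. p i * x + q i * y) = (c * \<mu>) * (\<Prod>i\<in>J'. p' i * x + q' i * y)" for x y
  proof (rule cancel_linear[OF insert.hyps(1) J(2) nzk])
    fix x y
    show "(p k * x + q k * y) * (\<Prod>i\<in>I. p i * x + q i * y) =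
      (p k * x + q k * y) * (c * \<mu> * (\<Prod>i\<in>J'. p' i * x + q' i * y))"
      using fac[of x y] insert.hyps J by (simp add: \<mu> algebra_simps)
  qed
  have IH: "ordered_disc I p q = (c * \<mu>) ^ (2 * (card I - 1)) * ordered_disc J' p' q'"
    by (rule insert.IH[OF J(2) card red]) (use insert.prems(4) in auto)
  define S where "S = (\<Prod>j\<in>J'. p' j * q k + q' j * (- p k))"
  have SL: "(\<Prod>j\<in>J'. p' j * q' l + q' j * (- p' l)) = \<mu> ^ card J' * S"
  proof -
    have "(\<Prod>j\<in>J'. p' j * q' l + q' j * (- p' l)) = (\<Prod>j\<in>J'. \<mu> * (p' j * q k + q' j * (- p k)))"
      by (intro prod.cong) (auto simp: \<mu> algebra_simps)
    then show ?thesis by (simp only: prod.distrib prod_constant S_def)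
  qed
  have 1: "ordered_disc (insert k I) p q =
      (-1) ^ card I * ((c * \<mu>) ^ (2 * (card I - 1)) * ordered_disc J' p' q') * (c * \<mu> * S)\<^sup>2"
    unfolding ordered_disc_insert[OF insert.hyps] IH red S_def by (rule refl)
  have 2: "ordered_disc J p' q' = (-1) ^ card I * ordered_disc J' p' q' * (\<mu> ^ card I * S)\<^sup>2"
    unfolding J(1) ordered_disc_insert[OF J(2,3)] SL card by (rule refl)
  show ?case
  proof (cases "card I")
    case 0
    then have "I = {}" "J' = {}" using insert.hyps J card by auto
    then show ?thesis using J by (simp add: ordered_disc_def)
  next
    case (Suc n)
    have n: "card (insert k I) - 1 = Suc n" using Suc insert.hyps by simp
    have alg: "s * ((c * \<mu>) ^ (2 * n) * d) * (c * \<mu> * S)\<^sup>2 =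
        c ^ (2 * Suc n) * (s * d * (\<mu> ^ Suc n * S)\<^sup>2)" for s d
    proof -
      have "c ^ (2 * Suc n) = c ^ (2 * n) * c\<^sup>2" "(\<mu> ^ Suc n * S)\<^sup>2 = \<mu> ^ (2 * n) * \<mu>\<^sup>2 * S\<^sup>2"
        by (simp_all only: mult_2 power_add power_Suc power2_eq_square add_Suc add_Suc_right
            mult.commute[of "_ :: complex"] mult.assoc[of "_ :: complex"]
            mult.left_commute[of "_ :: complex"])
      then show ?thesis by (simp only: power_mult_distrib mult_ac)
    qed
    show ?thesis unfolding 1 2 n Suc diff_Suc_1 by (rule alg)
  qed
qed

private lemma factor_disc_unique:
  assumes "linear_factorization r a p q" "linear_factorization r a p' q'"
  shows "factor_disc r p q = factor_disc r p' q'"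
proof -
  have eq: "(\<Prod>i<r. p i * x + q i * y) = (\<Prod>i<r. p' i * x + q' i * y)" for x y
    using assms unfolding linear_factorization_def by metis
  have "ordered_disc {..<r} p q = ordered_disc {..<r} p' q'"
  proof (cases "\<forall>i<r. p i \<noteq> 0 \<or> q i \<noteq> 0")
    case True
    have "ordered_disc {..<r} p q = 1 ^ (2 * (card {..<r} - 1)) * ordered_disc {..<r} p' q'"
      by (rule ordered_disc_unique) (simp_all only: eq finite_lessThan mult_1 lessThan_iff True simp_thms)
    then show ?thesis by simp
  next
    case False
    then obtain k where k: "k < r" "p k = 0" "q k = 0" by auto
    then have "(\<Prod>i<r. p i * x + q i * y) = 0" for x y
      by (metis add_0 finite_lessThan lessThan_iff mult_zero_left prod_zero)
    then have "(\<Prod>i<r. p' i * x + q' i * y) = 0" for x y by (simp only: eq)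
    then have "\<not> (\<forall>i\<in>{..<r}. p' i \<noteq> 0 \<or> q' i \<noteq> 0)"
      using linear_forms_nonvanishing[of "{..<r}" p' q'] by (metis finite_lessThan)
    then obtain l where l: "l < r" "p' l = 0" "q' l = 0" by auto
    show ?thesis
    proof (cases "r \<ge> 2")
      case True
      then show ?thesis using k l ordered_disc_zero[of "{..<r}" k p q]
          ordered_disc_zero[of "{..<r}" l p' q'] by simp
    next
      case False
      then have "r = 1" using k by simp
      then show ?thesis by (simp add: ordered_disc_def)
    qed
  qed
  moreover obtain e where "e \<noteq> 0" "\<And>p q. ordered_disc {..<r} p q = e * factor_disc r p q"
    using factor_disc_ordered[of r] by blast
  ultimately show ?thesis by simp
qed

lemma form_disc_eq:
  assumes "linear_factorization r a p q"
  shows "form_disc r a = factor_disc r p q"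
  unfolding form_disc_def
proof (rule the_equality)
  show "\<exists>p' q'. linear_factorization r a p' q' \<and> factor_disc r p q = factor_disc r p' q'"
    using assms by blast
next
  fix d
  assume "\<exists>p' q'. linear_factorization r a p' q' \<and> d = factor_disc r p' q'"
  then obtain p' q' where "linear_factorization r a p' q'" "d = factor_disc r p' q'" by blast
  then show "d = factor_disc r p q" using factor_disc_unique[OF _ assms] by simp
qed

end

lemma diagonalizable_factorization:
  assumes "diagonalizable r a" "r > 0"
  shows "\<exists>p q. linear_factorization r a p q"
proof -
  obtain \<alpha> \<beta> \<gamma> \<delta> where d: "\<And>x y :: complex. form_eval r a x y =
      (\<alpha> * x + \<beta> * y) ^ r - (\<gamma> * x + \<delta> * y) ^ r"
    using assms(1) unfolding diagonalizable_def diagonalization_def by blast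
  let ?P = "monom 1 r - 1 :: complex poly"
  have deg: "degree ?P = r" 
    using assms(2) degree_add_eq_left[of "- 1" "monom (1 :: complex) r"] by (simp add: degree_monom_eq)
  have lc: "lead_coeff ?P = 1" unfolding deg using assms(2) by simp
  have "?P \<noteq> 0" using deg assms(2) by (metis degree_0 less_irrefl)
  then obtain A where A: "size A = degree ?P" "?P = smult (lead_coeff ?P) (\<Prod>x\<in>#A. [:-x, 1:])"
    using alg_closed_imp_factorization by blast
  obtain zs where zs: "mset zs = A" using ex_mset by blast
  have len: "length zs = r" using A(1) deg zs by (metis size_mset)
  have "?P = (\<Prod>x\<in>#mset zs. [:-x, 1:])" using A(2) unfolding lc zs by simp
  also have "\<dots> = (\<Prod>i<r. [:- (zs ! i), 1:])"
    by (simp add: prod_mset_prod_list prod.list_conv_set_nth len atLeast0LessThan flip: mset_map)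
  finally have P: "?P = (\<Prod>i<r. [:- (zs ! i), 1:])" .
  have z: "z ^ r - 1 = (\<Prod>i<r. z - zs ! i)" for z
    using arg_cong[OF P, of "\<lambda>p. poly p z"] by (simp add: poly_prod poly_monom)
  have uv: "u ^ r - v ^ r = (\<Prod>i<r. u - zs ! i * v)" for u v :: complex
  proof (cases "v = 0")
    case True
    then show ?thesis using assms(2) by simp
  next
    case False
    then have "u ^ r - v ^ r = v ^ r * ((u / v) ^ r - 1)"
      by (simp add: field_simps power_divide)
    also have "\<dots> = (\<Prod>i<r. v * (u / v - zs ! i))" unfolding z prod.distrib by simp
    also have "\<dots> = (\<Prod>i<r. u - zs ! i * v)"
      using False by (intro prod.cong) (auto simp: field_simps)
    finally show ?thesis .
  qed
  have "linear_factorization r a (\<lambda>i. \<alpha> - zs ! i * \<gamma>) (\<lambda>i. \<beta> - zs ! i * \<delta>)"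
    unfolding linear_factorization_def d uv by (intro allI prod.cong) (auto simp: algebra_simps)
  then show ?thesis by blast
qed


section \<open>Existence of the integral quadratic form\<close>

lemma diagonalization_coeff:
  assumes "diagonalization r a \<alpha> \<beta> \<gamma> \<delta>" "k \<le> r"
  shows "of_int (a k) = of_nat (r choose k) * (\<alpha> ^ (r - k) * \<beta> ^ k - \<gamma> ^ (r - k) * \<delta> ^ k)"
proof -
  have "(\<Sum>i\<le>r. of_int (a i) * y ^ i) =
      (\<Sum>i\<le>r. of_nat (r choose i) * (\<alpha> ^ (r - i) * \<beta> ^ i - \<gamma> ^ (r - i) * \<delta> ^ i) * y ^ i)" for y
  proof -
    have "(\<Sum>i\<le>r. of_int (a i) * y ^ i) = (\<beta> * y + \<alpha>) ^ r - (\<delta> * y + \<gamma>) ^ r"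
      using assms(1) unfolding diagonalization_def form_eval_def
      by (metis (no_types, lifting) add.commute mult.right_neutral power_one sum.cong)
    also have "\<dots> = (\<Sum>i\<le>r. of_nat (r choose i) * (\<alpha> ^ (r - i) * \<beta> ^ i - \<gamma> ^ (r - i) * \<delta> ^ i) * y ^ i)"
      unfolding binomial_ring sum_subtractf[symmetric]
      by (intro sum.cong) (auto simp: algebra_simps)
    finally show ?thesis .
  qed
  then have "\<forall>i\<le>r. of_int (a i) =
      of_nat (r choose i) * (\<alpha> ^ (r - i) * \<beta> ^ i - \<gamma> ^ (r - i) * \<delta> ^ i)"
    by (subst polyfun_eq_coeffs[symmetric]) simp
  then show ?thesis using assms(2) by blast
qed

text \<open>The vector \<open>(\<beta> \<delta>, - (\<alpha> \<delta> + \<beta> \<gamma>), \<alpha> \<gamma>)\<close> is orthogonal to \<open>(s k, s (k+1), s (k+2))\<close> for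
  \<open>s k = \<alpha>^(r-k) \<beta>^k - \<gamma>^(r-k) \<delta>^k\<close>, hence proportional to a cross product of two such vectors.\<close>

lemma proportional_integral:
  fixes \<alpha> \<beta> \<gamma> \<delta> :: complex and M :: int
  assumes "M \<noteq> 0" "\<alpha> * \<gamma> \<noteq> 0" "\<alpha> * \<delta> - \<beta> * \<gamma> \<noteq> 0"
    and s: "\<And>k. k \<le> 3 \<Longrightarrow>
      \<exists>b. of_int b = of_int M * (\<alpha> ^ (n + 3 - k) * \<beta> ^ k - \<gamma> ^ (n + 3 - k) * \<delta> ^ k)"
  shows "\<exists>A B C \<kappa>. \<alpha> * \<gamma> = \<kappa> * of_int A \<and> \<alpha> * \<delta> + \<beta> * \<gamma> = \<kappa> * of_int B \<and> \<beta> * \<delta> = \<kappa> * of_int C"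
proof -
  obtain b where b: "\<And>k. k \<le> 3 \<Longrightarrow>
      of_int (b k) = of_int M * (\<alpha> ^ (n + 3 - k) * \<beta> ^ k - \<gamma> ^ (n + 3 - k) * \<delta> ^ k)"
    using s by metis
  have e: "n + 3 - 1 = n + 2" "n + 3 - 2 = n + 1" by simp_all
  have b0: "of_int (b 0) = of_int M * (\<alpha> ^ n * \<alpha> ^ 3 - \<gamma> ^ n * \<gamma> ^ 3)"
    using b[of 0] by (simp add: power_add)
  have b1: "of_int (b 1) = of_int M * (\<alpha> ^ n * \<alpha>\<^sup>2 * \<beta> - \<gamma> ^ n * \<gamma>\<^sup>2 * \<delta>)"
    using b[of 1] unfolding e by (simp add: power_add power2_eq_square mult_ac)
  have b2: "of_int (b 2) = of_int M * (\<alpha> ^ n * \<alpha> * \<beta>\<^sup>2 - \<gamma> ^ n * \<gamma> * \<delta>\<^sup>2)"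
    using b[of 2] unfolding e by (simp add: power_add power2_eq_square mult_ac)
  have b3: "of_int (b 3) = of_int M * (\<alpha> ^ n * \<beta> ^ 3 - \<gamma> ^ n * \<delta> ^ 3)"
    using b[of 3] by simp
  define w where "w = - ((of_int M)\<^sup>2 * (\<alpha> ^ n * \<gamma> ^ n) * (\<alpha> * \<delta> - \<beta> * \<gamma>)\<^sup>2)"
  have w: "w \<noteq> 0" using assms(1-3) by (auto simp: w_def)
  have "of_int (b 0 * b 2 - (b 1)\<^sup>2) = w * (\<alpha> * \<gamma>)"
    unfolding of_int_diff of_int_mult of_int_power b0 b1 b2 w_def by (simp add: algebra_simps power2_eq_square power3_eq_cube)
  moreover have "of_int (b 0 * b 3 - b 1 * b 2) = w * (\<alpha> * \<delta> + \<beta> * \<gamma>)"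
    unfolding of_int_diff of_int_mult of_int_power b0 b1 b2 b3 w_def by (simp add: algebra_simps power2_eq_square power3_eq_cube)
  moreover have "of_int (b 1 * b 3 - (b 2)\<^sup>2) = w * (\<beta> * \<delta>)"
    unfolding of_int_diff of_int_mult of_int_power b1 b2 b3 w_def by (simp add: algebra_simps power2_eq_square power3_eq_cube)
  ultimately show ?thesis using w
    by (intro exI[of _ "b 0 * b 2 - (b 1)\<^sup>2"] exI[of _ "b 0 * b 3 - b 1 * b 2"]
        exI[of _ "b 1 * b 3 - (b 2)\<^sup>2"] exI[of _ "1 / w"]) simp
qed

lemma quadratic_of_exists:
  assumes "diagonalizable r a" "r \<ge> 3"
  shows "\<exists>A B C. quadratic_of r a A B C"
proof -
  obtain \<alpha> \<beta> \<gamma> \<delta> where d: "diagonalization r a \<alpha> \<beta> \<gamma> \<delta>"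
    using assms(1) unfolding diagonalizable_def by blast
  have j: "\<alpha> * \<delta> - \<beta> * \<gamma> \<noteq> 0" using d unfolding diagonalization_def by blast
  obtain n where r: "r = n + 3" using assms(2) by (metis add.commute le_Suc_ex)
  define M where "M = int ((r choose 1) * (r choose 2) * (r choose 3))"
  have M: "M \<noteq> 0" using assms(2) by (simp add: M_def)
  have "\<exists>b. of_int b = (of_int M :: complex) * s"
    if c: "of_int c = of_nat e * s" and e: "int e dvd M" for c e and s :: complex
  proof -
    obtain f where "M = int e * f" using e by blast
    then have "of_int (c * f) = (of_int M :: complex) * s" using c by simp
    then show ?thesis by blast
  qed
  note ex = this
  have dvd: "int (r choose k) dvd M" if "k \<le> 3" for k
  proof -
    have "k = 0 \<or> k = 1 \<or> k = 2 \<or> k = 3" using that by linarith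
    then show ?thesis unfolding M_def by auto
  qed
  have "\<exists>A B C \<kappa>. \<alpha> * \<gamma> = \<kappa> * of_int A \<and> \<alpha> * \<delta> + \<beta> * \<gamma> = \<kappa> * of_int B \<and> \<beta> * \<delta> = \<kappa> * of_int C"
  proof -
    consider "\<alpha> * \<gamma> \<noteq> 0" | "\<beta> * \<delta> \<noteq> 0" | "\<alpha> * \<gamma> = 0" "\<beta> * \<delta> = 0" by blast
    then show ?thesis
    proof cases
      case 1
      show ?thesis
      proof (rule proportional_integral[OF M 1 j, of n])
        fix k :: nat assume k: "k \<le> 3"
        show "\<exists>b. of_int b = of_int M * (\<alpha> ^ (n + 3 - k) * \<beta> ^ k - \<gamma> ^ (n + 3 - k) * \<delta> ^ k)"
          using ex[OF diagonalization_coeff[OF d, of k] dvd[OF k]] k r by simp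
      qed
    next
      case 2
      have "\<exists>A B C \<kappa>. \<beta> * \<delta> = \<kappa> * of_int A \<and> \<beta> * \<gamma> + \<alpha> * \<delta> = \<kappa> * of_int B \<and> \<alpha> * \<gamma> = \<kappa> * of_int C"
      proof (rule proportional_integral[OF M 2, of \<gamma> \<alpha> n])
        show "\<beta> * \<gamma> - \<alpha> * \<delta> \<noteq> 0" using j by auto
      next
        fix k :: nat assume k: "k \<le> 3"
        have rk: "r - (r - k) = k" "r choose (r - k) = r choose k"
          using k r by (simp_all add: binomial_symmetric[symmetric])
        have "of_int (a (r - k)) =
            of_nat (r choose k) * (\<beta> ^ (r - k) * \<alpha> ^ k - \<delta> ^ (r - k) * \<gamma> ^ k)"
          using diagonalization_coeff[OF d, of "r - k"] unfolding rk by (simp add: mult_ac)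
        from ex[OF this dvd[OF k]]
        show "\<exists>b. of_int b = of_int M * (\<beta> ^ (n + 3 - k) * \<alpha> ^ k - \<delta> ^ (n + 3 - k) * \<gamma> ^ k)"
          unfolding r by simp
      qed
      then show ?thesis by (metis add.commute)
    next
      case 3
      then show ?thesis
        by (intro exI[of _ 0] exI[of _ 1] exI[of _ "\<alpha> * \<delta> + \<beta> * \<gamma>"]) simp
    qed
  qed
  then obtain A B C \<kappa> where q: "\<alpha> * \<gamma> = \<kappa> * of_int A" "\<alpha> * \<delta> + \<beta> * \<gamma> = \<kappa> * of_int B"
    "\<beta> * \<delta> = \<kappa> * of_int C" by blast
  have "(\<alpha> * x + \<beta> * y) * (\<gamma> * x + \<delta> * y) =
      \<kappa> * (of_int A * x\<^sup>2 + of_int B * x * y + of_int C * y\<^sup>2)" for x y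
  proof -
    have "(\<alpha> * x + \<beta> * y) * (\<gamma> * x + \<delta> * y) =
        (\<alpha> * \<gamma>) * x\<^sup>2 + (\<alpha> * \<delta> + \<beta> * \<gamma>) * (x * y) + (\<beta> * \<delta>) * y\<^sup>2"
      by (simp add: algebra_simps power2_eq_square)
    then show ?thesis unfolding q by (simp add: algebra_simps)
  qed
  then show ?thesis using d unfolding quadratic_of_def by blast
qed

end

(* Write F = xi^r - eta^r with linear forms xi, eta, let j be their determinant and D the
   discriminant of a primitive integral multiple of xi * eta.  The hypothesis says that
   (|j| / 2)^r / h^2 is larger than a certain power of r and h.

   The solutions are distributed over the r-th roots of unity omega for which eta is close to
   omega * xi: if D < 0 then |xi| = |eta| at integral points and every omega may occur, if D > 0 then
   xi^r and eta^r are real at integral points, and at large solutions only one omega, up to sign,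
   occurs.  If D > 0 and F is definite there are no large solutions at all.

   For two different solutions p, q the number xi(p) eta(q) - xi(q) eta(p) is a nonzero integral
   multiple of j.  Hence the sizes of the solutions that belong to one omega grow like iterated
   (r-1)-th powers, and the hypothesis makes the last two of m + 1 such solutions p, q large in terms
   of r and h.  These are excluded by the method of Thue and Siegel: substituting the diagonal Pade
   approximants of w^(1/r) at w = (eta(p) / xi(p))^r one gets combinations of xi(p) eta(q) and
   xi(q) eta(p) which, up to a bounded denominator, are integral multiples of j, which do not both
   vanish for two consecutive degrees, and which are too small. *)
theory Submission
  imports Defs
begin

text \<open>The discriminant enters only through its absolute value r^r |j|^(r(r-1)), which makes
  \<Delta>' the (r-1)-th power of \<kappa> = (|j|/2)^r / h^2. The obstacle is arithmetic: \<xi> and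
  \<eta> have arbitrary complex coefficients, so a combination of their values has no evident lower
  bound. Integers are only F = \<xi>^r - \<eta>^r and, as a Jacobian, w (\<xi>^r + \<eta>^r) with w
  = r sqrt(D); hence 2 w \<xi>^r and 2 w \<eta>^r have the conjugate shapes a + b w and a - b w.
  Each Pade degree thus costs a factor 2 r sqrt|D|, besides r^2 for the coefficients. Because A, B,
  C are primitive, |D| is bounded in terms of r and |j|, hence of r, h and \<kappa>, and the total
  cost per degree stays below X^(4/9), where X is the r-th power of the size of p divided by h. As
  only one of two consecutive combinations is known to be nonzero, the degree has to be such that it
  and its successor both lead to a contradiction. Several of the numerical inequalities become
  equalities at r = 5.\<close>

section \<open>Pade approximants of the r-th root\<close>

text \<open>Write \<open>f k b\<close> for the left-hand side.  Vandermonde's identity gives \<open>f k b = b * f k 1\<close> modulo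
  \<open>r^2\<close>, and \<open>f k r\<close> is visibly divisible by \<open>r^2\<close>.\<close>

lemma gbinomial_fraction_dvd:
  fixes r k b :: nat
  assumes "r > 0" "k > 0"
  shows "\<exists>c::int. real r ^ (2 * k) * ((real b / real r) gchoose k) = real r * of_int c"
  using assms(2)
proof (induction k arbitrary: b rule: less_induct)
  case (less k)
  define f where "f = (\<lambda>i b. real r ^ (2 * i) * ((real b / real r) gchoose i))"
  have f0: "f 0 b = 1" for b by (simp add: f_def)
  have add: "f k (b + 1) = f k b + f k 1 + (\<Sum>i\<in>{1..<k}. f i b * f (k - i) 1)" for b
  proof -
    have "f k (b + 1) = real r ^ (2 * k) * ((real b / real r + real 1 / real r) gchoose k)"
      by (simp add: f_def add_divide_distrib add.commute)
    also have "\<dots> = (\<Sum>i\<le>k. real r ^ (2 * k) * (((real b / real r) gchoose i) * ((real 1 / real r) gchoose (k - i))))"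
      by (simp add: gbinomial_Vandermonde[symmetric] sum_distrib_left atMost_atLeast0)
    also have "\<dots> = (\<Sum>i\<le>k. f i b * f (k - i) 1)"
    proof (rule sum.cong)
      fix i assume "i \<in> {..k}"
      then have "2 * k = 2 * i + 2 * (k - i)" by auto
      then have "real r ^ (2 * k) = real r ^ (2 * i) * real r ^ (2 * (k - i))"
        by (metis power_add)
      then show "real r ^ (2 * k) * (((real b / real r) gchoose i) * ((real 1 / real r) gchoose (k - i)))
          = f i b * f (k - i) 1" by (simp add: f_def)
    qed simp
    also have "{..k} = insert 0 (insert k {1..<k})" using less.prems by auto
    also have "(\<Sum>i\<in>insert 0 (insert k {1..<k}). f i b * f (k - i) 1) =
        f k b + f k 1 + (\<Sum>i\<in>{1..<k}. f i b * f (k - i) 1)"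
      using less.prems by (simp add: f0)
    finally show ?thesis .
  qed
  \<comment> \<open>The inner terms of \<open>add\<close> are products of two values of smaller
    index, each divisible by \<open>r\<close>; this is where the modulus \<open>r^2\<close> comes
    from.\<close>
  have IH: "\<exists>c::int. f i b = real r * of_int c" if "1 \<le> i" "i < k" for i b
    using less.IH[of i b] that by (auto simp: f_def)
  have lin: "\<exists>c::int. f k b = real b * f k 1 + (real r)\<^sup>2 * of_int c" for b
  proof (induction b)
    case 0
    show ?case using less.prems by (intro exI[of _ 0]) (cases k, auto simp: f_def)
  next
    case (Suc b)
    then obtain c :: int where c: "f k b = real b * f k 1 + (real r)\<^sup>2 * of_int c" by blast
    obtain d :: "nat \<Rightarrow> nat \<Rightarrow> int" where d: "\<And>i b. 1 \<le> i \<Longrightarrow> i < k \<Longrightarrow> f i b = real r * of_int (d i b)"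
      using IH by metis
    have "(\<Sum>i\<in>{1..<k}. f i b * f (k - i) 1) =
        (\<Sum>i\<in>{1..<k}. (real r)\<^sup>2 * of_int (d i b * d (k - i) 1))"
      by (rule sum.cong) (auto simp: d power2_eq_square)
    then have "f k (Suc b) = real (Suc b) * f k 1 +
        (real r)\<^sup>2 * of_int (c + (\<Sum>i\<in>{1..<k}. d i b * d (k - i) 1))"
      using add[of b] c by (simp add: algebra_simps sum_distrib_left)
    then show ?case by blast
  qed
  have "\<exists>c::int. f k r = (real r)\<^sup>2 * of_int c"
  proof (cases "k = 1")
    case True
    then show ?thesis using assms(1) by (intro exI[of _ 1]) (simp add: f_def)
  next
    case False
    then have "(1::real) gchoose k = 0"
      using less.prems binomial_gbinomial[of 1 k, where 'a = real] by (simp add: binomial_eq_0)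
    then show ?thesis using assms(1) by (intro exI[of _ 0]) (simp add: f_def)
  qed
  then obtain c d :: int where "(real r)\<^sup>2 * of_int c = real r * f k 1 + (real r)\<^sup>2 * of_int d"
    using lin[of r] by metis
  then have "real r * f k 1 = real r * (real r * of_int (c - d))"
    by (simp add: power2_eq_square algebra_simps)
  then have 1: "f k 1 = real r * of_int (c - d)" using assms(1) by simp
  obtain e :: int where "f k b = real b * f k 1 + (real r)\<^sup>2 * of_int e"
    using lin by blast
  then have "f k b = real r * of_int (int b * (c - d) + int r * e)"
    unfolding 1 by (simp add: algebra_simps power2_eq_square)
  then show ?case unfolding f_def by blast
qed

text \<open>The sum is the divided difference of \<open>p\<close> at the nodes, that is, the
  coefficient of degree \<open>card I - 1\<close> of the Lagrange interpolant \<open>L\<close>. The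
  interpolant is \<open>p\<close> itself, whose degree is too small for this coefficient.\<close>

lemma sum_divided_difference:
  fixes e :: "'i \<Rightarrow> 'a :: field" and p :: "'a poly"
  assumes "finite I" "inj_on e I" "Suc (degree p) < card I"
  shows "(\<Sum>i\<in>I. poly p (e i) / (\<Prod>j\<in>I - {i}. e i - e j)) = 0"
proof -
  define q where "q = (\<lambda>i. \<Prod>j\<in>I - {i}. [:- e j, 1:])"
  define w where "w = (\<lambda>i. \<Prod>j\<in>I - {i}. e i - e j)"
  define L where "L = (\<Sum>i\<in>I. smult (poly p (e i) / w i) (q i))"
  have w: "w i \<noteq> 0" if "i \<in> I" for i
    using that assms(1,2) by (auto simp: w_def inj_on_def)
  have degq: "degree (q i) = card I - 1" and lcq: "coeff (q i) (card I - 1) = 1" if "i \<in> I" for i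
  proof -
    show d: "degree (q i) = card I - 1"
      unfolding q_def using that assms(1) by (subst degree_prod_eq_sum_degree) auto
    have "lead_coeff (q i) = 1" unfolding q_def by (simp add: lead_coeff_prod)
    then show "coeff (q i) (card I - 1) = 1" using d by simp
  qed
  have "poly L (e k) = poly p (e k)" if k: "k \<in> I" for k
  proof -
    have "poly (q i) (e k) = (if i = k then w k else 0)" if "i \<in> I" for i
      using that k assms(1) by (auto simp: q_def w_def poly_prod intro!: prod_zero)
    then have "poly L (e k) = (\<Sum>i\<in>I. if i = k then poly p (e k) else 0)"
      unfolding L_def poly_sum using w k by (intro sum.cong) auto
    then show ?thesis using k assms(1) by simp
  qed
  then have roots: "e ` I \<subseteq> {x. poly (L - p) x = 0}" by auto
  have deg: "degree (L - p) \<le> card I - 1"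
  proof (rule degree_diff_le)
    show "degree L \<le> card I - 1"
      unfolding L_def using degq by (intro degree_sum_le assms(1)) (metis degree_smult_le)
  qed (use assms(3) in auto)
  have "L - p = 0"
  proof (rule ccontr)
    assume nz: "L - p \<noteq> 0"
    then have "card (e ` I) \<le> degree (L - p)"
      using card_mono[OF poly_roots_finite[OF nz] roots] card_poly_roots_bound[OF nz] by linarith
    then show False using deg assms(2,3) by (simp add: card_image)
  qed
  then have "coeff L (card I - 1) = coeff p (card I - 1)" by simp
  also have "\<dots> = 0" using assms(3) by (intro coeff_eq_0) auto
  also have "coeff L (card I - 1) = (\<Sum>i\<in>I. poly p (e i) / w i)"
    unfolding L_def coeff_sum using lcq by (intro sum.cong) auto
  finally show ?thesis unfolding w_def .
qed

text \<open>\<open>f\<close> takes integers because the differences \<open>k - l\<close> have both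
  signs. It serves both for the product without its zero factor and for the products shifted by
  \<nu>.\<close>

lemma prod_shifted_split:
  fixes f :: "int \<Rightarrow> 'a :: comm_monoid_mult"
  assumes "k \<le> n"
  shows "(\<Prod>l\<le>n. f (int k - int l)) = (\<Prod>d\<le>k. f (int d)) * (\<Prod>d=1..n - k. f (- int d))"
proof -
  have "{..n} = {..k} \<union> {k+1..n}" using assms by auto
  then have "(\<Prod>l\<le>n. f (int k - int l)) =
      (\<Prod>l\<le>k. f (int k - int l)) * (\<Prod>l=k+1..n. f (int k - int l))"
    by (simp add: prod.union_disjoint ivl_disj_int)
  also have "(\<Prod>l\<le>k. f (int k - int l)) = (\<Prod>d\<le>k. f (int d))"
    by (rule prod.reindex_bij_witness[of _ "\<lambda>d. k - d" "\<lambda>l. k - l"]) (auto simp: of_nat_diff)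
  also have "(\<Prod>l=k+1..n. f (int k - int l)) = (\<Prod>d=1..n - k. f (- int d))"
    by (rule prod.reindex_bij_witness[of _ "\<lambda>d. k + d" "\<lambda>l. l - k"]) (auto simp: of_nat_diff)
  finally show ?thesis .
qed

text \<open>For the exponent \<open>\<nu>\<close> write \<open>c k\<close> for this coefficient.  Then \<open>\<Sum>k\<le>n. c k * w^k\<close> and
  \<open>\<Sum>k\<le>n. c (n - k) * w^k\<close> are the numerator and the denominator of the diagonal Pade approximant
  of \<open>w powr \<nu>\<close> at \<open>w = 1\<close>.\<close>

definition pade_coeff :: "real \<Rightarrow> nat \<Rightarrow> nat \<Rightarrow> real" where
  "pade_coeff \<nu> n k = ((real n + \<nu>) gchoose k) * ((real n - \<nu>) gchoose (n - k))"

text \<open>Used for \<nu> and, with \<open>n - k\<close> in place of \<open>k\<close>, for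
  \<open>- \<nu>\<close>; hence \<nu> is an arbitrary real number here.\<close>

lemma gbinomial_prod_shift:
  fixes \<nu> :: real
  assumes "k \<le> n"
  shows "((real n + \<nu>) gchoose k) * fact k * (\<Prod>d=1..n - k. real d + \<nu>) = (\<Prod>d=1..n. real d + \<nu>)"
proof -
  have "((real n + \<nu>) gchoose k) * fact k = (\<Prod>i=0..<k. real n + \<nu> - of_nat i)"
    by (simp add: gbinomial_prod_rev)
  also have "\<dots> = (\<Prod>d=n-k+1..n. real d + \<nu>)"
    using assms
    by (intro prod.reindex_bij_witness[of _ "\<lambda>d. n - d" "\<lambda>i. n - i"]) (auto simp: of_nat_diff)
  also have "\<dots> * (\<Prod>d=1..n - k. real d + \<nu>) = (\<Prod>d\<in>{1..n-k} \<union> {n-k+1..n}. real d + \<nu>)"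
    by (subst prod.union_disjoint) (auto simp: mult.commute)
  also have "{1..n-k} \<union> {n-k+1..n} = {1..n}" using assms by auto
  finally show ?thesis .
qed

context
  fixes \<nu> :: real
  assumes \<nu>: "0 < \<nu>" "\<nu> < 1"
begin

private lemma shifted_prod_pos: "(\<Prod>d=1..k. real d + \<nu>) > 0" "(\<Prod>d=1..k. real d - \<nu>) > 0"
  using \<nu> by (auto intro!: prod_pos)

text \<open>Brings the coefficient to the shape of the products of node differences in
  \<open>sum_pade_coeff_poly\<close>. Positivity can be read off as well.\<close>

lemma pade_coeff_eq:
  assumes "k \<le> n"
  shows "pade_coeff \<nu> n k = (\<Prod>d=1..n. real d + \<nu>) * (\<Prod>d=1..n. real d - \<nu>) /
    (fact k * fact (n - k) * (\<Prod>d=1..n - k. real d + \<nu>) * (\<Prod>d=1..k. real d - \<nu>))"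
proof -
  have 1: "((real n + \<nu>) gchoose k) =
      (\<Prod>d=1..n. real d + \<nu>) / (fact k * (\<Prod>d=1..n - k. real d + \<nu>))"
    using gbinomial_prod_shift[OF assms, of \<nu>] shifted_prod_pos(1)[of "n - k"]
    by (subst nonzero_eq_divide_eq) (simp_all add: mult_ac less_imp_neq del: prod_zero_iff)
  have 2: "((real n - \<nu>) gchoose (n - k)) =
      (\<Prod>d=1..n. real d - \<nu>) / (fact (n - k) * (\<Prod>d=1..k. real d - \<nu>))"
    using gbinomial_prod_shift[of "n - k" n "- \<nu>"] shifted_prod_pos(2)[of k] assms
    by (subst nonzero_eq_divide_eq) (simp_all add: mult_ac less_imp_neq del: prod_zero_iff)
  show ?thesis unfolding pade_coeff_def 1 2 by simp
qed

lemma pade_coeff_pos: "k \<le> n \<Longrightarrow> pade_coeff \<nu> n k > 0"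
  unfolding pade_coeff_eq by (intro divide_pos_pos mult_pos_pos shifted_prod_pos) auto

text \<open>The upper arguments \<open>n + \<nu>\<close> and \<open>n - \<nu>\<close> add up to
  \<open>2 * n\<close>, so Vandermonde's identity removes \<nu>.\<close>

lemma sum_pade_coeff: "(\<Sum>k\<le>n. pade_coeff \<nu> n k) = real ((2 * n) choose n)"
  unfolding pade_coeff_def atMost_atLeast0 gbinomial_Vandermonde binomial_gbinomial by simp

lemma sum_pade_coeff_le: "(\<Sum>k\<le>n. pade_coeff \<nu> n k) \<le> 4 ^ n"
proof -
  have "(2 * n) choose n \<le> 2 ^ (2 * n)" by (rule binomial_le_pow2)
  then have "real ((2 * n) choose n) \<le> 4 ^ n"
    by (metis of_nat_le_iff of_nat_numeral of_nat_power power2_eq_square power_mult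
        numeral_times_numeral semiring_norm(12) semiring_norm(13))
  then show ?thesis by (simp add: sum_pade_coeff)
qed

text \<open>The weights are those of the divided difference on the nodes \<open>k\<close> and \<open>k + \<nu>\<close>.\<close>

lemma sum_pade_coeff_poly:
  fixes p :: "real poly"
  assumes "degree p \<le> 2 * n"
  shows "(\<Sum>k\<le>n. pade_coeff \<nu> n k * poly p (real k)) =
    (\<Sum>k\<le>n. pade_coeff \<nu> n (n - k) * poly p (real k + \<nu>))"
proof -
  \<comment> \<open>A disjoint sum, since there are two families of nodes, \<open>k\<close> and
    \<open>k + \<nu>\<close>; by \<open>ne\<close> they do not meet.\<close>
  define I where "I = {..n} <+> {..n}"
  define e where "e = case_sum real (\<lambda>k. real k + \<nu>)"
  define c where "c = (\<Prod>d=1..n. real d + \<nu>) * (\<Prod>d=1..n. real d - \<nu>)"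
  have ne: "real k \<noteq> real l + \<nu>" for k l
  proof
    assume "real k = real l + \<nu>"
    then have "real_of_int (int k - int l) = \<nu>" by simp
    then have "0 < int k - int l" "int k - int l < 1" using \<nu> by linarith+
    then show False by linarith
  qed
  have inj: "inj_on e I"
    unfolding inj_on_def e_def I_def using ne by (auto simp: Plus_def) (metis ne)+
  have own: "(\<Prod>l\<in>{..n} - {k}. real k - real l) = (-1) ^ (n - k) * (fact k * fact (n - k))"
    if "k \<le> n" for k
  proof -
    \<comment> \<open>With the zero factor replaced by one, the product may run over all
      \<open>l\<close>, and \<open>prod_shifted_split\<close> applies.\<close>
    let ?f = "\<lambda>x :: int. if x = 0 then 1 else real_of_int x"
    have "(\<Prod>l\<in>{..n} - {k}. real k - real l) = (\<Prod>l\<in>{..n} - {k}. ?f (int k - int l))"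
      by (intro prod.cong) auto
    also have "\<dots> = (\<Prod>l\<le>n. ?f (int k - int l))"
      by (rule prod.mono_neutral_left) auto
    also have "\<dots> = (\<Prod>d\<le>k. ?f (int d)) * (\<Prod>d=1..n - k. ?f (- int d))"
      by (rule prod_shifted_split[OF that])
    also have "(\<Prod>d\<le>k. ?f (int d)) = (\<Prod>d=1..k. real d)"
      by (rule prod.mono_neutral_cong_right) auto
    also have "(\<Prod>d=1..k. real d) = fact k" by (simp add: fact_prod)
    also have "(\<Prod>d=1..n - k. ?f (- int d)) = (\<Prod>d=1..n - k. (-1) * real d)"
      by (rule prod.cong) auto
    also have "\<dots> = (-1) ^ (n - k) * fact (n - k)"
      by (simp only: prod.distrib prod_constant) (simp add: fact_prod)
    finally show ?thesis by (simp add: mult_ac)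
  qed
  have other: "(\<Prod>l\<le>n. real k - real l + s) =
      (-1) ^ (n - k) * (s * (\<Prod>d=1..k. real d + s) * (\<Prod>d=1..n-k. real d - s))" if "k \<le> n" for k s
  proof -
    have "(\<Prod>l\<le>n. real k - real l + s) = (\<Prod>l\<le>n. of_int (int k - int l) + s)" by simp
    also have "\<dots> = (\<Prod>d\<le>k. real d + s) * (\<Prod>d=1..n - k. - real d + s)"
      using prod_shifted_split[OF that, of "\<lambda>x. of_int x + s"] by simp
    also have "(\<Prod>d\<le>k. real d + s) = s * (\<Prod>d=1..k. real d + s)"
      by (simp add: atMost_atLeast0 prod.atLeast_Suc_atMost)
    also have "(\<Prod>d=1..n - k. - real d + s) = (\<Prod>d=1..n - k. (-1) * (real d - s))"
      by (rule prod.cong) auto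
    also have "\<dots> = (-1) ^ (n - k) * (\<Prod>d=1..n-k. real d - s)"
      by (simp only: prod.distrib prod_constant) simp
    finally show ?thesis by (simp add: mult_ac)
  qed
  \<comment> \<open>The signs \<open>(-1) ^ (n - k)\<close> of \<open>own\<close> and
    \<open>other\<close> cancel. What remains is \<open>s\<close>, which is \<open>- \<nu>\<close>
    here and \<nu> in the second formula; hence the two sums get opposite signs.\<close>
  have 1: "c / (\<Prod>j\<in>I - {Inl k}. e (Inl k) - e j) = - pade_coeff \<nu> n k / \<nu>" if k: "k \<le> n" for k
  proof -
    have "I - {Inl k} = ({..n} - {k}) <+> {..n}" by (auto simp: I_def)
    then have "(\<Prod>j\<in>I - {Inl k}. e (Inl k) - e j) =
        (\<Prod>l\<in>{..n} - {k}. real k - real l) * (\<Prod>l\<le>n. real k - real l + (- \<nu>))"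
      by (simp add: prod.Plus e_def o_def algebra_simps)
    also have "\<dots> = - (\<nu> * (fact k * fact (n - k) * (\<Prod>d=1..n - k. real d + \<nu>) * (\<Prod>d=1..k. real d - \<nu>)))"
      unfolding own[OF k] other[OF k] by (simp add: power_mult_distrib[symmetric] mult_ac)
    finally show ?thesis using \<nu> by (simp add: pade_coeff_eq[OF k] c_def)
  qed
  have 2: "c / (\<Prod>j\<in>I - {Inr k}. e (Inr k) - e j) = pade_coeff \<nu> n (n - k) / \<nu>" if k: "k \<le> n" for k
  proof -
    have "I - {Inr k} = {..n} <+> ({..n} - {k})" by (auto simp: I_def)
    then have "(\<Prod>j\<in>I - {Inr k}. e (Inr k) - e j) =
        (\<Prod>l\<in>{..n} - {k}. real k - real l) * (\<Prod>l\<le>n. real k - real l + \<nu>)"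
      by (simp add: prod.Plus e_def o_def algebra_simps)
    also have "\<dots> = \<nu> * (fact k * fact (n - k) * (\<Prod>d=1..n - k. real d - \<nu>) * (\<Prod>d=1..k. real d + \<nu>))"
      unfolding own[OF k] other[OF k] by (simp add: power_mult_distrib[symmetric] mult_ac)
    finally show ?thesis using \<nu> k by (simp add: pade_coeff_eq[of "n - k" n] c_def mult_ac)
  qed
  have "(\<Sum>i\<in>I. poly p (e i) / (\<Prod>j\<in>I - {i}. e i - e j)) = 0"
    by (rule sum_divided_difference) (use inj assms in \<open>auto simp: I_def card_Plus\<close>)
  then have "0 = c * (\<Sum>i\<in>I. poly p (e i) / (\<Prod>j\<in>I - {i}. e i - e j))" by simp
  also have "\<dots> = (\<Sum>i\<in>I. poly p (e i) * (c / (\<Prod>j\<in>I - {i}. e i - e j)))"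
    by (simp add: sum_distrib_left mult_ac)
  also have "\<dots> = (\<Sum>k\<le>n. poly p (real k) * (c / (\<Prod>j\<in>I - {Inl k}. e (Inl k) - e j))) +
      (\<Sum>k\<le>n. poly p (real k + \<nu>) * (c / (\<Prod>j\<in>I - {Inr k}. e (Inr k) - e j)))"
    by (subst (1) I_def) (simp add: sum.Plus e_def)
  also have "\<dots> = (\<Sum>k\<le>n. poly p (real k) * (- pade_coeff \<nu> n k / \<nu>)) +
      (\<Sum>k\<le>n. poly p (real k + \<nu>) * (pade_coeff \<nu> n (n - k) / \<nu>))"
    using 1 2 by simp
  also have "\<dots> = ((\<Sum>k\<le>n. pade_coeff \<nu> n (n - k) * poly p (real k + \<nu>)) -
      (\<Sum>k\<le>n. pade_coeff \<nu> n k * poly p (real k))) / \<nu>"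
    by (simp add: sum_divide_distrib diff_divide_distrib sum_negf mult.commute)
  finally show ?thesis using \<nu> by simp
qed

end

text \<open>The power of \<open>r\<close> splits into \<open>r ^ (2 * k)\<close> and
  \<open>r ^ (2 * (n - k))\<close>, one for each factor, as \<open>n + 1 / r\<close> and
  \<open>n - 1 / r\<close> are fractions with denominator \<open>r\<close>. The case
  \<open>n = 0\<close> is separate because the natural number \<open>r * n - 1\<close> would be
  truncated there.\<close>

lemma pade_coeff_integral:
  assumes "r > 1" "k \<le> n"
  shows "\<exists>c::int. real r ^ (2 * n) * pade_coeff (1 / real r) n k = of_int c"
proof -
  have *: "\<exists>c::int. real r ^ (2 * k) * ((real b / real r) gchoose k) = of_int c" for b k
  proof (cases "k = 0")
    case True
    then show ?thesis by (intro exI[of _ 1]) simp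
  next
    case False
    then obtain c :: int where "real r ^ (2 * k) * ((real b / real r) gchoose k) = real r * of_int c"
      using gbinomial_fraction_dvd[of r k b] assms(1) by auto
    then show ?thesis by (intro exI[of _ "int r * c"]) simp
  qed
  have "real n + 1 / real r = real (r * n + 1) / real r"
    using assms(1) by (simp add: field_simps)
  then obtain c :: int where c: "real r ^ (2 * k) * ((real n + 1 / real r) gchoose k) = of_int c"
    using * by metis
  obtain d :: int where d: "real r ^ (2 * (n - k)) * ((real n - 1 / real r) gchoose (n - k)) = of_int d"
  proof (cases "n = 0")
    case True
    then show ?thesis using that[of 1] by simp
  next
    case False
    then have "r * n \<ge> 1" using assms(1) by auto
    then have "real n - 1 / real r = real (r * n - 1) / real r"
      using assms(1) by (simp add: field_simps of_nat_diff)
    then show ?thesis using * that by metis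
  qed
  have "2 * n = 2 * k + 2 * (n - k)" using assms(2) by auto
  then have "real r ^ (2 * n) = real r ^ (2 * k) * real r ^ (2 * (n - k))" by (metis power_add)
  then have "real r ^ (2 * n) * pade_coeff (1 / real r) n k = of_int (c * d)"
    unfolding pade_coeff_def of_int_mult c[symmetric] d[symmetric] by simp
  then show ?thesis by blast
qed

section \<open>The approximants as polynomials, and their remainder\<close>

definition pade_num :: "nat \<Rightarrow> nat \<Rightarrow> complex poly" where
  "pade_num r n = (\<Sum>k\<le>n. monom (of_real (pade_coeff (1 / real r) n k)) k)"

definition pade_den :: "nat \<Rightarrow> nat \<Rightarrow> complex poly" where
  "pade_den r n = (\<Sum>k\<le>n. monom (of_real (pade_coeff (1 / real r) n (n - k))) k)"

lemma coeff_sum_monom_atMost: "coeff (\<Sum>k\<le>n. monom (c k) k) i = (if i \<le> n then c i else 0)"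
proof -
  have "coeff (\<Sum>k\<le>n. monom (c k) k) i = (\<Sum>k\<le>n. if k = i then c i else 0)"
    unfolding coeff_sum by (intro sum.cong) auto
  then show ?thesis by simp
qed

lemma poly_pade_num: "poly (pade_num r n) x = (\<Sum>k\<le>n. of_real (pade_coeff (1 / real r) n k) * x ^ k)"
  by (simp add: pade_num_def poly_sum poly_monom)

lemma poly_pade_den: "poly (pade_den r n) x = (\<Sum>k\<le>n. of_real (pade_coeff (1 / real r) n (n - k)) * x ^ k)"
  by (simp add: pade_den_def poly_sum poly_monom)

lemma degree_pade: "degree (pade_num r n) \<le> n" "degree (pade_den r n) \<le> n"
  unfolding pade_num_def pade_den_def
  by (auto intro!: degree_sum_le order_trans[OF degree_monom_le])

text \<open>With the root written as \<open>t = 1 + s\<close>, numerator minus \<open>t\<close>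
  times denominator at \<open>t ^ r\<close> is a polynomial in \<open>s\<close>, and these are its
  coefficients. This avoids the binomial series.\<close>

definition pade_remainder_coeff :: "nat \<Rightarrow> nat \<Rightarrow> nat \<Rightarrow> real" where
  "pade_remainder_coeff r n i =
    (\<Sum>k\<le>n. pade_coeff (1 / real r) n k * real ((r * k) choose i)) -
    (\<Sum>k\<le>n. pade_coeff (1 / real r) n (n - k) * real ((r * k + 1) choose i))"

text \<open>\<open>(r * x) gchoose i\<close> is a polynomial in \<open>x\<close> of degree at most
  \<open>i\<close>. Its values at \<open>k\<close> and \<open>k + 1 / r\<close> are the binomial
  coefficients in the two sums, so \<open>sum_pade_coeff_poly\<close> applies.\<close>

lemma pade_remainder_coeff_eq_0:
  assumes "r > 1" "i \<le> 2 * n"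
  shows "pade_remainder_coeff r n i = 0"
proof -
  define p where "p = smult (1 / fact i) (\<Prod>j<i. [:- real j, real r:])"
  have "degree p \<le> i"
  proof -
    have "degree (\<Prod>j<i. [:- real j, real r:]) \<le> (\<Sum>j<i. degree [:- real j, real r:])"
      using degree_prod_sum_le[of "{..<i}" "\<lambda>j. [:- real j, real r:]"] by (simp add: o_def)
    also have "\<dots> \<le> (\<Sum>j<i. 1)" by (intro sum_mono) simp
    finally show ?thesis unfolding p_def using degree_smult_le order_trans by fastforce
  qed
  moreover have p: "poly p x = (real r * x) gchoose i" for x
    by (simp add: p_def poly_prod gbinomial_prod_rev atLeast0LessThan mult.commute)
  ultimately show ?thesis
    using sum_pade_coeff_poly[of "1 / real r" p n] assms
    by (simp add: pade_remainder_coeff_def p binomial_gbinomial distrib_left add.commute[of 1])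
qed

lemma one_plus_power_sum:
  assumes "e \<le> N"
  shows "(1 + s) ^ e = (\<Sum>i\<le>N. of_nat (e choose i) * s ^ i :: complex)"
proof -
  have "(1 + s) ^ e = (\<Sum>i\<le>e. of_nat (e choose i) * s ^ i)"
    using binomial_ring[of s 1 e] by (simp add: add.commute)
  also have "\<dots> = (\<Sum>i\<le>N. of_nat (e choose i) * s ^ i)"
    using assms by (intro sum.mono_neutral_left) (auto simp: binomial_eq_0)
  finally show ?thesis .
qed

lemma pade_remainder_expansion:
  "poly (pade_num r n) ((1 + s) ^ r) - (1 + s) * poly (pade_den r n) ((1 + s) ^ r) =
    (\<Sum>i\<le>r * n + 1. of_real (pade_remainder_coeff r n i) * s ^ i)"
proof -
  define N where "N = r * n + 1"
  have le: "r * k \<le> N" "r * k + 1 \<le> N" if "k \<le> n" for k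
    using that by (auto simp: N_def le_SucI)
  have "poly (pade_num r n) ((1 + s) ^ r) - (1 + s) * poly (pade_den r n) ((1 + s) ^ r) =
      (\<Sum>k\<le>n. of_real (pade_coeff (1 / real r) n k) * (1 + s) ^ (r * k)) -
      (\<Sum>k\<le>n. of_real (pade_coeff (1 / real r) n (n - k)) * (1 + s) ^ (r * k + 1))"
    by (simp add: poly_pade_num poly_pade_den flip: power_mult) (simp add: sum_distrib_left mult_ac)
  also have "\<dots> =
      (\<Sum>k\<le>n. of_real (pade_coeff (1 / real r) n k) * (\<Sum>i\<le>N. of_nat ((r * k) choose i) * s ^ i)) -
      (\<Sum>k\<le>n. of_real (pade_coeff (1 / real r) n (n - k)) * (\<Sum>i\<le>N. of_nat ((r * k + 1) choose i) * s ^ i))"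
    by (intro arg_cong2[of _ _ _ _ "(-)"] sum.cong refl, simp_all only: atMost_iff one_plus_power_sum[OF le(1)] one_plus_power_sum[OF le(2)])
  also have "\<dots> = (\<Sum>i\<le>N. of_real (pade_remainder_coeff r n i) * s ^ i)"
    unfolding sum_distrib_left sum.swap[of _ "{..N}"]
    by (simp add: pade_remainder_coeff_def sum_distrib_right sum_subtractf left_diff_distrib mult.assoc)
  finally show ?thesis unfolding N_def .
qed

lemma sum_binomial_tail_le:
  assumes "\<And>k. k \<le> n \<Longrightarrow> c k \<ge> 0" "\<And>k. k \<le> n \<Longrightarrow> e k \<le> M" "finite I"
  shows "(\<Sum>i\<in>I. \<Sum>k\<le>n. c k * real (e k choose i)) \<le> (\<Sum>k\<le>n. c k) * 2 ^ M"
proof -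
  have tail: "(\<Sum>i\<in>I. real (e choose i)) \<le> 2 ^ M" if "e \<le> M" for e
  proof -
    have "(\<Sum>i\<in>I. e choose i) = (\<Sum>i\<in>I \<inter> {..e}. e choose i)"
      using assms(3) by (intro sum.mono_neutral_right) (auto simp: binomial_eq_0)
    also have "\<dots> \<le> (\<Sum>i\<le>e. e choose i)" by (intro sum_mono2) auto
    also have "\<dots> = 2 ^ e" by (rule choose_row_sum)
    also have "\<dots> \<le> 2 ^ M" using that by simp
    finally show ?thesis using of_nat_mono by fastforce
  qed
  have "(\<Sum>i\<in>I. \<Sum>k\<le>n. c k * real (e k choose i)) = (\<Sum>k\<le>n. c k * (\<Sum>i\<in>I. real (e k choose i)))"
    by (subst sum.swap) (simp add: sum_distrib_left)
  also have "\<dots> \<le> (\<Sum>k\<le>n. c k * 2 ^ M)"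
    using assms tail by (intro sum_mono mult_left_mono) auto
  finally show ?thesis by (simp add: sum_distrib_right)
qed

text \<open>Only exponents above \<open>2 * n\<close> survive, and
  \<open>cmod (t - 1) \<le> 1\<close> reduces them all to \<open>2 * n + 1\<close>. Each of the two
  sums contributes at most \<open>4 ^ n * 2 ^ (r * n + 1)\<close>, the sum of the Pade coefficients
  times a full row of binomial coefficients.\<close>

lemma pade_remainder_bound:
  fixes t :: complex
  assumes r: "r > 1" and t: "cmod (t - 1) \<le> 1"
  shows "cmod (poly (pade_num r n) (t ^ r) - t * poly (pade_den r n) (t ^ r)) \<le>
    4 * 4 ^ n * 2 ^ (r * n) * cmod (t - 1) ^ (2 * n + 1)"
proof -
  define N where "N = r * n + 1"
  define s where "s = t - 1"
  define I where "I = {2 * n + 1..N}"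
  let ?c = "pade_coeff (1 / real r) n"
  have c: "?c k \<ge> 0" if "k \<le> n" for k
    using pade_coeff_pos[of "1 / real r" k n] r that by simp
  have sc: "(\<Sum>k\<le>n. ?c k) \<le> 4 ^ n" using sum_pade_coeff_le[of "1 / real r" n] r by simp
  have sc': "(\<Sum>k\<le>n. ?c (n - k)) \<le> 4 ^ n"
    using sc sum.nat_diff_reindex[of ?c "Suc n"] by (simp add: lessThan_Suc_atMost)
  have "poly (pade_num r n) (t ^ r) - t * poly (pade_den r n) (t ^ r) =
      (\<Sum>i\<le>N. of_real (pade_remainder_coeff r n i) * s ^ i)"
    using pade_remainder_expansion[of r n s] by (simp add: s_def N_def)
  also have "\<dots> = (\<Sum>i\<in>I. of_real (pade_remainder_coeff r n i) * s ^ i)"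
  proof (rule sum.mono_neutral_right)
    show "\<forall>i\<in>{..N} - I. of_real (pade_remainder_coeff r n i) * s ^ i = 0"
    proof
      fix i assume "i \<in> {..N} - I"
      then have "i \<le> 2 * n" by (auto simp: I_def)
      then show "of_real (pade_remainder_coeff r n i) * s ^ i = 0"
        using pade_remainder_coeff_eq_0[OF r] by simp
    qed
  qed (auto simp: I_def)
  also have "cmod \<dots> \<le> (\<Sum>i\<in>I. \<bar>pade_remainder_coeff r n i\<bar> * cmod s ^ (2 * n + 1))"
  proof (rule order_trans[OF norm_sum], rule sum_mono)
    fix i assume "i \<in> I"
    then have "cmod s ^ i \<le> cmod s ^ (2 * n + 1)"
      using t by (intro power_decreasing) (auto simp: I_def s_def)
    then show "cmod (of_real (pade_remainder_coeff r n i) * s ^ i) \<le>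
        \<bar>pade_remainder_coeff r n i\<bar> * cmod s ^ (2 * n + 1)"
      unfolding norm_mult norm_power norm_of_real by (intro mult_left_mono) auto
  qed
  also have "\<dots> = (\<Sum>i\<in>I. \<bar>pade_remainder_coeff r n i\<bar>) * cmod s ^ (2 * n + 1)"
    by (simp add: sum_distrib_right)
  also have "(\<Sum>i\<in>I. \<bar>pade_remainder_coeff r n i\<bar>) \<le> 4 * 4 ^ n * 2 ^ (r * n)"
  proof -
    have "(\<Sum>i\<in>I. \<bar>pade_remainder_coeff r n i\<bar>) \<le>
        (\<Sum>i\<in>I. (\<Sum>k\<le>n. ?c k * real ((r * k) choose i)) + (\<Sum>k\<le>n. ?c (n - k) * real ((r * k + 1) choose i)))"
    proof (rule sum_mono)
      fix i
      have "(\<Sum>k\<le>n. ?c k * real ((r * k) choose i)) \<ge> 0" "(\<Sum>k\<le>n. ?c (n - k) * real ((r * k + 1) choose i)) \<ge> 0"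
        using c by (auto intro!: sum_nonneg)
      then show "\<bar>pade_remainder_coeff r n i\<bar> \<le>
          (\<Sum>k\<le>n. ?c k * real ((r * k) choose i)) + (\<Sum>k\<le>n. ?c (n - k) * real ((r * k + 1) choose i))"
        unfolding pade_remainder_coeff_def by linarith
    qed
    also have "\<dots> = (\<Sum>i\<in>I. \<Sum>k\<le>n. ?c k * real ((r * k) choose i)) +
        (\<Sum>i\<in>I. \<Sum>k\<le>n. ?c (n - k) * real ((r * k + 1) choose i))" by (rule sum.distrib)
    also have "\<dots> \<le> (\<Sum>k\<le>n. ?c k) * 2 ^ N + (\<Sum>k\<le>n. ?c (n - k)) * 2 ^ N"
      using c by (intro add_mono sum_binomial_tail_le) (auto simp: I_def N_def le_SucI)
    also have "\<dots> \<le> 4 ^ n * 2 ^ N + 4 ^ n * 2 ^ N"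
      using sc sc' by (intro add_mono mult_right_mono) auto
    finally show ?thesis by (simp add: N_def)
  qed
  finally show ?thesis by (simp add: s_def mult_right_mono)
qed

section \<open>Independence of approximants of consecutive degrees\<close>

text \<open>The vanishing of the first coefficients as a divisibility of polynomials, after moving
  the expansion point from \<open>0\<close> back to \<open>1\<close>.\<close>

lemma pade_remainder_dvd:
  assumes "r > 1"
  shows "[:-1, 1:] ^ (2 * n + 1) dvd
    pcompose (pade_num r n) (monom 1 r) - [:0, 1:] * pcompose (pade_den r n) (monom 1 r)"
    (is "_ dvd ?R")
proof -
  have "pcompose ?R [:1, 1:] = (\<Sum>i\<le>r * n + 1. monom (of_real (pade_remainder_coeff r n i)) i)"
    unfolding poly_eq_poly_eq_iff[symmetric] fun_eq_iff
  proof
    fix s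
    show "poly (pcompose ?R [:1, 1:]) s = poly (\<Sum>i\<le>r * n + 1. monom (of_real (pade_remainder_coeff r n i)) i) s"
      using pade_remainder_expansion[of r n s] by (simp add: poly_pcompose poly_sum poly_monom)
  qed
  then have "monom 1 (2 * n + 1) dvd pcompose ?R [:1, 1:]"
    unfolding monom_1_dvd_iff' using pade_remainder_coeff_eq_0[OF assms, of _ n]
    by (simp add: coeff_sum_monom_atMost)
  then obtain q where "pcompose ?R [:1, 1:] = monom 1 (2 * n + 1) * q" by (elim dvdE)
  then have "pcompose (pcompose ?R [:1, 1:]) [:-1, 1:] = pcompose (monom 1 (2 * n + 1)) [:-1, 1:] * pcompose q [:-1, 1:]"
    by (simp add: pcompose_mult)
  moreover have "pcompose (pcompose ?R [:1, 1:]) [:-1, 1:] = ?R"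
    unfolding pcompose_assoc[symmetric] by (simp add: pcompose_pCons)
  moreover have "pcompose (monom 1 (2 * n + 1)) [:-1, 1:] = [:-1, 1 :: complex:] ^ (2 * n + 1)"
    unfolding poly_eq_poly_eq_iff[symmetric] fun_eq_iff by (simp add: poly_pcompose poly_monom algebra_simps)
  ultimately show ?thesis by (metis dvd_triv_left)
qed

lemma pcompose_power: "pcompose (p ^ n) q = pcompose p q ^ n"
  by (induction n) (simp_all add: pcompose_1 pcompose_mult)

text \<open>The zero of \<open>x^r - 1\<close> at \<open>1\<close> is simple, as the cofactor
  \<open>g\<close> of \<open>x - 1\<close> has the value \<open>r\<close> there. So substituting
  \<open>x^r\<close> does not raise the multiplicity of \<open>1\<close>.\<close>

lemma order_one_pcompose_monom:
  fixes p :: "complex poly"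
  assumes "p \<noteq> 0" "r > 0" "[:-1, 1:] ^ k dvd pcompose p (monom 1 r)"
  shows "k \<le> order 1 p"
proof (rule ccontr)
  define m where "m = order 1 p"
  assume "\<not> k \<le> order 1 p"
  then have "m + 1 \<le> k" by (simp add: m_def)
  then have dvd: "[:-1, 1:] ^ (m + 1) dvd pcompose p (monom 1 r)"
    using assms(3) power_le_dvd by blast
  obtain e where e: "p = [:-1, 1:] ^ m * e" "\<not> [:-1, 1:] dvd e"
    using order_decomp[OF assms(1), of 1] by (auto simp: m_def)
  define g where "g = (\<Sum>i<r. monom (1 :: complex) i)"
  have sub: "pcompose [:-1, 1:] (monom 1 r) = [:-1, 1 :: complex:] * g"
    unfolding poly_eq_poly_eq_iff[symmetric] fun_eq_iff
  proof
    fix x :: complex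
    show "poly (pcompose [:-1, 1:] (monom 1 r)) x = poly ([:-1, 1:] * g) x"
      using power_diff_1_eq[of x r]
      by (simp add: poly_pcompose poly_monom g_def poly_sum algebra_simps)
  qed
  have "pcompose p (monom 1 r) = [:-1, 1:] ^ m * (g ^ m * pcompose e (monom 1 r))"
    unfolding e(1) pcompose_mult pcompose_power sub power_mult_distrib by (simp only: mult_ac)
  then have "[:-1, 1:] ^ m * [:-1, 1:] dvd [:-1, 1:] ^ m * (g ^ m * pcompose e (monom 1 r))"
    using dvd by (simp add: mult_ac)
  moreover have "[:-1, 1 :: complex:] ^ m \<noteq> 0" by simp
  ultimately have "[:-1, 1:] dvd g ^ m * pcompose e (monom 1 r)"
    unfolding dvd_mult_cancel_left by blast
  then have "poly (g ^ m * pcompose e (monom 1 r)) 1 = 0" by (simp only: poly_eq_0_iff_dvd)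
  moreover have "poly g 1 = of_nat r" by (simp add: g_def poly_sum poly_monom)
  ultimately show False using e(2) assms(2) by (simp add: poly_pcompose poly_monom poly_eq_0_iff_dvd)
qed

text \<open>The determinant \<open>p\<close> of two consecutive approximants has degree at most
  \<open>2 * n + 1\<close> and a zero of at least this order at \<open>1\<close>. As
  \<open>p\<close> is not zero, it is a nonzero constant times \<open>(x - 1) ^ (2 * n + 1)\<close>
  and vanishes nowhere else.\<close>

lemma pade_independent:
  fixes w :: complex
  assumes r: "r > 1"
    and eq: "poly (pade_num r n) w * poly (pade_den r (Suc n)) w =
      poly (pade_num r (Suc n)) w * poly (pade_den r n) w"
  shows "w = 1"
proof -
  define p where "p = pade_num r n * pade_den r (Suc n) - pade_num r (Suc n) * pade_den r n"
  let ?\<nu> = "1 / real r"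
  define a where "a = ((real n + ?\<nu>) gchoose n)"
  define b where "b = ((real n - ?\<nu>) gchoose n)"
  have a: "a > 0" and b: "b > 0"
    using pade_coeff_pos[of ?\<nu> n n] pade_coeff_pos[of ?\<nu> 0 n] r by (simp_all add: a_def b_def pade_coeff_def)
  \<comment> \<open>From \<open>n\<close> to \<open>Suc n\<close> the leading coefficients
    \<open>a\<close> and \<open>b\<close> are multiplied by \<open>(n + 1 + \<nu>) / (n + 1)\<close>
    and \<open>(n + 1 - \<nu>) / (n + 1)\<close>. The difference of these factors gives the
    value.\<close>
  have lead: "coeff p (2 * n + 1) = of_real (a * b * (- 2 * ?\<nu> / (real n + 1)))"
  proof -
    have top: "coeff (f * g) (k + l) = coeff f k * coeff g l"
      if fk: "degree f \<le> k" and gl: "degree g \<le> l" for f g :: "complex poly" and k l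
    proof -
      have "coeff (f * g) (k + l) = (\<Sum>i\<le>k+l. coeff f i * coeff g (k + l - i))" by (rule coeff_mult)
      also have "\<dots> = (\<Sum>i\<in>{k}. coeff f i * coeff g (k + l - i))"
      proof (rule sum.mono_neutral_right)
        show "\<forall>i\<in>{..k + l} - {k}. coeff f i * coeff g (k + l - i) = 0"
        proof
          fix i assume "i \<in> {..k + l} - {k}"
          then have "k < i \<or> l < k + l - i" by auto
          then consider "degree f < i" | "degree g < k + l - i" using fk gl by linarith
          then show "coeff f i * coeff g (k + l - i) = 0" by cases (simp_all add: coeff_eq_0)
        qed
      qed auto
      finally show ?thesis by simp
    qed
    have S1: "(real (Suc n) + ?\<nu>) gchoose Suc n = (real (Suc n) + ?\<nu>) / real (Suc n) * a"
      using gbinomial_factors[of "real n + ?\<nu>" n] unfolding a_def by (simp add: ac_simps)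
    have S2: "(real (Suc n) - ?\<nu>) gchoose Suc n = (real (Suc n) - ?\<nu>) / real (Suc n) * b"
      using gbinomial_factors[of "real n - ?\<nu>" n] unfolding b_def by (simp add: algebra_simps)
    have num: "coeff (pade_num r k) k = of_real ((real k + ?\<nu>) gchoose k)"
      and den: "coeff (pade_den r k) k = of_real ((real k - ?\<nu>) gchoose k)" for k
      by (simp_all add: pade_num_def pade_den_def coeff_sum_monom_atMost pade_coeff_def)
    have "coeff p (n + Suc n) = coeff (pade_num r n) n * coeff (pade_den r (Suc n)) (Suc n) -
        coeff (pade_num r (Suc n)) (Suc n) * coeff (pade_den r n) n"
      unfolding p_def coeff_diff
      using top[of "pade_num r n" n "pade_den r (Suc n)" "Suc n"] top[of "pade_num r (Suc n)" "Suc n" "pade_den r n" n]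
      by (simp add: degree_pade add.commute)
    also have "\<dots> = of_real (a * ((real (Suc n) - ?\<nu>) / real (Suc n) * b) - (real (Suc n) + ?\<nu>) / real (Suc n) * a * b)"
      unfolding num den S1 S2 a_def[symmetric] b_def[symmetric] by simp
    also have "a * ((real (Suc n) - ?\<nu>) / real (Suc n) * b) - (real (Suc n) + ?\<nu>) / real (Suc n) * a * b
        = a * b * (- 2 * ?\<nu> / (real n + 1))"
      by (simp add: field_simps del: of_nat_Suc) (simp add: algebra_simps)
    finally show ?thesis by (simp add: mult_2)
  qed
  have p: "p \<noteq> 0"
  proof
    assume "p = 0"
    then have "a * b * (- 2 * ?\<nu> / (real n + 1)) = 0" using lead by (metis coeff_0 of_real_eq_0_iff)
    then show False using a b r by simp
  qed
  have deg: "degree p \<le> 2 * n + 1"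
    unfolding p_def
  proof (rule degree_diff_le)
    show "degree (pade_num r n * pade_den r (Suc n)) \<le> 2 * n + 1"
      using degree_mult_le[of "pade_num r n" "pade_den r (Suc n)"] degree_pade(1)[of r n]
        degree_pade(2)[of r "Suc n"] by linarith
    show "degree (pade_num r (Suc n) * pade_den r n) \<le> 2 * n + 1"
      using degree_mult_le[of "pade_num r (Suc n)" "pade_den r n"] degree_pade(1)[of r "Suc n"]
        degree_pade(2)[of r n] by linarith
  qed
  let ?R = "\<lambda>n. pcompose (pade_num r n) (monom 1 r) - [:0, 1:] * pcompose (pade_den r n) (monom 1 r)"
  \<comment> \<open>The products of the two denominators cancel, so \<open>p\<close> at
    \<open>x^r\<close> is a combination of the two remainders.\<close>
  have "pcompose p (monom 1 r) = ?R n * pcompose (pade_den r (Suc n)) (monom 1 r) -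
      ?R (Suc n) * pcompose (pade_den r n) (monom 1 r)"
    unfolding p_def pcompose_diff pcompose_mult by (simp only: algebra_simps)
  moreover have "[:-1, 1:] ^ (2 * n + 1) dvd ?R n" by (rule pade_remainder_dvd[OF r])
  moreover have "[:-1, 1:] ^ (2 * n + 1) dvd ?R (Suc n)"
    by (rule power_le_dvd[OF pade_remainder_dvd[OF r]]) simp
  ultimately have "[:-1, 1:] ^ (2 * n + 1) dvd pcompose p (monom 1 r)" by simp
  then have ord: "2 * n + 1 \<le> order 1 p" using r by (intro order_one_pcompose_monom[OF p]) auto
  then have dvd: "[:-1, 1:] ^ (2 * n + 1) dvd p" by (simp only: order_divides simp_thms)
  then obtain q where q: "p = [:-1, 1:] ^ (2 * n + 1) * q" by (elim dvdE)
  then have "degree p = 2 * n + 1 + degree q"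
    using p by (simp add: degree_mult_eq degree_power_eq del: power_Suc)
  then have "degree q = 0" using deg by simp
  then obtain c where c: "q = [:c:]" by (rule degree_eq_zeroE)
  then have "c \<noteq> 0" using q p by auto
  moreover have "poly p w = 0" using eq by (simp add: p_def)
  ultimately show ?thesis unfolding q c by (auto simp: poly_power)
qed

section \<open>Estimates for the exponents\<close>

text \<open>Here \<open>p = ln X\<close> and \<open>q = ln Y\<close> in \<open>pade_error_terms_small\<close> below; \<open>n\<close> is the least degree for
  which the second condition holds.\<close>

lemma exists_pade_degree:
  fixes p q R :: real
  assumes R: "R \<ge> 5" and p: "p > 0" and q: "q \<ge> (R - 1) * p"
  shows "\<exists>n\<ge>1. \<forall>N\<in>{n, Suc n}.
    (p + q) / R + real N * (13 / 9 * p) - q \<le> - p / 9 \<and>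
    (p + q) / R + real N * (13 / 9 * p) - (2 * real N + 1) * p \<le> - p / 9"
proof -
  define s where "s = (p + q) / R"
  have q_eq: "q = R * s - p" using R by (simp add: s_def field_simps)
  \<comment> \<open>The second condition for \<open>N = n\<close>, solved for \<open>s\<close>. The
    factor \<open>13 / 9\<close> is \<open>1 + 4 / 9\<close> and stands for \<open>M * X\<close>
    with \<open>M\<close> at most \<open>X powr (4 / 9)\<close>.\<close>
  define P where "P = (\<lambda>n::nat. n \<ge> 1 \<and> s \<le> p * (8 / 9 + 5 / 9 * real n))"
  obtain n0 :: nat where "s / p < real n0" using reals_Archimedean2 by blast
  then have "s < p * real n0" using p by (simp add: field_simps)
  also have "\<dots> \<le> p * (8 / 9 + 5 / 9 * real (2 * n0 + 1))" using p by (intro mult_left_mono) (simp_all add: field_simps)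
  finally have "P (2 * n0 + 1)" by (simp add: P_def)
  define n where "n = (LEAST n. P n)"
  have Pn: "P n" unfolding n_def using \<open>P (2 * n0 + 1)\<close> by (rule LeastI)
  then have n1: "n \<ge> 1" by (simp add: P_def)
  \<comment> \<open>Minimality of \<open>n\<close> bounds \<open>s\<close> from below, and with it
    \<open>q = R * s - p\<close>; this leaves room for \<open>Suc n\<close>. For
    \<open>n = 1\<close> the bound \<open>s \<ge> p\<close> takes over, and the margin
    \<open>p / 9\<close> is attained at \<open>R = 5\<close>, \<open>s = p\<close>.\<close>
  have first: "s + real (Suc n) * (13 / 9 * p) - q \<le> - p / 9"
  proof (cases "n = 1")
    case True
    have "R * s \<ge> R * p" using q q_eq by (simp add: algebra_simps)
    then have "s \<ge> p" using R by simp
    moreover have "s * (R - 1) \<ge> 4 * s" using R \<open>s \<ge> p\<close> p by (simp add: mult.commute)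
    ultimately show ?thesis using True q_eq by (simp add: algebra_simps)
  next
    case False
    then have "n - 1 < n" "n - 1 \<ge> 1" using n1 by auto
    then have "\<not> P (n - 1)" unfolding n_def using not_less_Least by blast
    then have "s > p * (8 / 9 + 5 / 9 * (real n - 1))"
      using \<open>n - 1 \<ge> 1\<close> by (auto simp: P_def of_nat_diff)
    moreover have "p * (8 / 9 + 5 / 9 * (real n - 1)) = 5 / 9 * (p * real n) + p / 3"
      by (simp add: field_simps)
    ultimately have s: "s > 5 / 9 * (p * real n) + p / 3" by simp
    have "p * real n \<ge> 0" using p by simp
    then have s0: "s \<ge> 0" using p s by linarith
    have "(R - 1) * s \<ge> 4 * s" using R s0 by (intro mult_right_mono) auto
    moreover have "(R - 1) * s = R * s - s" by (simp add: algebra_simps)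
    moreover have "p * real n \<ge> p * 2" using False n1 p by (intro mult_left_mono) auto
    moreover have "real (Suc n) * (13 / 9 * p) = 13 / 9 * (p * real n) + 13 / 9 * p"
      by (simp add: field_simps)
    ultimately show ?thesis using s q_eq p by argo
  qed
  show ?thesis
  proof (intro exI[of _ n] conjI ballI n1)
    fix N assume N: "N \<in> {n, Suc n}"
    then have "real N * (13 / 9 * p) \<le> real (Suc n) * (13 / 9 * p)"
      using p by (intro mult_right_mono) auto
    then show "(p + q) / R + real N * (13 / 9 * p) - q \<le> - p / 9"
      using first unfolding s_def by linarith
    have "p * real N \<ge> p * real n" using N p by (intro mult_left_mono) auto
    then show "(p + q) / R + real N * (13 / 9 * p) - (2 * real N + 1) * p \<le> - p / 9"
      using Pn unfolding P_def s_def[symmetric] by (simp add: algebra_simps)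
  qed
qed

text \<open>Because \<open>2 ^ 9 = 512 < 625 = 5 ^ 4\<close>. It absorbs powers of two into powers
  of \<open>r\<close>.\<close>

lemma ln_two_le:
  fixes R :: real
  assumes "R \<ge> 5"
  shows "ln 2 \<le> 4 / 9 * ln R"
proof -
  have "9 * ln (2::real) = ln (2 ^ 9)" by (subst ln_realpow) auto
  also have "\<dots> \<le> ln (5 ^ 4)" by simp
  also have "\<dots> = 4 * ln 5" by (subst ln_realpow) auto
  also have "\<dots> \<le> 4 * ln R" using assms by simp
  finally show ?thesis by simp
qed

text \<open>The constant \<open>32 \<cdot> 2^r r^3 h \<bar>D\<bar>^(1/2)\<close> is at most \<open>X^(4/9)\<close>; here \<open>g = ln h\<close>, \<open>k = ln \<kappa>\<close>
  and \<open>d = ln \<bar>D\<bar> / 2\<close>.\<close>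

lemma pade_constant_ln_le:
  fixes R p g k d :: real
  assumes R: "R \<ge> 5" and k: "0 \<le> k" "3 * k \<le> p" and g: "g \<ge> 0"
    and p: "p \<ge> 7 / 2 * (R + 3) * ln R + 6 * g"
    and d: "(R - 2) * d \<le> 2 * ln 2 + 2 * ln R + R * ln 2 + 2 * g + k"
  shows "5 * ln 2 + R * ln 2 + 3 * ln R + g + d \<le> 4 / 9 * p"
proof -
  define l where "l = ln R"
  have l: "l \<ge> 0" using R by (simp add: l_def)
  have l2: "ln 2 \<le> 4 / 9 * l" using ln_two_le[OF R] by (simp add: l_def)
  define T where "T = 2 * ln 2 + 2 * ln R + R * ln 2 + 2 * g + k"
  have Rl2: "R * ln 2 \<le> R * (4 / 9 * l)" using l2 R by (intro mult_left_mono) auto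
  have T: "T \<le> (26 / 9 + 4 / 9 * R) * l + 2 * g + k"
    using l2 Rl2 by (simp add: T_def l_def algebra_simps)
  \<comment> \<open>Every summand is compared with a multiple of \<open>R - 2\<close>, which is
    cancelled afterwards; \<open>46 / 27\<close> gives equality at \<open>R = 5\<close>.\<close>
  have "(26 / 9 + 4 / 9 * R) * l \<le> ((R - 2) * (46 / 27)) * l"
    using R l by (intro mult_right_mono) (auto simp: algebra_simps)
  moreover have "2 * g \<le> (R - 2) * (2 / 3 * g)" "k \<le> (R - 2) * (k / 3)"
    using R g k mult_right_mono[of 3 "R - 2" "2 / 3 * g"] mult_right_mono[of 3 "R - 2" "k / 3"] by auto
  ultimately have "(R - 2) * d \<le> (R - 2) * (46 / 27) * l + (R - 2) * (2 / 3 * g) + (R - 2) * (k / 3)"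
    using T d unfolding T_def by linarith
  also have "\<dots> = (R - 2) * (46 / 27 * l + 2 / 3 * g + k / 3)" by (simp only: distrib_left mult.assoc)
  finally have "(R - 2) * d \<le> (R - 2) * (46 / 27 * l + 2 / 3 * g + k / 3)" .
  then have d': "d \<le> 46 / 27 * l + 2 / 3 * g + k / 3" using R by simp
  have "R * l \<ge> 5 * l" using R l by (intro mult_right_mono) auto
  moreover have "R * (4 / 9 * l) = 4 / 9 * (R * l)" by simp
  moreover have "7 / 2 * (R + 3) * l = 7 / 2 * (R * l) + 21 / 2 * l" by (simp add: field_simps)
  \<comment> \<open>Of \<open>4 / 9 * p\<close>, one ninth pays for \<open>k / 3\<close> and one
    third for the terms in \<open>l\<close> and \<open>g\<close>.\<close>
  ultimately show ?thesis using d' l2 Rl2 p k l g unfolding l_def[symmetric] by linarith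
qed

lemma ln_five_bound: "ln (5::real) \<ge> 1"
proof -
  have "exp 1 \<le> (5::real)" using exp_le by linarith
  then show ?thesis by (metis exp_gt_zero ln_exp ln_le_cancel_iff order_less_le_trans)
qed

text \<open>\<open>X\<close> and \<open>Y\<close> belong to two solutions, and the first factor is
  the product of their sizes up to a power of \<open>h\<close>. The summands are the error at the
  second solution and the Pade remainder at the first. Times the first factor, each of the two
  quotients is at most \<open>exp (- ln X / 9) < 1 / 8\<close>, so the whole is below
  \<open>9 / 8\<close>.\<close>

lemma pade_error_terms_small:
  fixes X Y M \<kappa> :: real and r h :: nat
  assumes r: "r \<ge> 5" and X: "X > 0" and Y: "Y > 0" and M: "M > 0"
    and lnX: "ln X \<ge> 28" and lnY: "ln Y \<ge> (real r - 1) * ln X" and lnM: "ln M \<le> 4 / 9 * ln X"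
  shows "\<exists>n\<ge>1. \<forall>N\<in>{n, Suc n}.
    (X * Y) powr (1 / real r) * ((M * X) ^ N / Y + 8 * ((M * X) ^ N / X ^ (2 * N + 1))) < 2"
proof -
  define p where "p = ln X"
  define q where "q = ln Y"
  have p: "p \<ge> 28" using lnX by (simp add: p_def)
  have "\<exists>n\<ge>1. \<forall>N\<in>{n, Suc n}. (p + q) / real r + real N * (13 / 9 * p) - q \<le> - p / 9 \<and>
      (p + q) / real r + real N * (13 / 9 * p) - (2 * real N + 1) * p \<le> - p / 9"
    using r lnY p by (intro exists_pade_degree) (auto simp: p_def q_def)
  then obtain n where n: "n \<ge> 1" and ex: "\<And>N. N \<in> {n, Suc n} \<Longrightarrow>
      (p + q) / real r + real N * (13 / 9 * p) - q \<le> - p / 9 \<and>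
      (p + q) / real r + real N * (13 / 9 * p) - (2 * real N + 1) * p \<le> - p / 9"
    by blast
  \<comment> \<open>\<open>28\<close> is \<open>7 / 2 * (R + 3)\<close> at \<open>R = 5\<close>; the
    quadratic Taylor polynomial of \<open>exp\<close> at \<open>28 / 9\<close> already exceeds
    \<open>8\<close>.\<close>
  have small: "exp (- p / 9) < 1 / 8"
  proof -
    have "1 + p / 9 + (p / 9)\<^sup>2 / 2 \<le> exp (p / 9)" using p exp_lower_Taylor_quadratic[of "p / 9"] by simp
    moreover have "(28 / 9)\<^sup>2 \<le> (p / 9)\<^sup>2" using p by (intro power_mono) auto
    ultimately have "exp (p / 9) > 8" using p by (simp add: power2_eq_square)
    then show ?thesis by (simp add: exp_minus field_simps)
  qed
  show ?thesis
  proof (intro exI[of _ n] conjI ballI n)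
    fix N assume N: "N \<in> {n, Suc n}"
    have MX: "ln (M * X) \<le> 13 / 9 * p" using lnM X M by (simp add: ln_mult p_def)
    have 0: "(X * Y) powr (1 / real r) = exp ((p + q) / real r)"
      using X Y by (simp add: powr_def ln_mult p_def q_def)
    have 1: "(M * X) ^ N \<le> exp (real N * (13 / 9 * p))"
    proof -
      have "(M * X) ^ N = exp (real N * ln (M * X))" using X M by (simp add: exp_of_nat_mult)
      also have "\<dots> \<le> exp (real N * (13 / 9 * p))" using mult_left_mono[OF MX, of "real N"] by simp
      finally show ?thesis .
    qed
    have 2: "Y = exp q" "X ^ (2 * N + 1) = exp ((2 * real N + 1) * p)"
      using X Y exp_of_nat_mult[of "2 * N + 1" p] by (simp_all add: p_def q_def add.commute)
    have "exp ((p + q) / real r) * ((M * X) ^ N / Y) \<le> exp ((p + q) / real r) * (exp (real N * (13 / 9 * p)) / Y)"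
      using 1 Y by (intro mult_left_mono divide_right_mono) auto
    also have "\<dots> = exp ((p + q) / real r + real N * (13 / 9 * p) - q)"
      unfolding 2 by (simp add: exp_add exp_diff)
    also have "\<dots> \<le> exp (- p / 9)" using ex[OF N] by simp
    finally have a: "exp ((p + q) / real r) * ((M * X) ^ N / Y) \<le> exp (- p / 9)" .
    have "exp ((p + q) / real r) * ((M * X) ^ N / X ^ (2 * N + 1)) \<le>
        exp ((p + q) / real r) * (exp (real N * (13 / 9 * p)) / X ^ (2 * N + 1))"
      using 1 X by (intro mult_left_mono divide_right_mono) auto
    also have "\<dots> = exp ((p + q) / real r + real N * (13 / 9 * p) - (2 * real N + 1) * p)"
      unfolding 2 by (simp add: exp_add exp_diff)
    also have "\<dots> \<le> exp (- p / 9)" using ex[OF N] by simp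
    finally have b: "exp ((p + q) / real r) * ((M * X) ^ N / X ^ (2 * N + 1)) \<le> exp (- p / 9)" .
    show "(X * Y) powr (1 / real r) * ((M * X) ^ N / Y + 8 * ((M * X) ^ N / X ^ (2 * N + 1))) < 2"
      using a b small unfolding 0 by (simp add: distrib_left)
  qed
qed

text \<open>The common denominator of the two exponents in the theorem. The critical case is
  \<open>m = 3\<close>, with value \<open>R * (R - 4)\<close>.\<close>

lemma gap_exponent_pos:
  fixes R :: real
  assumes "R \<ge> 5" "m \<ge> 3"
  shows "(R - 1) ^ (m - 1) - 2 * R - 1 > 0"
proof -
  have "(R - 1)\<^sup>2 \<le> (R - 1) ^ (m - 1)" using assms by (intro power_increasing) auto
  moreover have "(R - 1)\<^sup>2 - 2 * R - 1 = R * (R - 4)" by (simp add: power2_eq_square algebra_simps)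
  moreover have "R * (R - 4) > 0" using assms by simp
  ultimately show ?thesis by linarith
qed

text \<open>Here \<open>l = ln r\<close>, \<open>g = ln h\<close>, \<open>k = ln \<kappa>\<close> and \<open>i = m - 3\<close>; after \<open>m - 2\<close> applications of the gap
  principle the logarithm of the size of a solution is at least \<open>e * k\<close>.\<close>

lemma hypothesis_exponents:
  fixes R E e l g k :: real and i :: nat
  assumes R: "R \<ge> 5" and l: "l \<ge> 0" and g: "g \<ge> 0"
    and E: "E = (R - 1) ^ (i + 2) - 2 * R - 1" "E > 0"
    and k: "k * E \<ge> 7 * R\<^sup>2 * l + (R\<^sup>2 + R + 2) * g"
    and e: "e \<ge> (R - 1) ^ i * (R + 1) / 2"
  shows "e * k \<ge> 7 / 2 * (R + 3) * l + 6 * g"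
proof -
  define T where "T = 7 * R\<^sup>2 * l + (R\<^sup>2 + R + 2) * g"
  have T: "T \<ge> 0" using R l g by (simp add: T_def)
  have k0: "k \<ge> 0"
  proof (rule ccontr)
    assume "\<not> k \<ge> 0"
    then have "k * E < 0" using E(2) by (simp add: mult_neg_pos)
    then show False using k T by (simp add: T_def)
  qed
  have R1: "(R - 1)\<^sup>2 > 0" using R by simp
  \<comment> \<open>Giving away \<open>2 * R + 1\<close> leaves powers of \<open>R - 1\<close> that
    differ from the one in \<open>e\<close> by \<open>(R - 1)^2\<close> only.\<close>
  have "E \<le> (R - 1) ^ (i + 2)" using E(1) R by linarith
  then have "E \<le> (R - 1) ^ i * (R - 1)\<^sup>2" by (simp only: power_add)
  then have "k * E \<le> k * ((R - 1) ^ i * (R - 1)\<^sup>2)" using k0 by (intro mult_left_mono)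
  then have 1: "T \<le> (R - 1)\<^sup>2 * ((R - 1) ^ i * k)" using k by (simp add: T_def mult_ac)
  have "7 * R\<^sup>2 * (R + 1) \<ge> 7 * (R + 3) * (R - 1)\<^sup>2"
    using R by (simp add: power2_eq_square algebra_simps)
  then have "7 * R\<^sup>2 * (R + 1) * l \<ge> 7 * (R + 3) * (R - 1)\<^sup>2 * l" using l by (rule mult_right_mono)
  \<comment> \<open>The factorization shows equality at \<open>R = 5\<close>, so \<open>6\<close> is
    the largest coefficient of \<open>g\<close> that this comparison yields for all
    \<open>R \<ge> 5\<close>.\<close>
  moreover have "(R + 1) * (R\<^sup>2 + R + 2) - 12 * (R - 1)\<^sup>2 = (R - 5) * (R * (R - 5) + 2)"
    by (simp add: power2_eq_square algebra_simps)
  then have "(R + 1) * (R\<^sup>2 + R + 2) \<ge> 12 * (R - 1)\<^sup>2"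
    using R by (smt (verit) mult_nonneg_nonneg)
  then have "(R + 1) * (R\<^sup>2 + R + 2) * g \<ge> 12 * (R - 1)\<^sup>2 * g" using g by (rule mult_right_mono)
  ultimately have "(R + 1) * T \<ge> (R - 1)\<^sup>2 * (7 * (R + 3) * l + 12 * g)"
    by (simp add: T_def algebra_simps)
  also have "(R + 1) * T \<le> (R + 1) * ((R - 1)\<^sup>2 * ((R - 1) ^ i * k))"
    using 1 R by (intro mult_left_mono) auto
  finally have "(R - 1)\<^sup>2 * (7 * (R + 3) * l + 12 * g) \<le> (R - 1)\<^sup>2 * ((R + 1) * ((R - 1) ^ i * k))"
    by (simp add: mult_ac)
  then have "7 * (R + 3) * l + 12 * g \<le> (R + 1) * ((R - 1) ^ i * k)"
    using R1 by (simp add: mult_le_cancel_left_pos)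
  moreover have "e * k \<ge> (R - 1) ^ i * (R + 1) / 2 * k" using e k0 by (rule mult_right_mono)
  moreover have "(R - 1) ^ i * (R + 1) / 2 * k = (R + 1) * ((R - 1) ^ i * k) / 2" by simp
  moreover have "7 * (R + 3) * l = 2 * (7 / 2 * (R + 3) * l)" by simp
  ultimately show ?thesis by linarith
qed

section \<open>Arithmetic of diagonalized forms\<close>

text \<open>Below \<open>w\<^sup>2\<close> is an integer that may be a square, so that \<open>a\<close> and \<open>b\<close> need not be unique.\<close>

definition conjugate_pair :: "complex \<Rightarrow> complex \<Rightarrow> complex \<Rightarrow> bool" where
  "conjugate_pair w u v \<longleftrightarrow> (\<exists>a b :: int. u = of_int a + of_int b * w \<and> v = of_int a - of_int b * w)"

lemma conjugate_pairI:
  "u = of_int a + of_int b * w \<Longrightarrow> v = of_int a - of_int b * w \<Longrightarrow> conjugate_pair w u v"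
  unfolding conjugate_pair_def by blast

lemma conjugate_pair_of_int: "conjugate_pair w (of_int n) (of_int n)"
  by (rule conjugate_pairI[of _ n 0]) simp_all

lemma conjugate_pair_add:
  assumes "conjugate_pair w u v" "conjugate_pair w u' v'"
  shows "conjugate_pair w (u + u') (v + v')"
proof -
  obtain a b a' b' :: int where e: "u = of_int a + of_int b * w" "v = of_int a - of_int b * w"
    "u' = of_int a' + of_int b' * w" "v' = of_int a' - of_int b' * w"
    using assms unfolding conjugate_pair_def by blast
  show ?thesis unfolding e
    by (intro conjugate_pairI[of _ "a + a'" "b + b'"]) (simp_all add: algebra_simps)
qed

lemma conjugate_pair_mult:
  assumes "w\<^sup>2 = of_int W" "conjugate_pair w u v" "conjugate_pair w u' v'"
  shows "conjugate_pair w (u * u') (v * v')"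
proof -
  obtain a b a' b' :: int where e: "u = of_int a + of_int b * w" "v = of_int a - of_int b * w"
    "u' = of_int a' + of_int b' * w" "v' = of_int a' - of_int b' * w"
    using assms(2,3) unfolding conjugate_pair_def by blast
  have "of_int (b * b' * W) = (of_int b * w) * (of_int b' * w)"
    using assms(1) by (simp add: power2_eq_square mult_ac)
  then show ?thesis unfolding e
    by (intro conjugate_pairI[of _ "a * a' + b * b' * W" "a * b' + b * a'"]) (auto simp: algebra_simps)
qed

lemma conjugate_pair_power:
  assumes "w\<^sup>2 = of_int W" "conjugate_pair w u v"
  shows "conjugate_pair w (u ^ n) (v ^ n)"
proof (induction n)
  case 0
  show ?case using conjugate_pair_of_int[of w 1] by simp
next
  case (Suc n)
  then show ?case using conjugate_pair_mult[OF assms] by simp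
qed

lemma conjugate_pair_sum:
  assumes "\<And>i. i \<in> I \<Longrightarrow> conjugate_pair w (f i) (g i)"
  shows "conjugate_pair w (sum f I) (sum g I)"
  using assms
proof (induction I rule: infinite_finite_induct)
  case (insert x F)
  then show ?case by (simp add: conjugate_pair_add)
qed (use conjugate_pair_of_int[of w 0] in simp_all)

lemma conjugate_pair_swap:
  assumes "conjugate_pair w u v"
  shows "conjugate_pair w v u"
proof -
  obtain a b :: int where "u = of_int a + of_int b * w" "v = of_int a - of_int b * w"
    using assms unfolding conjugate_pair_def by blast
  then show ?thesis by (intro conjugate_pairI[of _ a "- b"]) simp_all
qed

text \<open>The difference is \<open>2 * b * w\<close> with a nonzero integer \<open>b\<close>; this
  is the source of the lower bound in \<open>thue_comb_lower_bound\<close>.\<close>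

lemma conjugate_pair_diff_ge:
  assumes "conjugate_pair w u v" "u \<noteq> v"
  shows "cmod (u - v) \<ge> 2 * cmod w"
proof -
  obtain a b :: int where e: "u = of_int a + of_int b * w" "v = of_int a - of_int b * w"
    using assms(1) unfolding conjugate_pair_def by blast
  then have "b \<noteq> 0" using assms(2) by auto
  then have "1 \<le> real_of_int \<bar>b\<bar>" by linarith
  then have "1 * (2 * cmod w) \<le> real_of_int \<bar>b\<bar> * (2 * cmod w)" by (intro mult_right_mono) auto
  moreover have "u - v = of_int b * (2 * w)" by (simp add: e)
  ultimately show ?thesis by (simp add: norm_mult)
qed

definition form_at :: "nat \<Rightarrow> (nat \<Rightarrow> int) \<Rightarrow> int \<times> int \<Rightarrow> int" where
  "form_at r a p = form_eval r a (fst p) (snd p)"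

definition point_det :: "int \<times> int \<Rightarrow> int \<times> int \<Rightarrow> int" where
  "point_det p q = fst p * snd q - snd p * fst q"

section \<open>The linear forms and the quadratic form at integral points\<close>

locale diagonal_form =
  fixes r :: nat and a :: "nat \<Rightarrow> int" and \<alpha> \<beta> \<gamma> \<delta> \<chi> :: complex and A B C :: int
  assumes r_ge: "r \<ge> 3"
    and diag: "diagonalization r a \<alpha> \<beta> \<gamma> \<delta>"
    and quad: "\<alpha> * \<gamma> = \<chi> * of_int A" "\<alpha> * \<delta> + \<beta> * \<gamma> = \<chi> * of_int B" "\<beta> * \<delta> = \<chi> * of_int C"
begin

definition xi :: "int \<times> int \<Rightarrow> complex" where
  "xi p = \<alpha> * of_int (fst p) + \<beta> * of_int (snd p)"

definition eta :: "int \<times> int \<Rightarrow> complex" where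
  "eta p = \<gamma> * of_int (fst p) + \<delta> * of_int (snd p)"

definition jac :: complex where "jac = \<alpha> * \<delta> - \<beta> * \<gamma>"

definition D :: int where "D = B\<^sup>2 - 4 * A * C"

text \<open>Of the two square roots of \<open>D\<close> the one with \<open>2 * xi p * eta q =
  \<chi> * (polar p q + sqrt_D * point_det p q)\<close>.\<close>

definition sqrt_D :: complex where "sqrt_D = jac / \<chi>"

definition quad_at :: "int \<times> int \<Rightarrow> int" where
  "quad_at p = A * (fst p)\<^sup>2 + B * fst p * snd p + C * (snd p)\<^sup>2"

definition polar :: "int \<times> int \<Rightarrow> int \<times> int \<Rightarrow> int" where
  "polar p q = 2 * A * fst p * fst q + B * (fst p * snd q + snd p * fst q) + 2 * C * snd p * snd q"

definition size :: "int \<times> int \<Rightarrow> real" where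
  "size p = max (cmod (xi p)) (cmod (eta p))"

lemma r_pos: "r > 0" using r_ge by simp

lemma jac_nz: "jac \<noteq> 0"
  using diag unfolding diagonalization_def jac_def by blast

lemma form_eq: "form_eval r a x y = (\<alpha> * x + \<beta> * y) ^ r - (\<gamma> * x + \<delta> * y) ^ r"
  using diag unfolding diagonalization_def by blast

lemma chi_nz: "\<chi> \<noteq> 0"
proof
  assume "\<chi> = 0"
  then have "\<alpha> * \<gamma> = 0" "\<alpha> * \<delta> + \<beta> * \<gamma> = 0" "\<beta> * \<delta> = 0" using quad by simp_all
  then have "\<alpha> * \<delta> - \<beta> * \<gamma> = 0" by auto
  then show False using jac_nz by (simp add: jac_def)
qed

lemma sqrt_D_sq: "sqrt_D\<^sup>2 = of_int D"
proof -
  have "jac\<^sup>2 = (\<alpha> * \<delta> + \<beta> * \<gamma>)\<^sup>2 - 4 * (\<alpha> * \<gamma>) * (\<beta> * \<delta>)"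
    by (simp add: jac_def power2_eq_square algebra_simps)
  also have "\<dots> = \<chi>\<^sup>2 * of_int D"
    unfolding quad by (simp add: D_def power2_eq_square algebra_simps)
  finally show ?thesis using chi_nz by (simp add: sqrt_D_def power_divide)
qed

lemma D_nz: "D \<noteq> 0"
  using sqrt_D_sq jac_nz chi_nz by (auto simp: sqrt_D_def)

lemma cmod_sqrt_D: "cmod sqrt_D = sqrt \<bar>D\<bar>"
proof -
  have "(cmod sqrt_D)\<^sup>2 = \<bar>real_of_int D\<bar>"
    using arg_cong[OF sqrt_D_sq, of cmod] by (simp add: norm_power)
  then show ?thesis using real_sqrt_abs[of "cmod sqrt_D"] by simp
qed

lemma form_at_eq: "of_int (form_at r a p) = xi p ^ r - eta p ^ r"
proof -
  have "of_int (form_at r a p) = form_eval r a (of_int (fst p)) (of_int (snd p) :: complex)"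
    by (simp add: form_at_def form_eval_def)
  then show ?thesis by (simp add: form_eq xi_def eta_def)
qed

lemma xi_eta_diff: "xi p * eta q - xi q * eta p = jac * of_int (point_det p q)"
  by (simp add: xi_def eta_def jac_def point_det_def algebra_simps)

lemma xi_eta_sum: "xi p * eta q + xi q * eta p = \<chi> * of_int (polar p q)"
proof -
  have "xi p * eta q + xi q * eta p =
      2 * (\<alpha> * \<gamma>) * of_int (fst p * fst q) + (\<alpha> * \<delta> + \<beta> * \<gamma>) * of_int (fst p * snd q + snd p * fst q) +
      2 * (\<beta> * \<delta>) * of_int (snd p * snd q)"
    by (simp add: xi_def eta_def algebra_simps)
  then show ?thesis unfolding quad by (simp add: polar_def algebra_simps)
qed

lemma xi_eta: "xi p * eta p = \<chi> * of_int (quad_at p)"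
proof -
  have "2 * (xi p * eta p) = \<chi> * of_int (polar p p)" using xi_eta_sum[of p p] by (simp add: mult.commute)
  also have "polar p p = 2 * quad_at p"
    by (simp add: polar_def quad_at_def power2_eq_square algebra_simps)
  finally show ?thesis by simp
qed

text \<open>The Jacobian of \<open>F\<close> and \<open>A x\<^sup>2 + B x y + C y\<^sup>2\<close> is \<open>- r sqrt_D (\<xi>^r + \<eta>^r)\<close>.\<close>

lemma sum_powers_integral:
  "\<exists>g::int. of_nat r * sqrt_D * (xi p ^ r + eta p ^ r) = of_int g"
proof -
  obtain x y where p: "p = (x, y)" by fastforce
  let ?x = "of_int x :: complex" and ?y = "of_int y :: complex"
  \<comment> \<open>\<open>Fx\<close> and \<open>Fy\<close> are the partial derivatives of the form
    at an integral point, computed from the coefficients and again from the diagonalization. The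
    truncated exponents are harmless since their coefficients vanish.\<close>
  define Fx where "Fx = (\<Sum>i\<le>r. a i * int (r - i) * x ^ (r - i - 1) * y ^ i)"
  define Fy where "Fy = (\<Sum>i\<le>r. a i * x ^ (r - i) * (int i * y ^ (i - 1)))"
  have "((\<lambda>X. form_eval r a X ?y) has_field_derivative of_int Fx) (at ?x)"
    unfolding form_eval_def Fx_def
    by (auto intro!: derivative_eq_intros sum.cong simp: algebra_simps)
  moreover have "((\<lambda>X. form_eval r a X ?y) has_field_derivative
      of_nat r * (\<alpha> * xi p ^ (r - 1) - \<gamma> * eta p ^ (r - 1))) (at ?x)"
    unfolding form_eq
    by (auto intro!: derivative_eq_intros simp: algebra_simps p xi_def eta_def)
  ultimately have Fx: "of_int Fx = of_nat r * (\<alpha> * xi p ^ (r - 1) - \<gamma> * eta p ^ (r - 1))"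
    by (rule DERIV_unique)
  have "((\<lambda>Y. form_eval r a ?x Y) has_field_derivative of_int Fy) (at ?y)"
    unfolding form_eval_def Fy_def
    by (auto intro!: derivative_eq_intros sum.cong simp: algebra_simps)
  moreover have "((\<lambda>Y. form_eval r a ?x Y) has_field_derivative
      of_nat r * (\<beta> * xi p ^ (r - 1) - \<delta> * eta p ^ (r - 1))) (at ?y)"
    unfolding form_eq
    by (auto intro!: derivative_eq_intros simp: algebra_simps p xi_def eta_def)
  ultimately have Fy: "of_int Fy = of_nat r * (\<beta> * xi p ^ (r - 1) - \<delta> * eta p ^ (r - 1))"
    by (rule DERIV_unique)
  have qx: "\<chi> * of_int (2 * A * x + B * y) = \<alpha> * eta p + \<gamma> * xi p"
  proof -
    have "\<chi> * of_int (2 * A * x + B * y) = 2 * (\<alpha> * \<gamma>) * ?x + (\<alpha> * \<delta> + \<beta> * \<gamma>) * ?y"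
      unfolding quad by (simp add: algebra_simps)
    then show ?thesis by (simp add: p xi_def eta_def algebra_simps)
  qed
  have qy: "\<chi> * of_int (B * x + 2 * C * y) = \<beta> * eta p + \<delta> * xi p"
  proof -
    have "\<chi> * of_int (B * x + 2 * C * y) = (\<alpha> * \<delta> + \<beta> * \<gamma>) * ?x + 2 * (\<beta> * \<delta>) * ?y"
      unfolding quad by (simp add: algebra_simps)
    then show ?thesis by (simp add: p xi_def eta_def algebra_simps)
  qed
  have pw: "xi p ^ r = xi p * xi p ^ (r - 1)" "eta p ^ r = eta p * eta p ^ (r - 1)"
    using r_pos by (simp_all flip: power_Suc)
  have "\<chi> * of_int ((B * x + 2 * C * y) * Fx - (2 * A * x + B * y) * Fy) =
      (\<chi> * of_int (B * x + 2 * C * y)) * of_int Fx - (\<chi> * of_int (2 * A * x + B * y)) * of_int Fy"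
    by (simp only: of_int_diff of_int_mult right_diff_distrib mult.assoc)
  also have "\<dots> = of_nat r * jac * (xi p ^ r + eta p ^ r)"
    unfolding qx qy Fx Fy pw by (simp add: jac_def algebra_simps)
  finally have "of_nat r * sqrt_D * (xi p ^ r + eta p ^ r) =
      of_int ((B * x + 2 * C * y) * Fx - (2 * A * x + B * y) * Fy)"
    using chi_nz by (simp add: sqrt_D_def field_simps)
  then show ?thesis by blast
qed

lemma size_nonneg: "size p \<ge> 0" by (simp add: size_def le_max_iff_disj)

lemma xi_le_size: "cmod (xi p) \<le> size p" and eta_le_size: "cmod (eta p) \<le> size p"
  by (simp_all add: size_def)

lemma size_pos: "form_at r a p \<noteq> 0 \<Longrightarrow> size p > 0"
proof (rule ccontr)
  assume F: "form_at r a p \<noteq> 0" and "\<not> size p > 0"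
  then have "cmod (xi p) \<le> 0" "cmod (eta p) \<le> 0"
    using xi_le_size[of p] eta_le_size[of p] by linarith+
  then show False using F form_at_eq[of p] r_pos by simp
qed

lemma jac_le:
  assumes "point_det p q \<noteq> 0"
  shows "cmod jac \<le> cmod (xi p * eta q - xi q * eta p)"
proof -
  have "1 \<le> \<bar>real_of_int (point_det p q)\<bar>" using assms by linarith
  then have "cmod jac * 1 \<le> cmod jac * \<bar>real_of_int (point_det p q)\<bar>" by (intro mult_left_mono) auto
  then show ?thesis unfolding xi_eta_diff by (simp add: norm_mult)
qed

lemma jac_le_sizes:
  assumes "point_det p q \<noteq> 0"
  shows "cmod jac \<le> 2 * (size p * size q)"
proof -
  have "cmod (xi p * eta q - xi q * eta p) \<le> cmod (xi p) * cmod (eta q) + cmod (xi q) * cmod (eta p)"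
    by (metis norm_triangle_ineq4 norm_mult)
  also have "\<dots> \<le> size p * size q + size q * size p"
    by (intro add_mono mult_mono xi_le_size eta_le_size size_nonneg norm_ge_zero)
  finally show ?thesis using jac_le[OF assms] by simp
qed

text \<open>This concerns the root of unity \<open>1\<close> only; \<open>root_class_bound\<close>
  reduces the others to it by multiplying \<open>eta\<close> by a constant.\<close>

definition near :: "real \<Rightarrow> int \<times> int \<Rightarrow> bool" where
  "near h p \<longleftrightarrow> cmod (eta p - xi p) * size p ^ (r - 1) \<le> h"

text \<open>Written with the differences \<open>eta q - xi q\<close> and
  \<open>eta p - xi p\<close>, the determinant is a sum of two terms, each at most
  \<open>h * size q\<close> after multiplication by \<open>size p ^ (r - 1)\<close>.\<close>

lemma gap_principle:
  assumes "point_det p q \<noteq> 0" "near h p" "near h q" "0 < size p" "size p \<le> size q"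
  shows "cmod jac * size p ^ (r - 1) \<le> 2 * (h * size q)"
proof -
  let ?P = "size p ^ (r - 1)"
  have 1: "cmod (xi p * eta q - xi q * eta p) \<le>
      size p * cmod (eta q - xi q) + size q * cmod (eta p - xi p)"
  proof -
    have "xi p * eta q - xi q * eta p = xi p * (eta q - xi q) - xi q * (eta p - xi p)"
      by (simp add: algebra_simps)
    also have "cmod \<dots> \<le> cmod (xi p) * cmod (eta q - xi q) + cmod (xi q) * cmod (eta p - xi p)"
      by (metis norm_triangle_ineq4 norm_mult)
    also have "\<dots> \<le> size p * cmod (eta q - xi q) + size q * cmod (eta p - xi p)"
      by (intro add_mono mult_right_mono xi_le_size norm_ge_zero)
    finally show ?thesis .
  qed
  have "cmod (eta q - xi q) * ?P \<le> cmod (eta q - xi q) * size q ^ (r - 1)"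
    using assms(4,5) by (intro mult_left_mono power_mono) auto
  then have 2: "cmod (eta q - xi q) * ?P \<le> h" using assms(3) by (simp add: near_def)
  have h: "h \<ge> 0" using 2 assms(4) by (smt (verit) mult_nonneg_nonneg norm_ge_zero zero_le_power)
  have "cmod jac * ?P \<le> (size p * cmod (eta q - xi q) + size q * cmod (eta p - xi p)) * ?P"
    using 1 jac_le[OF assms(1)] assms(4) by (intro mult_right_mono) auto
  also have "\<dots> = size p * (cmod (eta q - xi q) * ?P) + size q * (cmod (eta p - xi p) * ?P)"
    by (simp add: algebra_simps)
  also have "\<dots> \<le> size p * h + size q * h"
    using 2 assms(2) by (intro add_mono mult_left_mono size_nonneg) (auto simp: near_def)
  also have "\<dots> \<le> size q * h + size q * h" using mult_right_mono[OF assms(5) h] by linarith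
  finally show ?thesis by (simp add: mult.commute)
qed

text \<open>The bound expresses that \<open>4 r^2 D \<chi>^r\<close> is a nonzero integer.\<close>

lemma sqrt_D_bound:
  assumes "gcd A (gcd B C) = 1"
  shows "sqrt \<bar>D\<bar> ^ r \<le> 4 * (real r)\<^sup>2 * cmod jac ^ r * \<bar>D\<bar>"
proof -
  define c where "c = 4 * (of_nat r)\<^sup>2 * of_int D * \<chi> ^ r"
  have int: "c * of_int (quad_at p) ^ r \<in> \<int>" for p
  proof -
    obtain g :: int where g: "of_nat r * sqrt_D * (xi p ^ r + eta p ^ r) = of_int g"
      using sum_powers_integral by blast
    \<comment> \<open>By \<open>(u + v)^2 = (u - v)^2 + 4 u v\<close>, the square of
      \<open>g\<close> is an integer plus \<open>c\<close> times the \<open>r\<close>-th power of a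
      value of the quadratic form.\<close>
    have "of_int (g\<^sup>2) = (of_nat r)\<^sup>2 * sqrt_D\<^sup>2 * (xi p ^ r + eta p ^ r)\<^sup>2"
      unfolding of_int_power g[symmetric] by (simp add: power_mult_distrib)
    also have "\<dots> = (of_nat r)\<^sup>2 * of_int D * ((xi p ^ r - eta p ^ r)\<^sup>2 + 4 * (xi p * eta p) ^ r)"
      unfolding sqrt_D_sq by (simp add: power2_eq_square algebra_simps power_mult_distrib)
    also have "\<dots> = (of_nat r)\<^sup>2 * of_int D * of_int ((form_at r a p)\<^sup>2) + c * of_int (quad_at p) ^ r"
      unfolding form_at_eq[symmetric] xi_eta by (simp add: c_def algebra_simps power_mult_distrib)
    finally have "c * of_int (quad_at p) ^ r = of_int (g\<^sup>2 - (int r)\<^sup>2 * D * (form_at r a p)\<^sup>2)"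
      by simp
    then show ?thesis by (metis Ints_of_int)
  qed
  have gcd: "c * of_int (gcd m n) \<in> \<int>" if "c * of_int m \<in> \<int>" "c * of_int n \<in> \<int>" for m n
  proof -
    obtain u v where "u * m + v * n = gcd m n" using bezout_int by blast
    then have "c * of_int (gcd m n) = of_int u * (c * of_int m) + of_int v * (c * of_int n)"
      by (metis (no_types, opaque_lifting) distrib_left mult.left_commute of_int_add of_int_mult)
    then show ?thesis using that by simp
  qed
  \<comment> \<open>The values of the quadratic form at \<open>(1, 0)\<close>, \<open>(0, 1)\<close>
    and \<open>(1, 1)\<close> are \<open>A\<close>, \<open>C\<close> and \<open>A + B + C\<close>.
    They have no common divisor, so Bezout makes \<open>c\<close> itself an integer.\<close>
  have "c * of_int (gcd (A ^ r) (C ^ r)) \<in> \<int>"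
    using int[of "(1, 0)"] int[of "(0, 1)"] by (intro gcd) (simp_all add: quad_at_def)
  then have "c * of_int (gcd (gcd (A ^ r) (C ^ r)) ((A + B + C) ^ r)) \<in> \<int>"
    using int[of "(1, 1)"] gcd[of "gcd (A ^ r) (C ^ r)" "(A + B + C) ^ r"] by (simp add: quad_at_def)
  moreover have "gcd (gcd (A ^ r) (C ^ r)) ((A + B + C) ^ r) = 1"
  proof -
    have "gcd (gcd A C) (A + B + C) dvd gcd A (gcd B C)"
    proof (intro gcd_greatest)
      have 1: "gcd (gcd A C) (A + B + C) dvd A" "gcd (gcd A C) (A + B + C) dvd C"
        by (meson dvd_trans gcd_dvd1 gcd_dvd2)+
      then have "gcd (gcd A C) (A + B + C) dvd (A + B + C) - A - C" by (intro dvd_diff) auto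
      then show "gcd (gcd A C) (A + B + C) dvd B" by simp
    qed (meson dvd_trans gcd_dvd1 gcd_dvd2)+
    then have "coprime (gcd A C) (A + B + C)" using assms by (simp add: coprime_iff_gcd_eq_1)
    then have "coprime (gcd A C ^ r) ((A + B + C) ^ r)" by simp
    then show ?thesis by (simp add: gcd_exp coprime_iff_gcd_eq_1)
  qed
  ultimately have "c * of_int 1 \<in> \<int>" by metis
  then have "c \<in> \<int>" by simp
  then obtain k :: int where k: "c = of_int k" by (elim Ints_cases)
  have "k \<noteq> 0" using k D_nz chi_nz r_pos by (auto simp: c_def)
  then have "1 \<le> cmod c" by (simp add: k)
  also have "cmod c = 4 * (real r)\<^sup>2 * \<bar>D\<bar> * cmod \<chi> ^ r"
    by (simp add: c_def norm_mult norm_power)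
  finally have "1 \<le> 4 * (real r)\<^sup>2 * \<bar>D\<bar> * cmod \<chi> ^ r" .
  then have "1 * sqrt \<bar>D\<bar> ^ r \<le> 4 * (real r)\<^sup>2 * \<bar>D\<bar> * cmod \<chi> ^ r * sqrt \<bar>D\<bar> ^ r"
    by (intro mult_right_mono) auto
  moreover have "cmod jac = cmod \<chi> * sqrt \<bar>D\<bar>"
    unfolding cmod_sqrt_D[symmetric] sqrt_D_def norm_divide using chi_nz by simp
  then have "cmod jac ^ r = cmod \<chi> ^ r * sqrt \<bar>D\<bar> ^ r" by (simp add: power_mult_distrib)
  ultimately show ?thesis by (simp add: mult_ac)
qed

text \<open>With the Pade coefficients this is small if \<open>\<eta> / \<xi>\<close> is close to \<open>1\<close> at both \<open>p\<close> and \<open>q\<close>.\<close>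

definition thue_comb :: "nat \<Rightarrow> (nat \<Rightarrow> int) \<Rightarrow> int \<times> int \<Rightarrow> int \<times> int \<Rightarrow> complex" where
  "thue_comb n c p q =
    xi q * eta p * (\<Sum>k\<le>n. of_int (c k) * (xi p ^ r) ^ k * (eta p ^ r) ^ (n - k)) -
    xi p * eta q * (\<Sum>k\<le>n. of_int (c k) * (eta p ^ r) ^ k * (xi p ^ r) ^ (n - k))"

text \<open>With \<open>w = r * sqrt_D\<close>, multiplication by
  \<open>(2 * w) ^ n * (2 * r / \<chi>)\<close> turns the two terms of the combination into a
  conjugate pair. A nonzero difference is then at least \<open>2 * cmod w\<close>, and
  \<open>cmod \<chi> * cmod w / r\<close> is \<open>cmod jac\<close>.\<close>

lemma thue_comb_lower_bound:
  assumes "thue_comb n c p q \<noteq> 0"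
  shows "cmod jac \<le> cmod (thue_comb n c p q) * (2 * (real r * sqrt \<bar>D\<bar>)) ^ n"
proof -
  define w where "w = of_nat r * sqrt_D"
  have W: "w\<^sup>2 = of_int ((int r)\<^sup>2 * D)" by (simp add: w_def power_mult_distrib sqrt_D_sq)
  have w: "w \<noteq> 0" using r_pos jac_nz chi_nz by (simp add: w_def sqrt_D_def)
  have w_cmod: "cmod w = real r * sqrt \<bar>D\<bar>" by (simp add: w_def norm_mult cmod_sqrt_D)
  obtain g :: int where g: "w * (xi p ^ r + eta p ^ r) = of_int g"
    using sum_powers_integral unfolding w_def by blast
  \<comment> \<open>The sum of the two \<open>r\<close>-th powers is \<open>g / w\<close> and their
    difference is the value of the form; doubling separates them.\<close>
  define u where "u = 2 * w * xi p ^ r"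
  define v where "v = 2 * w * eta p ^ r"
  have "u = of_int g + of_int (form_at r a p) * w" "v = of_int g - of_int (form_at r a p) * w"
    by (simp_all add: u_def v_def g[symmetric] form_at_eq algebra_simps)
  then have uv: "conjugate_pair w u v" unfolding conjugate_pair_def by blast
  define Q where "Q = (\<Sum>k\<le>n. of_int (c k) * u ^ k * v ^ (n - k))"
  define Q' where "Q' = (\<Sum>k\<le>n. of_int (c k) * v ^ k * u ^ (n - k))"
  have QQ': "conjugate_pair w Q Q'"
    unfolding Q_def Q'_def using uv
    by (intro conjugate_pair_sum conjugate_pair_mult[OF W] conjugate_pair_power[OF W]
        conjugate_pair_of_int) (auto intro: conjugate_pair_swap)
  have pw: "(2 * w) ^ n * (z * x ^ k * y ^ (n - k)) = z * (2 * w * x) ^ k * (2 * w * y) ^ (n - k)"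
    if "k \<le> n" for k x y z
  proof -
    have "(2 * w) ^ n = (2 * w) ^ k * (2 * w) ^ (n - k)" by (metis power_add le_add_diff_inverse that)
    then show ?thesis by (simp only: power_mult_distrib mult_ac)
  qed
  have Q: "Q = (2 * w) ^ n * (\<Sum>k\<le>n. of_int (c k) * (xi p ^ r) ^ k * (eta p ^ r) ^ (n - k))"
    unfolding Q_def u_def v_def sum_distrib_left by (intro sum.cong refl) (simp only: pw atMost_iff)
  have Q': "Q' = (2 * w) ^ n * (\<Sum>k\<le>n. of_int (c k) * (eta p ^ r) ^ k * (xi p ^ r) ^ (n - k))"
    unfolding Q'_def u_def v_def sum_distrib_left by (intro sum.cong refl) (simp only: pw atMost_iff)
  let ?e = "of_nat r * 2 * (xi q * eta p) / \<chi>" and ?e' = "of_nat r * 2 * (xi p * eta q) / \<chi>"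
  have "\<chi> * (of_nat r * of_int (polar p q) + of_int (point_det p q) * w) = of_nat r * 2 * (xi p * eta q)"
    "\<chi> * (of_nat r * of_int (polar p q) - of_int (point_det p q) * w) = of_nat r * 2 * (xi q * eta p)"
  proof -
    have jw: "\<chi> * w = of_nat r * jac" using chi_nz by (simp add: w_def sqrt_D_def)
    have "\<chi> * (of_nat r * of_int (polar p q) + of_int (point_det p q) * w) =
        of_nat r * (\<chi> * of_int (polar p q)) + (\<chi> * w) * of_int (point_det p q)"
      "\<chi> * (of_nat r * of_int (polar p q) - of_int (point_det p q) * w) =
        of_nat r * (\<chi> * of_int (polar p q)) - (\<chi> * w) * of_int (point_det p q)"
      by (simp_all add: algebra_simps)
    then show "\<chi> * (of_nat r * of_int (polar p q) + of_int (point_det p q) * w) = of_nat r * 2 * (xi p * eta q)"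
      "\<chi> * (of_nat r * of_int (polar p q) - of_int (point_det p q) * w) = of_nat r * 2 * (xi q * eta p)"
      unfolding jw mult.assoc xi_eta_sum[symmetric] xi_eta_diff[symmetric]
      by (simp_all add: algebra_simps)
  qed
  then have "?e' = of_int (int r * polar p q) + of_int (point_det p q) * w"
    "?e = of_int (int r * polar p q) - of_int (point_det p q) * w"
    using chi_nz by (simp_all add: field_simps)
  then have ee: "conjugate_pair w ?e ?e'"
    by (intro conjugate_pairI[of _ "int r * polar p q" "- point_det p q"]) simp_all
  have eq: "?e * Q - ?e' * Q' = (2 * w) ^ n * (of_nat r * 2 / \<chi>) * thue_comb n c p q"
    unfolding Q Q' thue_comb_def using chi_nz by (simp add: field_simps)
  have "?e * Q \<noteq> ?e' * Q'"
  proof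
    assume "?e * Q = ?e' * Q'"
    then have "(2 * w) ^ n * (of_nat r * 2 / \<chi>) * thue_comb n c p q = 0" unfolding eq[symmetric] by simp
    then show False using assms w r_pos chi_nz by simp
  qed
  then have "2 * cmod w \<le> cmod (?e * Q - ?e' * Q')"
    by (intro conjugate_pair_diff_ge conjugate_pair_mult[OF W ee QQ'])
  also have "\<dots> = (2 * cmod w) ^ n * (real r * 2 / cmod \<chi>) * cmod (thue_comb n c p q)"
    unfolding eq by (simp add: norm_mult norm_power norm_divide)
  finally have "cmod \<chi> * cmod w / real r \<le> (2 * cmod w) ^ n * cmod (thue_comb n c p q)"
    using chi_nz r_pos by (simp add: field_simps)
  moreover have "cmod \<chi> * cmod w / real r = cmod jac"
    using chi_nz r_pos by (simp add: w_def sqrt_D_def norm_mult norm_divide)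
  ultimately show ?thesis by (simp add: w_cmod mult.commute)
qed

end

section \<open>The Thue-Siegel argument for two large solutions\<close>

text \<open>The floor only changes the type: for \<open>r > 1\<close> and \<open>k \<le> n\<close>
  its argument is an integer.\<close>

definition scaled_pade :: "nat \<Rightarrow> nat \<Rightarrow> nat \<Rightarrow> int" where
  "scaled_pade r n k = \<lfloor>real r ^ (2 * n) * pade_coeff (1 / real r) n k\<rfloor>"

lemma of_int_scaled_pade:
  assumes "r > 1" "k \<le> n"
  shows "of_int (scaled_pade r n k) = real r ^ (2 * n) * pade_coeff (1 / real r) n k"
  using pade_coeff_integral[OF assms] by (auto simp: scaled_pade_def)

lemma pade_num_homogeneous:
  fixes u v :: complex
  assumes "r > 1" "u \<noteq> 0"
  shows "(\<Sum>k\<le>n. of_int (scaled_pade r n k) * v ^ k * u ^ (n - k)) =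
    of_nat r ^ (2 * n) * u ^ n * poly (pade_num r n) (v / u)"
proof -
  have "of_int (scaled_pade r n k) * v ^ k * u ^ (n - k) =
      of_nat r ^ (2 * n) * u ^ n * (of_real (pade_coeff (1 / real r) n k) * (v / u) ^ k)"
    if "k \<le> n" for k
  proof -
    have "of_int (scaled_pade r n k) = (of_nat r ^ (2 * n) * of_real (pade_coeff (1 / real r) n k) :: complex)"
      using arg_cong[OF of_int_scaled_pade[OF assms(1) that], of complex_of_real] by simp
    moreover have "u ^ n = u ^ k * u ^ (n - k)" by (metis power_add le_add_diff_inverse that)
    ultimately show ?thesis using assms(2) by (simp add: power_divide)
  qed
  then show ?thesis unfolding poly_pade_num sum_distrib_left by (intro sum.cong) auto
qed

text \<open>The denominator has the coefficients of the numerator in reverse order, so the same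
  integers serve both.\<close>

lemma pade_den_homogeneous:
  fixes u v :: complex
  assumes "r > 1" "u \<noteq> 0"
  shows "(\<Sum>k\<le>n. of_int (scaled_pade r n k) * u ^ k * v ^ (n - k)) =
    of_nat r ^ (2 * n) * u ^ n * poly (pade_den r n) (v / u)"
proof -
  have "of_int (scaled_pade r n (n - k)) * u ^ (n - k) * v ^ k =
      of_nat r ^ (2 * n) * u ^ n * (of_real (pade_coeff (1 / real r) n (n - k)) * (v / u) ^ k)"
    if "k \<le> n" for k
  proof -
    have "of_int (scaled_pade r n (n - k)) = (of_nat r ^ (2 * n) * of_real (pade_coeff (1 / real r) n (n - k)) :: complex)"
      using arg_cong[OF of_int_scaled_pade[OF assms(1), of "n - k" n], of complex_of_real] that by simp
    moreover have "u ^ n = u ^ k * u ^ (n - k)" by (metis power_add le_add_diff_inverse that)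
    ultimately show ?thesis using assms(2) by (simp add: power_divide)
  qed
  then have "(\<Sum>k\<le>n. of_int (scaled_pade r n (n - k)) * u ^ (n - k) * v ^ k) =
      of_nat r ^ (2 * n) * u ^ n * poly (pade_den r n) (v / u)"
    unfolding poly_pade_den sum_distrib_left by (intro sum.cong) auto
  then show ?thesis
    using sum.nat_diff_reindex[of "\<lambda>k. of_int (scaled_pade r n k) * u ^ k * v ^ (n - k)" "Suc n"]
    by (simp add: lessThan_Suc_atMost)
qed

lemma pade_num_homogeneous_bound:
  fixes u v :: complex
  assumes "r > 1" "cmod u \<le> M" "cmod v \<le> M"
  shows "cmod (\<Sum>k\<le>n. of_int (scaled_pade r n k) * v ^ k * u ^ (n - k)) \<le> real r ^ (2 * n) * 4 ^ n * M ^ n"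
proof -
  have M: "M \<ge> 0" using assms(2) norm_ge_zero order_trans by blast
  let ?c = "pade_coeff (1 / real r) n"
  have "cmod (\<Sum>k\<le>n. of_int (scaled_pade r n k) * v ^ k * u ^ (n - k)) \<le>
      (\<Sum>k\<le>n. real r ^ (2 * n) * ?c k * M ^ n)"
  proof (rule order_trans[OF norm_sum], rule sum_mono)
    fix k assume "k \<in> {..n}"
    then have k: "k \<le> n" by simp
    have "cmod v ^ k * cmod u ^ (n - k) \<le> M ^ k * M ^ (n - k)"
      using assms(2,3) M by (intro mult_mono power_mono) auto
    also have "\<dots> = M ^ n" using k by (simp flip: power_add)
    finally have "cmod v ^ k * cmod u ^ (n - k) \<le> M ^ n" .
    moreover have "\<bar>real_of_int (scaled_pade r n k)\<bar> = real r ^ (2 * n) * ?c k"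
      using of_int_scaled_pade[OF assms(1) k] pade_coeff_pos[of "1 / real r" k n] k assms(1) by simp
    ultimately have "\<bar>real_of_int (scaled_pade r n k)\<bar> * (cmod v ^ k * cmod u ^ (n - k)) \<le>
        real r ^ (2 * n) * ?c k * M ^ n" by (metis abs_ge_zero mult_left_mono)
    then show "cmod (of_int (scaled_pade r n k) * v ^ k * u ^ (n - k)) \<le> real r ^ (2 * n) * ?c k * M ^ n"
      by (simp add: norm_mult norm_power mult.assoc)
  qed
  also have "\<dots> = real r ^ (2 * n) * (\<Sum>k\<le>n. ?c k) * M ^ n"
    by (simp add: sum_distrib_left sum_distrib_right)
  also have "\<dots> \<le> real r ^ (2 * n) * 4 ^ n * M ^ n"
    using sum_pade_coeff_le[of "1 / real r" n] assms(1) M by (intro mult_right_mono mult_left_mono) auto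
  finally show ?thesis .
qed

context diagonal_form
begin

text \<open>If both vanished, \<open>xi q * eta p\<close> and \<open>xi p * eta q\<close>, which are
  not both zero, would solve a homogeneous system whose determinant is that of
  \<open>pade_independent\<close>. This forces \<open>eta p ^ r = xi p ^ r\<close>, against
  \<open>F\<close>.\<close>

lemma thue_comb_not_both_zero:
  assumes det: "point_det p q \<noteq> 0" and F: "form_at r a p \<noteq> 0" and xi: "xi p \<noteq> 0"
  shows "thue_comb n (scaled_pade r n) p q \<noteq> 0 \<or> thue_comb (Suc n) (scaled_pade r (Suc n)) p q \<noteq> 0"
proof (rule ccontr)
  assume "\<not> ?thesis"
  then have z: "thue_comb n (scaled_pade r n) p q = 0" "thue_comb (Suc n) (scaled_pade r (Suc n)) p q = 0"
    by auto
  define w where "w = eta p ^ r / xi p ^ r"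
  define x where "x = xi q * eta p"
  define y where "y = xi p * eta q"
  have r1: "r > 1" using r_ge by simp
  have u: "xi p ^ r \<noteq> 0" using xi by simp
  have eq: "x * poly (pade_den r N) w = y * poly (pade_num r N) w"
    if "thue_comb N (scaled_pade r N) p q = 0" for N
  proof -
    have "of_nat r ^ (2 * N) * (xi p ^ r) ^ N * (x * poly (pade_den r N) w - y * poly (pade_num r N) w) = 0"
      using that unfolding thue_comb_def pade_num_homogeneous[OF r1 u] pade_den_homogeneous[OF r1 u]
      by (simp add: x_def y_def w_def algebra_simps)
    then show ?thesis using u r_pos by simp
  qed
  have "x \<noteq> 0 \<or> y \<noteq> 0"
    using xi_eta_diff[of p q] jac_nz det by (auto simp: x_def y_def)
  moreover have "z * (poly (pade_num r n) w * poly (pade_den r (Suc n)) w) =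
      z * (poly (pade_num r (Suc n)) w * poly (pade_den r n) w)" if "z = x \<or> z = y" for z
    using eq[OF z(1)] eq[OF z(2)] that by algebra
  ultimately have "poly (pade_num r n) w * poly (pade_den r (Suc n)) w =
      poly (pade_num r (Suc n)) w * poly (pade_den r n) w" by (metis mult_left_cancel)
  then have "w = 1" by (rule pade_independent[OF r1])
  then show False using F form_at_eq[of p] u by (simp add: w_def)
qed

text \<open>One part is \<open>xi q\<close> times the Pade remainder at
  \<open>t = eta p / xi p\<close>, the other is the numerator times the error
  \<open>eta q - xi q\<close>. The condition \<open>2 * h \<le> size p ^ r\<close> gives
  \<open>cmod (xi p) \<ge> size p / 2\<close> and so \<open>cmod (t - 1) \<le> 1\<close>.\<close>

lemma thue_comb_upper_bound:
  assumes p: "near h p" and q: "near h q" and h: "h > 0"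
    and Zp: "2 * h \<le> size p ^ r" "size p > 0" and Zq: "size q > 0"
  shows "cmod (thue_comb n (scaled_pade r n) p q) \<le>
    real r ^ (2 * n) * 4 ^ n * size p ^ (r * n) * (size p * size q) *
    (8 * (4 * 2 ^ r) ^ n * (h / size p ^ r) ^ (2 * n + 1) + h / size q ^ r)"
proof -
  define e where "e = h / size p ^ r"
  have r1: "r > 1" using r_ge by simp
  have pw: "size p ^ r = size p * size p ^ (r - 1)" "size q ^ r = size q * size q ^ (r - 1)"
    using r_pos by (simp_all flip: power_Suc)
  have e: "0 < e" "e \<le> 1 / 2" using Zp h by (simp_all add: e_def field_simps)
  have dp: "cmod (eta p - xi p) \<le> e * size p"
    using p Zp h by (simp add: near_def e_def pw field_simps)
  have dq: "cmod (eta q - xi q) \<le> h / size q ^ r * size q"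
    using q Zq by (simp add: near_def pw field_simps)
  have xi_ge: "cmod (xi p) \<ge> size p / 2"
  proof -
    have "size p \<le> cmod (xi p) + cmod (eta p - xi p)"
      using norm_triangle_ineq[of "xi p" "eta p - xi p"] by (auto simp: size_def)
    moreover have "e * size p \<le> 1 / 2 * size p" using e Zp by (intro mult_right_mono) auto
    ultimately show ?thesis using dp by linarith
  qed
  then have xi: "xi p \<noteq> 0" using Zp by auto
  define t where "t = eta p / xi p"
  have t: "cmod (t - 1) \<le> 2 * e"
  proof -
    have "t - 1 = (eta p - xi p) / xi p" using xi by (simp add: t_def diff_divide_distrib)
    then have "cmod (t - 1) = cmod (eta p - xi p) / cmod (xi p)" by (simp add: norm_divide)
    also have "\<dots> \<le> (e * size p) / (size p / 2)" using dp xi_ge Zp e by (intro frac_le) auto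
    finally show ?thesis using Zp by simp
  qed
  have tr: "eta p ^ r / xi p ^ r = t ^ r" by (simp add: t_def power_divide)
  let ?num = "\<Sum>k\<le>n. of_int (scaled_pade r n k) * (eta p ^ r) ^ k * (xi p ^ r) ^ (n - k)"
  let ?den = "\<Sum>k\<le>n. of_int (scaled_pade r n k) * (xi p ^ r) ^ k * (eta p ^ r) ^ (n - k)"
  let ?R = "poly (pade_num r n) (t ^ r) - t * poly (pade_den r n) (t ^ r)"
  have u: "xi p ^ r \<noteq> 0" using xi by simp
  have "thue_comb n (scaled_pade r n) p q = xi q * (eta p * ?den - xi p * ?num) - xi p * (eta q - xi q) * ?num"
    by (simp add: thue_comb_def algebra_simps)
  also have "eta p * ?den - xi p * ?num = - (of_nat r ^ (2 * n) * (xi p ^ r) ^ n * xi p * ?R)"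
    unfolding pade_num_homogeneous[OF r1 u] pade_den_homogeneous[OF r1 u] tr
    using xi by (simp add: t_def algebra_simps)
  finally have "cmod (thue_comb n (scaled_pade r n) p q) \<le>
      cmod (xi q) * (real r ^ (2 * n) * cmod (xi p) ^ (r * n) * cmod (xi p) * cmod ?R) +
      cmod (xi p) * cmod (eta q - xi q) * cmod ?num"
    using norm_triangle_ineq4[of "xi q * - (of_nat r ^ (2 * n) * (xi p ^ r) ^ n * xi p * ?R)" "xi p * (eta q - xi q) * ?num"]
    by (simp add: norm_mult norm_power power_mult)
  also have "\<dots> \<le> size q * (real r ^ (2 * n) * size p ^ (r * n) * size p *
      (4 * 4 ^ n * 2 ^ (r * n) * (2 * e) ^ (2 * n + 1))) +
      size p * (h / size q ^ r * size q) * (real r ^ (2 * n) * 4 ^ n * size p ^ (r * n))"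
  proof (intro add_mono mult_mono)
    have "cmod ?R \<le> 4 * 4 ^ n * 2 ^ (r * n) * cmod (t - 1) ^ (2 * n + 1)"
      using t e by (intro pade_remainder_bound r1) auto
    also have "\<dots> \<le> 4 * 4 ^ n * 2 ^ (r * n) * (2 * e) ^ (2 * n + 1)"
      using t by (intro mult_left_mono power_mono) auto
    finally show "cmod ?R \<le> 4 * 4 ^ n * 2 ^ (r * n) * (2 * e) ^ (2 * n + 1)" .
    show "cmod (xi p) ^ (r * n) \<le> size p ^ (r * n)" by (intro power_mono xi_le_size norm_ge_zero)
    have "cmod (xi p ^ r) \<le> size p ^ r" "cmod (eta p ^ r) \<le> size p ^ r"
      by (auto simp: norm_power intro!: power_mono xi_le_size eta_le_size)
    then show "cmod ?num \<le> real r ^ (2 * n) * 4 ^ n * size p ^ (r * n)"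
      using pade_num_homogeneous_bound[OF r1, of "xi p ^ r" "size p ^ r" "eta p ^ r" n]
      by (simp add: power_mult)
  qed (use dq xi_le_size Zp Zq h e in \<open>auto intro!: mult_nonneg_nonneg\<close>)
  also have "\<dots> = real r ^ (2 * n) * 4 ^ n * size p ^ (r * n) * (size p * size q) *
      (8 * (4 * 2 ^ r) ^ n * e ^ (2 * n + 1) + h / size q ^ r)"
  proof -
    have 1: "(2 * e) ^ (2 * n + 1) = 2 * 4 ^ n * e ^ (2 * n + 1)"
      by (simp add: power_mult_distrib power_mult)
    have 2: "(4 * 2 ^ r) ^ n = (4 ^ n * 2 ^ (r * n) :: real)" by (simp add: power_mult_distrib power_mult)
    have "b * (A * S * a * (4 * G * T * (2 * G * E))) + a * (H * b) * (A * G * S) =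
        A * G * S * (a * b) * (8 * (G * T) * E + H)" for a b A S G T E H :: real
      by (simp add: algebra_simps)
    then show ?thesis unfolding 1 2 by blast
  qed
  finally show ?thesis unfolding e_def .
qed

text \<open>\<open>\<kappa> \<ge> 1\<close> means that \<open>cmod jac\<close> is at least
  \<open>2 * h powr (2 / r)\<close>, while the two bounds for \<open>thue_comb\<close> put it
  strictly below. The condition \<open>3 * ln \<kappa> \<le> ln X\<close> keeps \<open>D\<close>,
  and so the denominators, small compared with \<open>X\<close>.\<close>

lemma no_two_large_solutions:
  fixes h :: real and p q :: "int \<times> int"
  defines "X \<equiv> size p ^ r / h" and "Y \<equiv> size q ^ r / h" and "\<kappa> \<equiv> (cmod jac / 2) ^ r / h\<^sup>2"
  assumes r: "r \<ge> 5" and prim: "gcd A (gcd B C) = 1" and h: "h \<ge> 1"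
    and det: "point_det p q \<noteq> 0" and F: "form_at r a p \<noteq> 0" and p: "near h p" and q: "near h q"
    and Zq: "size q > 0" and \<kappa>: "\<kappa> \<ge> 1" "3 * ln \<kappa> \<le> ln X"
    and lnX: "ln X \<ge> 7 / 2 * (real r + 3) * ln (real r) + 6 * ln h"
    and lnY: "ln Y \<ge> (real r - 1) * ln X"
  shows False
proof -
  define s where "s = sqrt \<bar>D\<bar>"
  \<comment> \<open>Per degree there are \<open>r^2\<close> and \<open>4\<close> from the
    coefficients, \<open>h\<close> from \<open>size p ^ r = h * X\<close>, \<open>2 * r * s\<close>
    from the denominator, and \<open>4 * 2 ^ r\<close> from the Pade remainder.\<close>
  define M where "M = 32 * 2 ^ r * real r ^ 3 * h * s"
  have s: "s > 0" using D_nz by (simp add: s_def)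
  have M: "M > 0" using s r h by (simp add: M_def)
  have Zp: "size p > 0" using size_pos[OF F] .
  have X: "X > 0" and Y: "Y > 0" using Zp Zq h by (simp_all add: X_def Y_def)
  have jac: "cmod jac > 0" using jac_nz by simp
  have ln_pow: "ln (x ^ n) = real n * ln x" if "x > 0" for x :: real and n by (rule ln_realpow)
  have lnj: "real r * ln (cmod jac) = real r * ln 2 + 2 * ln h + ln \<kappa>"
  proof -
    have "ln \<kappa> = real r * (ln (cmod jac) - ln 2) - 2 * ln h"
      using jac h by (simp add: \<kappa>_def ln_div ln_pow)
    then show ?thesis by (simp add: algebra_simps)
  qed
  have lnM: "ln M \<le> 4 / 9 * ln X"
  proof -
    have "s ^ r \<le> 4 * (real r)\<^sup>2 * cmod jac ^ r * s\<^sup>2"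
      using sqrt_D_bound[OF prim] by (simp add: s_def)
    then have "ln (s ^ r) \<le> ln (2\<^sup>2 * (real r)\<^sup>2 * cmod jac ^ r * s\<^sup>2)"
      using s jac r by (subst ln_le_cancel_iff) auto
    then have "real r * ln s \<le> 2 * ln 2 + 2 * ln (real r) + real r * ln (cmod jac) + 2 * ln s"
      using s jac r ln_pow[of 2 2] by (simp add: ln_mult ln_pow)
    then have "(real r - 2) * ln s \<le> 2 * ln 2 + 2 * ln (real r) + real r * ln 2 + 2 * ln h + ln \<kappa>"
      unfolding lnj by (simp add: algebra_simps)
    then have "5 * ln 2 + real r * ln 2 + 3 * ln (real r) + ln h + ln s \<le> 4 / 9 * ln X"
      using \<kappa> h r lnX by (intro pade_constant_ln_le[where k = "ln \<kappa>"]) auto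
    moreover have "M = 2 ^ 5 * 2 ^ r * real r ^ 3 * h * s" by (simp add: M_def)
    then have "ln M = 5 * ln 2 + real r * ln 2 + 3 * ln (real r) + ln h + ln s"
      using s h r ln_pow[of 2 5] by (simp add: ln_mult ln_pow)
    ultimately show ?thesis by simp
  qed
  have X28: "ln X \<ge> 28"
  proof -
    have "ln (real r) \<ge> ln 5" using r by simp
    then have "ln (real r) \<ge> 1" using ln_five_bound by linarith
    moreover have "7 / 2 * (real r + 3) \<ge> 28" using r by simp
    ultimately have "28 * 1 \<le> 7 / 2 * (real r + 3) * ln (real r)" by (intro mult_mono) auto
    then have "28 \<le> 7 / 2 * (real r + 3) * ln (real r) + 6 * ln h"
      using h by (intro add_increasing2) auto
    then show ?thesis using lnX by (rule order_trans)
  qed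
  have "X \<ge> 2" using X28 ln_le_minus_one[OF X] by linarith
  then have hX: "2 * h \<le> size p ^ r" using h by (simp add: X_def field_simps)
  obtain n where n: "\<And>N. N \<in> {n, Suc n} \<Longrightarrow>
      (X * Y) powr (1 / real r) * ((M * X) ^ N / Y + 8 * ((M * X) ^ N / X ^ (2 * N + 1))) < 2"
    using pade_error_terms_small[OF r X Y M X28 lnY lnM] by blast
  obtain N where N: "N \<in> {n, Suc n}" and nz: "thue_comb N (scaled_pade r N) p q \<noteq> 0"
  proof -
    have "xi p \<noteq> 0"
    proof
      assume "xi p = 0"
      then have "size p ^ r \<le> h"
        using p r_pos by (simp add: near_def size_def flip: power_Suc)
      then show False using hX h by linarith
    qed
    then show ?thesis using thue_comb_not_both_zero[OF det F, of n] that by blast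
  qed
  define V where "V = 8 * (4 * 2 ^ r) ^ N * (1 / X) ^ (2 * N + 1) + 1 / Y"
  have V: "V \<ge> 0" using X Y by (simp add: V_def)
  have "cmod jac \<le> cmod (thue_comb N (scaled_pade r N) p q) * (2 * (real r * s)) ^ N"
    using thue_comb_lower_bound[OF nz] by (simp add: s_def)
  also have "\<dots> \<le> (real r ^ (2 * N) * 4 ^ N * size p ^ (r * N) * (size p * size q) * V) * (2 * (real r * s)) ^ N"
  proof (rule mult_right_mono)
    show "cmod (thue_comb N (scaled_pade r N) p q) \<le>
        real r ^ (2 * N) * 4 ^ N * size p ^ (r * N) * (size p * size q) * V"
      using thue_comb_upper_bound[OF p q _ hX Zp Zq, of N] h by (simp add: V_def X_def Y_def)
  qed (use s in simp)
  also have "\<dots> = (size p * size q) * (((8 * real r ^ 3 * h * s) * X) ^ N * V)"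
  proof -
    have "size p ^ (r * N) = (h * X) ^ N" using h by (simp add: X_def power_mult)
    moreover have "((8 * real r ^ 3 * h * s) * X) ^ N =
        real r ^ (2 * N) * 4 ^ N * (h * X) ^ N * (2 * (real r * s)) ^ N"
    proof -
      have "(8 * real r ^ 3 * h * s) * X = (real r)\<^sup>2 * 4 * (h * X) * (2 * (real r * s))"
        by (simp add: power2_eq_square power3_eq_cube)
      then show ?thesis by (simp only: power_mult_distrib power_mult)
    qed
    ultimately show ?thesis by (simp add: mult_ac)
  qed
  also have "((8 * real r ^ 3 * h * s) * X) ^ N * V \<le> (M * X) ^ N / Y + 8 * ((M * X) ^ N / X ^ (2 * N + 1))"
  proof -
    let ?m = "8 * real r ^ 3 * h * s"
    have m: "?m > 0" using r h s by simp
    have Mm: "M = ?m * (4 * 2 ^ r)" by (simp add: M_def)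
    have "?m * 1 \<le> ?m * (4 * 2 ^ r)" using m one_le_power[of "2 :: real" r] by (intro mult_left_mono) linarith+
    then have "(?m * X) ^ N / Y \<le> (M * X) ^ N / Y"
      using m X Y Mm by (intro divide_right_mono power_mono mult_right_mono) auto
    moreover have "(c * X) ^ N * (8 * d ^ N * (1 / X) ^ k) = 8 * ((c * d * X) ^ N / X ^ k)" for c d k
      by (simp add: power_mult_distrib power_divide)
    then have "(?m * X) ^ N * (8 * (4 * 2 ^ r) ^ N * (1 / X) ^ (2 * N + 1)) = 8 * ((M * X) ^ N / X ^ (2 * N + 1))"
      unfolding Mm by blast
    ultimately show ?thesis by (simp add: V_def distrib_left)
  qed
  finally have main: "cmod jac \<le> (size p * size q) * ((M * X) ^ N / Y + 8 * ((M * X) ^ N / X ^ (2 * N + 1)))"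
    using Zp Zq by (simp add: mult_left_mono)
  have root: "x = (x ^ r) powr (1 / real r)" if "x > 0" for x :: real
    using that r_pos by (simp add: powr_powr flip: powr_realpow)
  have "size p * size q = ((size p * size q) ^ r) powr (1 / real r)" using Zp Zq by (intro root) simp
  also have "(size p * size q) ^ r = h\<^sup>2 * (X * Y)"
    using h by (simp add: X_def Y_def power_mult_distrib power2_eq_square)
  also have "\<dots> powr (1 / real r) = h\<^sup>2 powr (1 / real r) * (X * Y) powr (1 / real r)"
    using X Y h by (simp add: powr_mult)
  finally have sizes: "size p * size q = h\<^sup>2 powr (1 / real r) * (X * Y) powr (1 / real r)" .
  have "h\<^sup>2 \<le> (cmod jac / 2) ^ r" using \<kappa>(1) h by (simp add: \<kappa>_def field_simps)
  then have "h\<^sup>2 powr (1 / real r) \<le> ((cmod jac / 2) ^ r) powr (1 / real r)"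
    by (intro powr_mono2) auto
  also have "\<dots> = cmod jac / 2" using root[of "cmod jac / 2"] jac by simp
  finally have "2 * h\<^sup>2 powr (1 / real r) \<le> cmod jac" by simp
  also note main
  also have "(size p * size q) * ((M * X) ^ N / Y + 8 * ((M * X) ^ N / X ^ (2 * N + 1))) =
      h\<^sup>2 powr (1 / real r) * ((X * Y) powr (1 / real r) * ((M * X) ^ N / Y + 8 * ((M * X) ^ N / X ^ (2 * N + 1))))"
    unfolding sizes by simp
  also have "\<dots> < h\<^sup>2 powr (1 / real r) * 2"
    using n[OF N] h by (intro mult_strict_left_mono) auto
  finally show False by simp
qed

end

section \<open>The absolute value of the discriminant\<close>

lemma card_roots_of_unity_complex:
  assumes "r > 0"
  shows "finite {z :: complex. z ^ r = 1}" "card {z :: complex. z ^ r = 1} = r"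
  using card_roots_unity_eq[OF assms] finite_roots_unity[of r] assms by auto

lemma prod_roots_of_unity:
  assumes r: "r > 0"
  shows "(\<Prod>z | z ^ r = 1. [:- z, 1 :: complex:]) = monom 1 r - 1"
proof -
  define U where "U = {z :: complex. z ^ r = 1}"
  have U: "finite U" "card U = r" using card_roots_of_unity_complex[OF r] by (simp_all add: U_def)
  define L where "L = (\<Prod>z\<in>U. [:- z, 1 :: complex:])"
  define P where "P = monom (1 :: complex) r - 1"
  have dL: "degree L = r" unfolding L_def by (subst degree_prod_eq_sum_degree) (auto simp: U)
  have lL: "coeff L r = 1"
  proof -
    have "lead_coeff L = 1" unfolding L_def by (simp add: lead_coeff_prod)
    then show ?thesis by (simp add: dL)
  qed
  have "coeff P r = 1" using r by (simp add: P_def)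
  have dP: "degree P \<le> r"
    unfolding P_def by (intro degree_diff_le) (auto simp: degree_monom_le)
  have deg: "degree (L - P) < r"
  proof (rule ccontr)
    assume "\<not> degree (L - P) < r"
    moreover have "degree (L - P) \<le> r" using dL dP by (intro degree_diff_le) auto
    ultimately have "degree (L - P) = r" by simp
    then have "lead_coeff (L - P) = 0" using lL \<open>coeff P r = 1\<close> by simp
    then have "L - P = 0" by (simp only: leading_coeff_0_iff)
    then show False using \<open>degree (L - P) = r\<close> r by simp
  qed
  have roots: "U \<subseteq> {x. poly (L - P) x = 0}"
    using U(1) by (auto simp: L_def P_def poly_prod poly_monom U_def)
  have "L - P = 0"
  proof (rule ccontr)
    assume nz: "L - P \<noteq> 0"
    then have "card U \<le> degree (L - P)"
      using card_mono[OF poly_roots_finite[OF nz] roots] card_poly_roots_bound[OF nz] by linarith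
    then show False using deg U(2) by simp
  qed
  then show ?thesis by (simp add: L_def P_def U_def)
qed

text \<open>Both sides are the derivative of \<open>x^r - 1\<close> at \<open>w\<close>, computed
  here by dividing by \<open>x - w\<close>.\<close>

lemma prod_roots_of_unity_diff:
  assumes r: "r > 0" and w: "w ^ r = (1 :: complex)"
  shows "(\<Prod>z\<in>{z. z ^ r = 1} - {w}. w - z) = of_nat r * w ^ (r - 1)"
proof -
  define U where "U = {z :: complex. z ^ r = 1}"
  have U: "finite U" "w \<in> U" using card_roots_of_unity_complex[OF r] w by (simp_all add: U_def)
  define G where "G = (\<Sum>i<r. monom (w ^ (r - Suc i)) i)"
  have "[:- w, 1:] * (\<Prod>z\<in>U - {w}. [:- z, 1:]) = monom 1 r - 1"
    using prod_roots_of_unity[OF r] prod.remove[OF U, of "\<lambda>z. [:- z, 1:]"] by (simp add: U_def)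
  also have "\<dots> = [:- w, 1:] * G"
    unfolding poly_eq_poly_eq_iff[symmetric] fun_eq_iff
  proof
    fix x :: complex
    have "x ^ r - w ^ r = (x - w) * (\<Sum>i<r. w ^ (r - Suc i) * x ^ i)"
      by (rule power_diff_sumr2)
    then show "poly (monom 1 r - 1) x = poly ([:- w, 1:] * G) x"
      unfolding w G_def by (simp add: poly_monom poly_sum algebra_simps)
  qed
  finally have "(\<Prod>z\<in>U - {w}. [:- z, 1:]) = G"
    by (rule mult_left_cancel[THEN iffD1, rotated]) simp
  then have "poly (\<Prod>z\<in>U - {w}. [:- z, 1:]) w = poly G w" by simp
  moreover have "poly G w = (\<Sum>i<r. w ^ (r - 1))"
    unfolding G_def poly_sum poly_monom by (intro sum.cong) (auto simp flip: power_add)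
  ultimately show ?thesis by (simp add: poly_prod U_def)
qed

text \<open>Squares over unordered pairs become a product over ordered pairs, which can be evaluated
  row by row.\<close>

lemma prod_square_symmetric:
  fixes g :: "nat \<Rightarrow> nat \<Rightarrow> 'a :: comm_monoid_mult"
  assumes "\<And>i j. g i j = g j i"
  shows "(\<Prod>j<n. \<Prod>i<j. (g i j)\<^sup>2) = (\<Prod>j<n. \<Prod>i\<in>{..<n} - {j}. g i j)"
proof (induction n)
  case (Suc n)
  have "(\<Prod>j<n. \<Prod>i\<in>{..<Suc n} - {j}. g i j) = (\<Prod>j<n. g n j * (\<Prod>i\<in>{..<n} - {j}. g i j))"
  proof (rule prod.cong)
    fix j assume "j \<in> {..<n}"
    then have "{..<Suc n} - {j} = insert n ({..<n} - {j})" by auto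
    then show "(\<Prod>i\<in>{..<Suc n} - {j}. g i j) = g n j * (\<Prod>i\<in>{..<n} - {j}. g i j)" by simp
  qed simp
  also have "\<dots> = (\<Prod>i<n. g i n) * (\<Prod>j<n. \<Prod>i\<in>{..<n} - {j}. g i j)"
    unfolding prod.distrib using assms by simp
  finally have 1: "(\<Prod>j<n. \<Prod>i\<in>{..<Suc n} - {j}. g i j) =
      (\<Prod>i<n. g i n) * (\<Prod>j<n. \<Prod>i\<in>{..<n} - {j}. g i j)" .
  have "{..<Suc n} - {n} = {..<n}" by auto
  then have "(\<Prod>j<Suc n. \<Prod>i\<in>{..<Suc n} - {j}. g i j) =
      (\<Prod>j<n. \<Prod>i\<in>{..<Suc n} - {j}. g i j) * (\<Prod>i<n. g i n)" by simp
  then show ?case unfolding 1 using Suc by (simp add: prod.distrib power2_eq_square mult_ac)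
qed simp

context diagonal_form
begin

text \<open>The linear factors are \<open>xi - \<zeta> i * eta\<close>, with pairwise determinants
  \<open>(\<zeta> i - \<zeta> j) * jac\<close>. Each of the \<open>r\<close> rows of ordered pairs
  contributes \<open>r * cmod jac ^ (r - 1)\<close>.\<close>

lemma cmod_form_disc: "cmod (form_disc r a) = real r ^ r * cmod jac ^ (r * (r - 1))"
proof -
  define U where "U = {z :: complex. z ^ r = 1}"
  have U: "finite U" "card U = r" using card_roots_of_unity_complex[OF r_pos] by (simp_all add: U_def)
  obtain \<zeta> where \<zeta>: "bij_betw \<zeta> {..<r} U"
    using ex_bij_betw_nat_finite[OF U(1)] U(2) by (auto simp: atLeast0LessThan)
  define P where "P = (\<lambda>i. \<alpha> - \<zeta> i * \<gamma>)"
  define Q where "Q = (\<lambda>i. \<beta> - \<zeta> i * \<delta>)"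
  have diff: "u ^ r - v ^ r = (\<Prod>i<r. u - \<zeta> i * v)" for u v :: complex
  proof (cases "v = 0")
    case True
    then show ?thesis using r_pos by simp
  next
    case False
    have "(u / v) ^ r - 1 = (\<Prod>z\<in>U. u / v - z)"
      using arg_cong[OF prod_roots_of_unity[OF r_pos], of "\<lambda>p. poly p (u / v)"]
      by (simp add: poly_prod poly_monom U_def)
    also have "\<dots> = (\<Prod>i<r. u / v - \<zeta> i)" by (rule prod.reindex_bij_betw[OF \<zeta>, symmetric])
    finally have "v ^ r * ((u / v) ^ r - 1) = (\<Prod>i<r. v * (u / v - \<zeta> i))"
      unfolding prod.distrib by simp
    also have "\<dots> = (\<Prod>i<r. u - \<zeta> i * v)"
      using False by (intro prod.cong) (auto simp: field_simps)
    finally have "v ^ r * ((u / v) ^ r - 1) = (\<Prod>i<r. u - \<zeta> i * v)" .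
    moreover have "v ^ r * ((u / v) ^ r - 1) = u ^ r - v ^ r"
      using False by (simp add: right_diff_distrib power_divide)
    ultimately show ?thesis by simp
  qed
  have "linear_factorization r a P Q"
    unfolding linear_factorization_def form_eq diff
    by (intro allI prod.cong) (auto simp: P_def Q_def algebra_simps)
  then have "form_disc r a = factor_disc r P Q" by (rule form_disc_eq)
  moreover have "cmod (factor_disc r P Q) = (\<Prod>j<r. \<Prod>i<j. (cmod (\<zeta> i - \<zeta> j) * cmod jac)\<^sup>2)"
  proof -
    have "P i * Q j - P j * Q i = (\<zeta> i - \<zeta> j) * jac" for i j
      by (simp add: P_def Q_def jac_def algebra_simps)
    then show ?thesis by (simp add: factor_disc_def norm_power norm_mult flip: prod_norm)
  qed
  also have "\<dots> = (\<Prod>j<r. \<Prod>i\<in>{..<r} - {j}. cmod (\<zeta> i - \<zeta> j) * cmod jac)"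
    by (rule prod_square_symmetric) (simp add: norm_minus_commute)
  also have "\<dots> = (\<Prod>j<r. real r * cmod jac ^ (r - 1))"
  proof (rule prod.cong)
    fix j assume "j \<in> {..<r}"
    then have j: "j < r" by simp
    have root: "\<zeta> j ^ r = 1" using \<zeta> j by (auto simp: bij_betw_def U_def)
    then have one: "cmod (\<zeta> j) = 1"
      using r_pos by (metis norm_ge_zero norm_one norm_power power_eq_1_iff less_numeral_extra(3) abs_of_nonneg real_norm_def)
    have inj: "inj_on \<zeta> {..<r}" and im: "\<zeta> ` {..<r} = U" using \<zeta> by (auto simp: bij_betw_def)
    have "bij_betw \<zeta> ({..<r} - {j}) (U - {\<zeta> j})"
      unfolding bij_betw_def using inj im j by (auto simp: inj_on_def)
    then have "(\<Prod>i\<in>{..<r} - {j}. cmod (\<zeta> i - \<zeta> j)) = (\<Prod>z\<in>U - {\<zeta> j}. cmod (z - \<zeta> j))"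
      by (rule prod.reindex_bij_betw)
    also have "\<dots> = cmod (\<Prod>z\<in>U - {\<zeta> j}. \<zeta> j - z)"
      by (simp add: norm_minus_commute flip: prod_norm)
    also have "\<dots> = real r"
      unfolding U_def prod_roots_of_unity_diff[OF r_pos root] using one by (simp add: norm_mult norm_power)
    finally show "(\<Prod>i\<in>{..<r} - {j}. cmod (\<zeta> i - \<zeta> j) * cmod jac) = real r * cmod jac ^ (r - 1)"
      using j by (simp add: prod.distrib)
  qed simp
  finally show ?thesis
    using \<open>form_disc r a = factor_disc r P Q\<close> by (simp add: power_mult_distrib mult.commute flip: power_mult)
qed

text \<open>With \<open>X i\<close> the size of the \<open>i\<close>-th solution, \<open>X 1 \<ge> \<kappa>^(1/2)\<close> and \<open>X (i + 1) \<ge> \<kappa> (X i)^(r-1)\<close>;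
  so \<open>X (m - 1)\<close> and \<open>X m\<close> are too large.\<close>

lemma no_long_chain:
  fixes h :: real and P :: "nat \<Rightarrow> int \<times> int" and m :: nat
  defines "\<kappa> \<equiv> (cmod jac / 2) ^ r / h\<^sup>2" and "R \<equiv> real r"
  assumes r: "r \<ge> 5" and prim: "gcd A (gcd B C) = 1" and h: "h \<ge> 1" and m: "m \<ge> 3"
    and hyp: "ln \<kappa> * ((R - 1) ^ (m - 1) - 2 * R - 1) \<ge> 7 * R\<^sup>2 * ln R + (R\<^sup>2 + R + 2) * ln h"
    and F: "\<And>i. i \<le> m \<Longrightarrow> form_at r a (P i) \<noteq> 0"
    and mono: "\<And>i j. i \<le> j \<Longrightarrow> j \<le> m \<Longrightarrow> size (P i) \<le> size (P j)"
    and det: "\<And>i j. i < j \<Longrightarrow> j \<le> m \<Longrightarrow> point_det (P i) (P j) \<noteq> 0"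
    and near: "\<And>i. i \<le> m \<Longrightarrow> h < size (P i) ^ r \<Longrightarrow> near h (P i)"
  shows False
proof -
  define X where "X = (\<lambda>i. size (P i) ^ r / h)"
  define E where "E = (R - 1) ^ (m - 1) - 2 * R - 1"
  have R: "R \<ge> 5" using r by (simp add: R_def)
  have Z: "size (P i) > 0" if "i \<le> m" for i using size_pos[OF F[OF that]] .
  have X0: "X i > 0" if "i \<le> m" for i using Z[OF that] h by (simp add: X_def)
  have jac: "cmod jac > 0" using jac_nz by simp
  have \<kappa>0: "\<kappa> > 0" using jac h by (simp add: \<kappa>_def)
  have E: "E > 0" using gap_exponent_pos[OF R m] by (simp add: E_def)
  have lnR: "ln R > 0" using R by simp
  have lnh: "ln h \<ge> 0" using h by simp
  have ln\<kappa>: "ln \<kappa> > 0"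
  proof -
    have "7 * R\<^sup>2 * ln R + (R\<^sup>2 + R + 2) * ln h > 0" using R lnR lnh by (intro add_pos_nonneg) auto
    then have "ln \<kappa> * E > 0" using hyp unfolding E_def by linarith
    then show ?thesis using E by (simp add: zero_less_mult_iff)
  qed
  then have \<kappa>1: "\<kappa> > 1" using \<kappa>0 by (simp add: ln_gt_zero_iff)
  have Zr: "size (P i) ^ r = h * X i" for i using h by (simp add: X_def)
  \<comment> \<open>\<open>P 0\<close> may be too small for \<open>near\<close>, so the chain starts
    with the cruder \<open>jac_le_sizes\<close>.\<close>
  have first: "ln \<kappa> / 2 \<le> ln (X 1)"
  proof -
    have "cmod jac \<le> 2 * (size (P 0) * size (P 1))" using det[of 0 1] m by (intro jac_le_sizes) auto
    also have "size (P 0) * size (P 1) \<le> size (P 1) * size (P 1)"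
      using mono[of 0 1] m Z[of 1] by (intro mult_right_mono) auto
    finally have "(cmod jac / 2) ^ r \<le> (size (P 1) * size (P 1)) ^ r"
      using jac by (intro power_mono) auto
    also have "\<dots> = h\<^sup>2 * (X 1)\<^sup>2" unfolding power_mult_distrib Zr by (simp add: power2_eq_square)
    finally have "\<kappa> \<le> (X 1)\<^sup>2" using h by (simp add: \<kappa>_def field_simps)
    then have "ln \<kappa> \<le> ln ((X 1)\<^sup>2)" using \<kappa>0 X0[of 1] m by (subst ln_le_cancel_iff) auto
    also have "\<dots> = 2 * ln (X 1)" using X0[of 1] m by (subst ln_realpow) auto
    finally show ?thesis by simp
  qed
  have nr: "near h (P i)" if i: "1 \<le> i" "i \<le> m" for i
  proof -
    have "ln (X 1) > 0" using first ln\<kappa> by linarith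
    then have "X 1 > 1" using X0[of 1] m by (simp add: ln_gt_zero_iff)
    then have "h < size (P 1) ^ r" unfolding Zr using h by simp
    also have "\<dots> \<le> size (P i) ^ r" using mono[of 1 i] i by (intro power_mono size_nonneg) auto
    finally show ?thesis using near i by blast
  qed
  have step: "ln \<kappa> + (R - 1) * ln (X i) \<le> ln (X (Suc i))" if i: "1 \<le> i" "i < m" for i
  proof -
    have "cmod jac * size (P i) ^ (r - 1) \<le> 2 * (h * size (P (Suc i)))"
      using i by (intro gap_principle det nr Z mono) auto
    then have "(cmod jac / 2 * size (P i) ^ (r - 1)) ^ r \<le> (h * size (P (Suc i))) ^ r"
      using jac Z[of i] i by (intro power_mono) auto
    then have "(cmod jac / 2) ^ r * (size (P i) ^ (r - 1)) ^ r \<le> h ^ r * (h * X (Suc i))"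
      by (simp only: power_mult_distrib Zr)
    moreover have "(size (P i) ^ (r - 1)) ^ r = (h * X i) ^ (r - 1)"
      unfolding Zr[symmetric] by (simp add: mult.commute flip: power_mult)
    moreover have "h ^ r * h = h\<^sup>2 * h ^ (r - 1)"
      using r by (simp add: power2_eq_square flip: power_Suc)
    then have "h ^ r * (h * X (Suc i)) = h\<^sup>2 * h ^ (r - 1) * X (Suc i)" by (metis mult.assoc)
    ultimately have "(cmod jac / 2) ^ r * (h ^ (r - 1) * X i ^ (r - 1)) \<le> h\<^sup>2 * h ^ (r - 1) * X (Suc i)"
      by (simp only: power_mult_distrib)
    then have "\<kappa> * X i ^ (r - 1) \<le> X (Suc i)" using h by (simp add: \<kappa>_def field_simps)
    then have "ln (\<kappa> * X i ^ (r - 1)) \<le> ln (X (Suc i))"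
      using \<kappa>0 X0[of i] X0[of "Suc i"] i by (subst ln_le_cancel_iff) auto
    moreover have "ln (\<kappa> * X i ^ (r - 1)) = ln \<kappa> + (R - 1) * ln (X i)"
      using \<kappa>0 X0[of i] i r by (simp add: ln_mult ln_realpow R_def of_nat_diff)
    ultimately show ?thesis by simp
  qed
  \<comment> \<open>The exponent of \<open>X 2\<close> is
    \<open>1 + (R - 1) / 2 = (R + 1) / 2\<close>; in the later steps the additional factor \<kappa>
    is dropped.\<close>
  have growth: "(R - 1) ^ i * (R + 1) / 2 * ln \<kappa> \<le> ln (X (i + 2))" if "i + 2 \<le> m" for i
    using that
  proof (induction i)
    case 0
    have "(R - 1) * (ln \<kappa> / 2) \<le> (R - 1) * ln (X 1)" using first R by (intro mult_left_mono) auto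
    moreover have "(R - 1) ^ 0 * (R + 1) / 2 * ln \<kappa> = ln \<kappa> + (R - 1) * (ln \<kappa> / 2)"
      by (simp add: field_simps)
    moreover have "ln \<kappa> + (R - 1) * ln (X 1) \<le> ln (X (0 + 2))"
      using step[of 1] 0 by (simp add: numeral_2_eq_2)
    ultimately show ?case by argo
  next
    case (Suc i)
    then have "(R - 1) * ((R - 1) ^ i * (R + 1) / 2 * ln \<kappa>) \<le> (R - 1) * ln (X (i + 2))"
      using R by (intro mult_left_mono) auto
    then show ?case using step[of "i + 2"] Suc ln\<kappa> by simp
  qed
  define e where "e = (R - 1) ^ (m - 3) * (R + 1) / 2"
  have m3: "m - 3 + 2 = m - 1" using m by simp
  have big: "e * ln \<kappa> \<le> ln (X (m - 1))" using growth[of "m - 3"] unfolding m3 e_def by simp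
  have "e * ln \<kappa> \<ge> 7 / 2 * (R + 3) * ln R + 6 * ln h"
  proof (rule hypothesis_exponents[OF R _ lnh _ E])
    show "E = (R - 1) ^ (m - 3 + 2) - 2 * R - 1" unfolding m3 by (rule E_def)
  qed (use hyp lnR in \<open>simp_all add: E_def e_def\<close>)
  moreover have "3 * ln \<kappa> \<le> e * ln \<kappa>"
  proof (rule mult_right_mono)
    have "1 * (R + 1) \<le> (R - 1) ^ (m - 3) * (R + 1)" using R by (intro mult_right_mono) auto
    then show "3 \<le> e" using R unfolding e_def by argo
  qed (use ln\<kappa> in simp)
  moreover have "Suc (m - 1) = m" "1 \<le> m - 1" using m by simp_all
  then have "(R - 1) * ln (X (m - 1)) \<le> ln (X m)" using step[of "m - 1"] ln\<kappa> by simp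
  ultimately have "3 * ln \<kappa> \<le> ln (X (m - 1))" "7 / 2 * (R + 3) * ln R + 6 * ln h \<le> ln (X (m - 1))"
    "(R - 1) * ln (X (m - 1)) \<le> ln (X m)" using big by linarith+
  then show False
    using \<kappa>1 m F nr Z det[of "m - 1" m] unfolding X_def \<kappa>_def R_def
    by (intro no_two_large_solutions[OF r prim h, of "P (m - 1)" "P m"]) simp_all
qed

end

section \<open>Counting solutions\<close>

definition up_to_sign :: "int \<times> int \<Rightarrow> (int \<times> int) set" where
  "up_to_sign = (\<lambda>(x, y). {(x, y), (- x, - y)})"

text \<open>If the determinant is zero, coprimality makes the coordinates of the two points divide
  each other.\<close>

lemma point_det_nonzero:
  assumes "gcd (fst p) (snd p) = 1" "gcd (fst q) (snd q) = 1" "up_to_sign p \<noteq> up_to_sign q"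
  shows "point_det p q \<noteq> 0"
proof
  obtain x y x' y' where pq: "p = (x, y)" "q = (x', y')" by fastforce
  assume "point_det p q = 0"
  then have eq: "x * y' = y * x'" by (simp add: point_det_def pq)
  have c: "coprime x y" "coprime x' y'" using assms(1,2) by (simp_all add: pq coprime_iff_gcd_eq_1)
  have "x dvd y * x'" "y' dvd y * x'" by (simp_all flip: eq)
  moreover have "y dvd x * y'" "x' dvd x * y'" by (simp_all add: eq)
  ultimately have "x dvd x'" "y dvd y'" "x' dvd x" "y' dvd y"
    using c coprime_dvd_mult_right_iff[of x y x'] coprime_dvd_mult_right_iff[of y x y']
      coprime_dvd_mult_left_iff[of x' y' x] coprime_dvd_mult_left_iff[of y' x' y]
    by (simp_all add: coprime_commute)
  then have abs: "\<bar>x\<bar> = \<bar>x'\<bar>" "\<bar>y\<bar> = \<bar>y'\<bar>" by (auto intro: zdvd_antisym_abs)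
  have "(x' = x \<and> y' = y) \<or> (x' = - x \<and> y' = - y)"
  proof (cases "x = 0 \<or> y = 0")
    case True
    then show ?thesis using abs by auto
  next
    case False
    have "x' = x \<or> x' = - x" using abs(1) by linarith
    then show ?thesis
    proof
      assume "x' = x"
      then have "x * y' = x * y" using eq by (simp only: mult.commute)
      then show ?thesis using \<open>x' = x\<close> False by simp
    next
      assume "x' = - x"
      then have "x * y' = x * - y" unfolding eq by simp
      then have "y' = - y" using False mult_left_cancel[of x y' "- y"] by blast
      then show ?thesis using \<open>x' = - x\<close> by simp
    qed
  qed
  then show False using assms(3) by (auto simp: up_to_sign_def pq)
qed

lemma abs_diff_power_ge:
  fixes x y :: real
  assumes "x \<ge> 0" "y \<ge> 0" "n > 0"
  shows "\<bar>x - y\<bar> * max x y ^ (n - 1) \<le> \<bar>x ^ n - y ^ n\<bar>"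
proof -
  have *: "(x - y) * x ^ (n - 1) \<le> x ^ n - y ^ n" if "y \<le> x" "0 \<le> y" for x y :: real
  proof -
    have "x ^ n - y ^ n = x * x ^ (n - 1) - y * y ^ (n - 1)"
      using assms(3) by (simp flip: power_Suc)
    moreover have "y * y ^ (n - 1) \<le> y * x ^ (n - 1)" using that by (intro mult_left_mono power_mono) auto
    ultimately show ?thesis by (simp add: left_diff_distrib)
  qed
  show ?thesis
  proof (cases "y \<le> x")
    case True
    then show ?thesis using *[of y x] assms power_mono[of y x n] by (simp add: max_def)
  next
    case False
    then show ?thesis using *[of x y] assms power_mono[of x y n] by (simp add: max_def)
  qed
qed

text \<open>Choose \<omega> with \<open>z = \<omega> * cis \<theta>\<close> and
  \<open>\<bar>r * \<theta>\<bar> \<le> pi\<close>. The distance of \<open>cis t\<close> from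
  \<open>1\<close> increases with \<open>\<bar>t\<bar>\<close> up to \<open>pi\<close>, so passing
  from \<open>r * \<theta>\<close> to \<theta> does not increase it.\<close>

lemma ex_near_root_of_unity:
  fixes z :: complex
  assumes "cmod z = 1" "r > 0"
  shows "\<exists>\<omega>. \<omega> ^ r = 1 \<and> cmod (z - \<omega>) \<le> cmod (z ^ r - 1)"
proof -
  define \<theta> where "\<theta> = Arg (z ^ r) / real r"
  have zr: "z ^ r = cis (real r * \<theta>)"
  proof -
    have "z ^ r \<noteq> 0" using assms by auto
    then have "cis (Arg (z ^ r)) = sgn (z ^ r)" by (rule cis_Arg)
    then show ?thesis using assms by (simp add: \<theta>_def sgn_eq norm_power)
  qed
  have bound: "\<bar>real r * \<theta>\<bar> \<le> pi" using Arg_bounded[of "z ^ r"] assms(2) by (auto simp: \<theta>_def)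
  define \<omega> where "\<omega> = z * cis (- \<theta>)"
  have "\<omega> ^ r = 1" by (simp add: \<omega>_def power_mult_distrib zr DeMoivre cis_mult)
  moreover have "cmod (z - \<omega>) \<le> cmod (z ^ r - 1)"
  proof -
    have norm: "(cmod (cis t - 1))\<^sup>2 = 2 - 2 * cos t" for t
    proof -
      have "(cmod (cis t - 1))\<^sup>2 = (cos t)\<^sup>2 + (sin t)\<^sup>2 + 1 - 2 * cos t"
        unfolding cmod_power2 by (simp add: power2_eq_square algebra_simps)
      then show ?thesis by simp
    qed
    have "1 * \<bar>\<theta>\<bar> \<le> real r * \<bar>\<theta>\<bar>" using assms(2) by (intro mult_right_mono) auto
    then have "cos \<bar>real r * \<theta>\<bar> \<le> cos \<bar>\<theta>\<bar>"
      using bound by (intro cos_monotone_0_pi_le) (auto simp: abs_mult)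
    then have "(cmod (cis \<theta> - 1))\<^sup>2 \<le> (cmod (cis (real r * \<theta>) - 1))\<^sup>2"
      unfolding norm by simp
    then have "cmod (cis \<theta> - 1) \<le> cmod (z ^ r - 1)" unfolding zr by (simp add: power_mono_iff)
    moreover have "z - \<omega> = \<omega> * (cis \<theta> - 1)"
      by (simp add: \<omega>_def algebra_simps cis_mult)
    moreover have "cmod \<omega> = 1" using assms(1) by (simp add: \<omega>_def norm_mult)
    ultimately show ?thesis by (simp add: norm_mult)
  qed
  ultimately show ?thesis by blast
qed

text \<open>The negated conjunction also covers an infinite image, whose \<open>card\<close> is
  \<open>0\<close>. The indices \<open>0\<close> to \<open>m\<close> give \<open>m + 1\<close>
  representatives.\<close>

lemma obtain_sorted_representatives:
  fixes f :: "'a \<Rightarrow> real" and g :: "'a \<Rightarrow> 'b"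
  assumes "\<not> (finite (g ` T) \<and> card (g ` T) \<le> m)"
  obtains P where "\<And>i. i \<le> m \<Longrightarrow> P i \<in> T" "\<And>i j. i \<le> j \<Longrightarrow> j \<le> m \<Longrightarrow> f (P i) \<le> f (P j)"
    "\<And>i j. i < j \<Longrightarrow> j \<le> m \<Longrightarrow> g (P i) \<noteq> g (P j)"
proof -
  obtain S where S: "finite S" "card S = Suc m" "S \<subseteq> g ` T"
  proof (cases "finite (g ` T)")
    case True
    then have "Suc m \<le> card (g ` T)" using assms by auto
    then show ?thesis using obtain_subset_with_card_n that by blast
  next
    case False
    then show ?thesis using infinite_arbitrarily_large[of _ "Suc m"] that by blast
  qed
  obtain U where U: "U \<subseteq> T" "inj_on g U" "g ` U = S" using S(3) unfolding subset_image_inj by blast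
  have "finite U" "card U = Suc m" using U S by (auto simp: finite_image_iff card_image)
  obtain ys where ys: "set ys = U" "distinct ys" using finite_distinct_list[OF \<open>finite U\<close>] by blast
  define zs where "zs = sort_key f ys"
  have zs: "set zs = U" "distinct zs" "sorted (map f zs)" by (simp_all add: zs_def ys)
  have len: "length zs = Suc m" using distinct_card[OF zs(2)] zs(1) \<open>card U = Suc m\<close> by simp
  show ?thesis
  proof (rule that[of "(!) zs"])
    show "zs ! i \<in> T" if "i \<le> m" for i using that len zs(1) U(1) nth_mem[of i zs] by auto
    show "f (zs ! i) \<le> f (zs ! j)" if "i \<le> j" "j \<le> m" for i j
      using sorted_nth_mono[OF zs(3), of i j] that len by simp
    show "g (zs ! i) \<noteq> g (zs ! j)" if "i < j" "j \<le> m" for i j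
    proof
      assume "g (zs ! i) = g (zs ! j)"
      moreover have "zs ! i \<in> U" "zs ! j \<in> U" using that len zs(1) nth_mem by auto
      ultimately have "zs ! i = zs ! j" using U(2) by (auto simp: inj_on_def)
      then show False using that len zs(2) by (simp add: nth_eq_iff_index_eq)
    qed
  qed
qed

section \<open>Solutions that belong to one root of unity\<close>

text \<open>\<open>hyp\<close> is the hypothesis on the discriminant after taking logarithms and
  cancelling \<open>r - 1\<close>. It involves \<open>jac\<close> only through
  \<open>cmod jac\<close>, so it survives multiplying \<open>eta\<close> by a root of unity.\<close>

locale thue_problem = diagonal_form +
  fixes h :: nat and m :: nat
  assumes r5: "r \<ge> 5" and prim: "gcd A (gcd B C) = 1" and h1: "h \<ge> 1" and m3: "m \<ge> 3"
    and hyp: "ln ((cmod jac / 2) ^ r / (real h)\<^sup>2) * ((real r - 1) ^ (m - 1) - 2 * real r - 1) \<ge>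
      7 * (real r)\<^sup>2 * ln (real r) + ((real r)\<^sup>2 + real r + 2) * ln (real h)"
begin

lemma primitive_solutionsD:
  assumes "p \<in> primitive_solutions r a h"
  shows "gcd (fst p) (snd p) = 1" "form_at r a p \<noteq> 0" "cmod (xi p ^ r - eta p ^ r) \<le> h"
proof -
  show "gcd (fst p) (snd p) = 1" "form_at r a p \<noteq> 0"
    using assms by (auto simp: primitive_solutions_def form_at_def)
  have "\<bar>form_at r a p\<bar> \<le> int h"
    using assms by (auto simp: primitive_solutions_def form_at_def)
  then have "\<bar>real_of_int (form_at r a p)\<bar> \<le> real h" by linarith
  then show "cmod (xi p ^ r - eta p ^ r) \<le> h" by (simp flip: form_at_eq)
qed

text \<open>As \<open>near\<close> is required only above the threshold \<open>h\<close>, smaller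
  solutions may be put into any class without increasing the bound \<open>m\<close>: in a chain only
  the first solution can be that small.\<close>

lemma near_class_bound:
  assumes T: "T \<subseteq> primitive_solutions r a h"
    and near: "\<And>p. p \<in> T \<Longrightarrow> h < size p ^ r \<Longrightarrow> near h p"
  shows "finite (up_to_sign ` T) \<and> card (up_to_sign ` T) \<le> m"
proof (rule ccontr)
  assume "\<not> ?thesis"
  then show False
  proof (rule obtain_sorted_representatives[where f = size])
    fix P
    assume P: "\<And>i. i \<le> m \<Longrightarrow> P i \<in> T" "\<And>i j. i \<le> j \<Longrightarrow> j \<le> m \<Longrightarrow> size (P i) \<le> size (P j)"
      "\<And>i j. i < j \<Longrightarrow> j \<le> m \<Longrightarrow> up_to_sign (P i) \<noteq> up_to_sign (P j)"
    have sol: "P i \<in> primitive_solutions r a h" if "i \<le> m" for i using T P(1) that by blast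
    show False
    proof (rule no_long_chain[OF r5 prim _ m3 hyp])
      show "form_at r a (P i) \<noteq> 0" if "i \<le> m" for i using primitive_solutionsD(2)[OF sol[OF that]] .
      show "point_det (P i) (P j) \<noteq> 0" if "i < j" "j \<le> m" for i j
        using that P(3) sol by (intro point_det_nonzero primitive_solutionsD) auto
    qed (use P(1,2) near h1 in auto)
  qed
qed

text \<open>Dividing \<open>eta\<close> by \<omega> gives another diagonalization with the same
  \<open>A\<close>, \<open>B\<close>, \<open>C\<close>, the same \<open>size\<close> and the same
  \<open>cmod jac\<close>. For it the condition is \<open>near\<close>.\<close>

lemma root_class_bound:
  assumes \<omega>: "\<omega> ^ r = 1" and T: "T \<subseteq> primitive_solutions r a h"
    and near: "\<And>p. p \<in> T \<Longrightarrow> h < size p ^ r \<Longrightarrow> cmod (eta p - \<omega> * xi p) * size p ^ (r - 1) \<le> h"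
  shows "finite (up_to_sign ` T) \<and> card (up_to_sign ` T) \<le> m"
proof -
  define c where "c = 1 / \<omega>"
  have \<omega>0: "\<omega> \<noteq> 0" using \<omega> r_pos by (auto simp: zero_power)
  have cr: "c ^ r = 1" using \<omega> by (simp add: c_def power_divide)
  have c1: "cmod c = 1"
  proof -
    have "cmod c ^ r = 1" using cr by (metis norm_one norm_power)
    then show ?thesis using r_pos by (metis norm_ge_zero power_eq_1_iff abs_of_nonneg less_numeral_extra(3) real_norm_def)
  qed
  have diag': "diagonalization r a \<alpha> \<beta> (c * \<gamma>) (c * \<delta>)"
  proof -
    have "\<alpha> * (c * \<delta>) - \<beta> * (c * \<gamma>) = c * jac" by (simp add: jac_def algebra_simps)
    then have "\<alpha> * (c * \<delta>) - \<beta> * (c * \<gamma>) \<noteq> 0" using jac_nz c1 by auto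
    moreover have "(c * \<gamma> * x + c * \<delta> * y) ^ r = (\<gamma> * x + \<delta> * y) ^ r" for x y
    proof -
      have "c * \<gamma> * x + c * \<delta> * y = c * (\<gamma> * x + \<delta> * y)" by (simp add: algebra_simps)
      then show ?thesis by (simp add: power_mult_distrib cr)
    qed
    ultimately show ?thesis unfolding diagonalization_def by (simp add: form_eq)
  qed
  have quad': "\<alpha> * (c * \<gamma>) = c * \<chi> * of_int A" "\<alpha> * (c * \<delta>) + \<beta> * (c * \<gamma>) = c * \<chi> * of_int B"
    "\<beta> * (c * \<delta>) = c * \<chi> * of_int C"
  proof -
    have "\<alpha> * (c * \<gamma>) = c * (\<alpha> * \<gamma>)" "\<alpha> * (c * \<delta>) + \<beta> * (c * \<gamma>) = c * (\<alpha> * \<delta> + \<beta> * \<gamma>)"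
      "\<beta> * (c * \<delta>) = c * (\<beta> * \<delta>)" by (simp_all add: algebra_simps)
    then show "\<alpha> * (c * \<gamma>) = c * \<chi> * of_int A" "\<alpha> * (c * \<delta>) + \<beta> * (c * \<gamma>) = c * \<chi> * of_int B"
      "\<beta> * (c * \<delta>) = c * \<chi> * of_int C" unfolding quad by simp_all
  qed
  interpret E: diagonal_form r a \<alpha> \<beta> "c * \<gamma>" "c * \<delta>" "c * \<chi>" A B C
    by unfold_locales (use r_ge diag' quad' in auto)
  have eta: "E.eta p = c * eta p" for p
    unfolding E.eta_def eta_def by (simp add: algebra_simps)
  have sz: "E.size p = size p" for p
    by (simp add: E.size_def size_def eta norm_mult c1)
  have "cmod E.jac = cmod (c * jac)" unfolding E.jac_def jac_def by (simp add: algebra_simps)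
  then have jac: "cmod E.jac = cmod jac" by (simp add: norm_mult c1)
  interpret E: thue_problem r a \<alpha> \<beta> "c * \<gamma>" "c * \<delta>" "c * \<chi>" A B C h m
    by unfold_locales (use r5 prim h1 m3 hyp in \<open>auto simp: jac\<close>)
  show ?thesis
  proof (rule E.near_class_bound[OF T])
    fix p assume p: "p \<in> T" "h < E.size p ^ r"
    have "c * \<omega> = 1" using \<omega>0 by (simp add: c_def)
    then have "E.eta p - E.xi p = c * (eta p - \<omega> * xi p)"
      by (simp add: eta right_diff_distrib flip: mult.assoc)
    then show "E.near h p" using near[OF p(1)] p(2) by (simp add: E.near_def sz norm_mult c1)
  qed
qed

lemma kappa_gt_one: "(cmod jac / 2) ^ r / (real h)\<^sup>2 > 1"
proof -
  let ?\<kappa> = "(cmod jac / 2) ^ r / (real h)\<^sup>2" and ?E = "(real r - 1) ^ (m - 1) - 2 * real r - 1"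
  have E: "?E > 0" using r5 m3 by (intro gap_exponent_pos) auto
  have "7 * (real r)\<^sup>2 * ln (real r) + ((real r)\<^sup>2 + real r + 2) * ln (real h) > 0"
    using r5 h1 by (intro add_pos_nonneg) auto
  then have "ln ?\<kappa> * ?E > 0" using hyp by linarith
  then have "ln ?\<kappa> > 0" using E by (simp add: zero_less_mult_iff)
  moreover have "?\<kappa> > 0" using jac_nz h1 by simp
  ultimately show ?thesis by (simp add: ln_gt_zero_iff)
qed

text \<open>\<open>xi p ^ r - eta p ^ r\<close> and
  \<open>r * sqrt_D * (xi p ^ r + eta p ^ r)\<close> are integers, and \<open>sqrt_D\<close> is real
  or purely imaginary. So conjugation fixes both powers or exchanges them up to sign.\<close>

lemma cnj_relations:
  shows "cnj sqrt_D = sgn (real_of_int D) * sqrt_D"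
    and "D > 0 \<Longrightarrow> cnj (xi p ^ r) = xi p ^ r" "D > 0 \<Longrightarrow> cnj (eta p ^ r) = eta p ^ r"
    and "D < 0 \<Longrightarrow> cnj (xi p ^ r) = - (eta p ^ r)"
proof -
  have "Re (sqrt_D\<^sup>2) = D" "Im (sqrt_D\<^sup>2) = 0" using sqrt_D_sq by simp_all
  then have sq: "(Re sqrt_D)\<^sup>2 - (Im sqrt_D)\<^sup>2 = D" "Re sqrt_D = 0 \<or> Im sqrt_D = 0"
    by (auto simp: power2_eq_square)
  have pos: "Im sqrt_D = 0" if "D > 0"
  proof (rule ccontr)
    assume "Im sqrt_D \<noteq> 0"
    then have "real_of_int D = - (Im sqrt_D)\<^sup>2" using sq by auto
    moreover have "- (Im sqrt_D)\<^sup>2 \<le> 0" by simp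
    ultimately show False using that by (metis not_le of_int_0_less_iff)
  qed
  have neg: "Re sqrt_D = 0" if "D < 0"
  proof (rule ccontr)
    assume "Re sqrt_D \<noteq> 0"
    then have "real_of_int D = (Re sqrt_D)\<^sup>2" using sq by auto
    moreover have "(Re sqrt_D)\<^sup>2 \<ge> 0" by simp
    ultimately show False using that by (metis not_le of_int_less_0_iff)
  qed
  show cs: "cnj sqrt_D = sgn (real_of_int D) * sqrt_D"
    using pos neg D_nz by (cases "D > 0") (auto simp: complex_eq_iff)
  obtain g :: int where g: "of_nat r * sqrt_D * (xi p ^ r + eta p ^ r) = of_int g"
    using sum_powers_integral by blast
  have s0: "sqrt_D \<noteq> 0" using jac_nz chi_nz by (simp add: sqrt_D_def)
  have sum: "sgn (real_of_int D) * cnj (xi p ^ r + eta p ^ r) = xi p ^ r + eta p ^ r"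
  proof -
    have "cnj (of_nat r * sqrt_D * (xi p ^ r + eta p ^ r)) = of_nat r * sqrt_D * (xi p ^ r + eta p ^ r)"
      unfolding g by simp
    then have "of_nat r * sqrt_D * (sgn (real_of_int D) * cnj (xi p ^ r + eta p ^ r)) =
        of_nat r * sqrt_D * (xi p ^ r + eta p ^ r)"
      by (simp only: complex_cnj_mult cs complex_cnj_of_nat mult_ac)
    then show ?thesis using s0 r_pos by (simp only: mult_cancel_left) auto
  qed
  have diff: "cnj (xi p ^ r - eta p ^ r) = xi p ^ r - eta p ^ r"
    unfolding form_at_eq[symmetric] by simp
  have two: "2 * cnj (xi p ^ r) = cnj (xi p ^ r + eta p ^ r) + cnj (xi p ^ r - eta p ^ r)"
    "2 * cnj (eta p ^ r) = cnj (xi p ^ r + eta p ^ r) - cnj (xi p ^ r - eta p ^ r)" by simp_all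
  show "cnj (xi p ^ r) = xi p ^ r" "cnj (eta p ^ r) = eta p ^ r" if "D > 0"
  proof -
    have "cnj (xi p ^ r + eta p ^ r) = xi p ^ r + eta p ^ r" using sum that by simp
    then have "2 * cnj (xi p ^ r) = 2 * xi p ^ r" "2 * cnj (eta p ^ r) = 2 * eta p ^ r"
      unfolding two diff by simp_all
    then show "cnj (xi p ^ r) = xi p ^ r" "cnj (eta p ^ r) = eta p ^ r" by simp_all
  qed
  show "cnj (xi p ^ r) = - (eta p ^ r)" if "D < 0"
  proof -
    have "- cnj (xi p ^ r + eta p ^ r) = xi p ^ r + eta p ^ r" using sum that by simp
    then have "cnj (xi p ^ r + eta p ^ r) = - (xi p ^ r + eta p ^ r)" by (metis add.inverse_inverse)
    then have "2 * cnj (xi p ^ r) = 2 * - (eta p ^ r)" unfolding two diff by simp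
    then show ?thesis by (simp only: mult_cancel_left) auto
  qed
qed

text \<open>As \<open>cmod (eta p / xi p) = 1\<close>, every solution, large or not, lies in the
  class of one of the \<open>r\<close> roots of unity.\<close>

lemma negative_discriminant_bound:
  assumes "D < 0"
  shows "finite (up_to_sign ` primitive_solutions r a h) \<and>
    card (up_to_sign ` primitive_solutions r a h) \<le> r * m"
proof -
  define U where "U = {z :: complex. z ^ r = 1}"
  define T where "T = (\<lambda>\<omega>. {p \<in> primitive_solutions r a h. cmod (eta p - \<omega> * xi p) * size p ^ (r - 1) \<le> h})"
  have U: "finite U" "card U = r" using card_roots_of_unity_complex[OF r_pos] by (simp_all add: U_def)
  have bound: "finite (up_to_sign ` T \<omega>)" "card (up_to_sign ` T \<omega>) \<le> m" if "\<omega> \<in> U" for \<omega>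
    using root_class_bound[of \<omega> "T \<omega>"] that by (auto simp: U_def T_def)
  have "\<exists>\<omega>\<in>U. p \<in> T \<omega>" if p: "p \<in> primitive_solutions r a h" for p
  proof -
    have "cmod (xi p) ^ r = cmod (eta p) ^ r"
      using arg_cong[OF cnj_relations(4)[OF assms, of p], of cmod] by (simp add: norm_power)
    then have eq: "cmod (xi p) = cmod (eta p)" using r_pos by (simp add: power_eq_iff_eq_base)
    then have sz: "size p = cmod (xi p)" by (simp add: size_def)
    have nz: "xi p \<noteq> 0" using size_pos[OF primitive_solutionsD(2)[OF p]] sz by auto
    then have "cmod (eta p / xi p) = 1" by (simp add: norm_divide flip: eq)
    then obtain \<omega> where \<omega>: "\<omega> ^ r = 1" "cmod (eta p / xi p - \<omega>) \<le> cmod ((eta p / xi p) ^ r - 1)"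
      using ex_near_root_of_unity r_pos by blast
    have "cmod (eta p - \<omega> * xi p) * size p ^ (r - 1) = cmod (eta p / xi p - \<omega>) * cmod (xi p) ^ r"
    proof -
      have "eta p - \<omega> * xi p = (eta p / xi p - \<omega>) * xi p" using nz by (simp add: left_diff_distrib)
      then show ?thesis using r_pos by (simp add: sz norm_mult mult.assoc flip: power_Suc)
    qed
    also have "\<dots> \<le> cmod ((eta p / xi p) ^ r - 1) * cmod (xi p) ^ r" using \<omega>(2) by (intro mult_right_mono) auto
    also have "\<dots> = cmod (xi p ^ r - eta p ^ r)"
    proof -
      have "eta p ^ r - xi p ^ r = ((eta p / xi p) ^ r - 1) * xi p ^ r"
        using nz by (simp add: left_diff_distrib power_divide)
      then show ?thesis by (metis norm_minus_commute norm_mult norm_power)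
    qed
    finally show ?thesis using primitive_solutionsD(3)[OF p] p \<omega>(1) by (auto simp: T_def U_def)
  qed
  then have "primitive_solutions r a h = (\<Union>\<omega>\<in>U. T \<omega>)" by (auto simp: T_def)
  then have im: "up_to_sign ` primitive_solutions r a h = (\<Union>\<omega>\<in>U. up_to_sign ` T \<omega>)" by (simp add: image_UN)
  have "card (\<Union>\<omega>\<in>U. up_to_sign ` T \<omega>) \<le> (\<Sum>\<omega>\<in>U. card (up_to_sign ` T \<omega>))" by (rule card_UN_le[OF U(1)])
  also have "\<dots> \<le> (\<Sum>\<omega>\<in>U. m)" using bound by (intro sum_mono) auto
  finally show ?thesis unfolding im using U bound by auto
qed

section \<open>Counting for positive \<open>D\<close>\<close>

text \<open>For \<open>D > 0\<close> both powers are real, so \<open>Re\<close> loses nothing and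
  they have the same strict sign.\<close>

definition aligned :: "int \<times> int \<Rightarrow> bool" where
  "aligned p \<longleftrightarrow> Re (xi p ^ r) * Re (eta p ^ r) > 0"

text \<open>For \<open>D > 0\<close> and aligned \<open>p\<close> this is an \<open>r\<close>-th
  root of unity, the one to whose class \<open>p\<close> belongs.\<close>

definition ratio_sgn :: "int \<times> int \<Rightarrow> complex" where
  "ratio_sgn p = sgn (eta p / xi p)"

text \<open>If the real numbers \<open>u\<close> and \<open>v\<close> do not have the same strict
  sign, then \<open>\<bar>u - v\<bar>\<close>, which is at most \<open>h\<close>, dominates both
  absolute values.\<close>

lemma aligned_if_large:
  assumes "D > 0" "p \<in> primitive_solutions r a h" "h < size p ^ r"
  shows "aligned p"
proof (rule ccontr)
  assume neg: "\<not> aligned p"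
  have "xi p ^ r \<in> \<real>" "eta p ^ r \<in> \<real>"
    unfolding Reals_cnj_iff by (rule cnj_relations(2,3)[OF assms(1)])+
  then obtain u v where uv: "xi p ^ r = of_real u" "eta p ^ r = of_real v"
    by (elim Reals_cases)
  have "u * v \<le> 0" using neg by (simp add: aligned_def uv)
  then have "\<bar>u\<bar> \<le> \<bar>u - v\<bar>" "\<bar>v\<bar> \<le> \<bar>u - v\<bar>" by (auto simp: mult_le_0_iff)
  moreover have "\<bar>u - v\<bar> \<le> h"
    using primitive_solutionsD(3)[OF assms(2)] unfolding uv by (simp flip: of_real_diff)
  moreover have "cmod (xi p) ^ r = \<bar>u\<bar>" "cmod (eta p) ^ r = \<bar>v\<bar>"
    using uv by (simp_all flip: norm_power)
  ultimately have "size p ^ r \<le> h" by (auto simp: size_def max_def)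
  then show False using assms(3) by simp
qed

lemma aligned_ratio:
  assumes "D > 0" "aligned p"
  shows "xi p \<noteq> 0" "eta p \<noteq> 0" "eta p = ratio_sgn p * of_real (cmod (eta p) / cmod (xi p)) * xi p"
    "cmod (ratio_sgn p) = 1" "ratio_sgn p ^ r = 1"
    "cmod (xi p ^ r - eta p ^ r) = \<bar>cmod (xi p) ^ r - cmod (eta p) ^ r\<bar>"
proof -
  show nz: "xi p \<noteq> 0" "eta p \<noteq> 0" using assms(2) r_pos by (auto simp: aligned_def zero_power)
  show "eta p = ratio_sgn p * of_real (cmod (eta p) / cmod (xi p)) * xi p"
    using nz by (simp add: ratio_sgn_def sgn_eq norm_divide)
  show "cmod (ratio_sgn p) = 1" unfolding ratio_sgn_def norm_sgn using nz by simp
  have "xi p ^ r \<in> \<real>" "eta p ^ r \<in> \<real>"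
    unfolding Reals_cnj_iff by (rule cnj_relations(2,3)[OF assms(1)])+
  then obtain u v where uv: "xi p ^ r = of_real u" "eta p ^ r = of_real v"
    by (elim Reals_cases)
  have pos: "u * v > 0" using assms(2) by (simp add: aligned_def uv)
  have n: "cmod (xi p) ^ r = \<bar>u\<bar>" "cmod (eta p) ^ r = \<bar>v\<bar>"
    using uv by (simp_all flip: norm_power)
  have "ratio_sgn p ^ r = (eta p ^ r / xi p ^ r) / of_real (cmod (eta p) ^ r / cmod (xi p) ^ r)"
    by (simp add: ratio_sgn_def sgn_eq norm_divide power_divide power_mult_distrib)
  also have "\<dots> = of_real ((v / u) / (\<bar>v\<bar> / \<bar>u\<bar>))" unfolding uv n by simp
  also have "(v / u) / (\<bar>v\<bar> / \<bar>u\<bar>) = 1" using pos by (auto simp: zero_less_mult_iff)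
  finally show "ratio_sgn p ^ r = 1" by simp
  show "cmod (xi p ^ r - eta p ^ r) = \<bar>cmod (xi p) ^ r - cmod (eta p) ^ r\<bar>"
    using pos unfolding n unfolding uv by (auto simp: zero_less_mult_iff simp flip: of_real_diff)
qed

text \<open>\<open>eta p\<close> and \<open>ratio_sgn p * xi p\<close> have the same direction, so
  their distance is that of the absolute values, to which \<open>abs_diff_power_ge\<close>
  applies.\<close>

lemma aligned_near:
  assumes "D > 0" "aligned p" "p \<in> primitive_solutions r a h"
  shows "cmod (eta p - ratio_sgn p * xi p) * size p ^ (r - 1) \<le> h"
proof -
  note rho = aligned_ratio[OF assms(1,2)]
  have "eta p - ratio_sgn p * xi p = ratio_sgn p * xi p * of_real (cmod (eta p) / cmod (xi p) - 1)"
    by (subst rho(3)) (simp add: algebra_simps)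
  then have "cmod (eta p - ratio_sgn p * xi p) = cmod (xi p) * \<bar>cmod (eta p) / cmod (xi p) - 1\<bar>"
    by (simp add: norm_mult rho(4) del: of_real_diff of_real_divide)
  also have "\<dots> = \<bar>cmod (xi p) * (cmod (eta p) / cmod (xi p) - 1)\<bar>" by (simp add: abs_mult)
  also have "\<dots> = \<bar>cmod (xi p) - cmod (eta p)\<bar>" using rho(1) by (simp add: right_diff_distrib abs_minus_commute)
  finally have "cmod (eta p - ratio_sgn p * xi p) * size p ^ (r - 1) \<le> cmod (xi p ^ r - eta p ^ r)"
    using abs_diff_power_ge[of "cmod (xi p)" "cmod (eta p)" r] r_pos
    unfolding rho(6) by (simp add: size_def)
  then show ?thesis using primitive_solutionsD(3)[OF assms(3)] by simp
qed

text \<open>For positive \<open>D\<close> the quotient of two ratios \<open>\<eta> / \<xi>\<close> is real.\<close>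

lemma aligned_ratio_sgn_eq:
  assumes D: "D > 0" and p: "aligned p" and q: "aligned q"
  shows "ratio_sgn q = ratio_sgn p \<or> ratio_sgn q = - ratio_sgn p"
proof -
  note rp = aligned_ratio[OF D p] and rq = aligned_ratio[OF D q]
  define c where "c = ratio_sgn q / ratio_sgn p"
  have p0: "ratio_sgn p \<noteq> 0" using rp(4) by auto
  have c: "c = sgn ((xi p * eta q) / (xi q * eta p))"
    using rp(1,2) rq(1,2) by (simp add: c_def ratio_sgn_def sgn_mult sgn_divide field_simps)
  have cs: "cnj sqrt_D = sqrt_D" using cnj_relations(1) D by simp
  have s: "2 * (xi p * eta q) = \<chi> * (of_int (polar p q) + sqrt_D * of_int (point_det p q))"
    "2 * (xi q * eta p) = \<chi> * (of_int (polar p q) - sqrt_D * of_int (point_det p q))"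
  proof -
    have j: "\<chi> * sqrt_D = jac" using chi_nz by (simp add: sqrt_D_def)
    show "2 * (xi p * eta q) = \<chi> * (of_int (polar p q) + sqrt_D * of_int (point_det p q))"
      unfolding distrib_left mult.assoc[symmetric] j xi_eta_sum[symmetric] xi_eta_diff[symmetric] by simp
    show "2 * (xi q * eta p) = \<chi> * (of_int (polar p q) - sqrt_D * of_int (point_det p q))"
      unfolding right_diff_distrib mult.assoc[symmetric] j xi_eta_sum[symmetric] xi_eta_diff[symmetric] by simp
  qed
  have "(xi p * eta q) / (xi q * eta p) = (2 * (xi p * eta q)) / (2 * (xi q * eta p))" by simp
  also have "\<dots> = (of_int (polar p q) + sqrt_D * of_int (point_det p q)) /
      (of_int (polar p q) - sqrt_D * of_int (point_det p q))"
    unfolding s using chi_nz by simp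
  finally have "cnj ((xi p * eta q) / (xi q * eta p)) = (xi p * eta q) / (xi q * eta p)" by (simp add: cs)
  then have "(xi p * eta q) / (xi q * eta p) \<in> \<real>" by (simp add: Reals_cnj_iff)
  then obtain x where x: "(xi p * eta q) / (xi q * eta p) = of_real x" by (rule Reals_cases)
  then have "x \<noteq> 0" using rp(1,2) rq(1,2) by auto
  then have "c = 1 \<or> c = - 1" unfolding c x by (auto simp: sgn_of_real sgn_if)
  then show ?thesis using p0 by (auto simp: c_def field_simps)
qed

lemma positive_discriminant_bound:
  assumes D: "D > 0"
  shows "finite (up_to_sign ` primitive_solutions r a h) \<and>
    card (up_to_sign ` primitive_solutions r a h) \<le> (if even r then 2 else 1) * m"
proof (cases "\<exists>p \<in> primitive_solutions r a h. aligned p")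
  case False
  \<comment> \<open>Without aligned solutions there are no large ones, so the condition for the
    class of \<open>1\<close> is vacuous.\<close>
  have "finite (up_to_sign ` primitive_solutions r a h) \<and> card (up_to_sign ` primitive_solutions r a h) \<le> m"
    by (rule root_class_bound[of 1]) (use False aligned_if_large[OF D] in auto)
  then show ?thesis by auto
next
  case True
  then obtain p0 where p0: "p0 \<in> primitive_solutions r a h" "aligned p0" by blast
  define \<rho> where "\<rho> = ratio_sgn p0"
  define S where "S = primitive_solutions r a h"
  \<comment> \<open>The solutions that are not aligned are never large and are counted with \<rho>
    at no cost.\<close>
  define T1 where "T1 = {p \<in> S. aligned p \<longrightarrow> ratio_sgn p = \<rho>}"
  define T2 where "T2 = {p \<in> S. aligned p \<and> ratio_sgn p = - \<rho>}"
  have T1: "finite (up_to_sign ` T1) \<and> card (up_to_sign ` T1) \<le> m"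
  proof (rule root_class_bound)
    show "\<rho> ^ r = 1" using aligned_ratio(5)[OF D p0(2)] by (simp add: \<rho>_def)
    fix p assume "p \<in> T1" "h < size p ^ r"
    then show "cmod (eta p - \<rho> * xi p) * size p ^ (r - 1) \<le> h"
      using aligned_near[OF D, of p] aligned_if_large[OF D, of p] by (auto simp: T1_def S_def)
  qed (auto simp: T1_def S_def)
  \<comment> \<open>A member of \<open>T2\<close> makes both \<rho> and \<open>- \<rho>\<close>
    roots of unity, so \<open>T2\<close> is empty for odd \<open>r\<close>.\<close>
  have T2: "finite (up_to_sign ` T2) \<and> card (up_to_sign ` T2) \<le> (if even r then m else 0)"
  proof (cases "T2 = {}")
    case True
    then show ?thesis by simp
  next
    case False
    then obtain q where q: "aligned q" "ratio_sgn q = - \<rho>" by (auto simp: T2_def)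
    have one: "(- \<rho>) ^ r = 1" using aligned_ratio(5)[OF D q(1)] q(2) by simp
    moreover have "\<rho> ^ r = 1" using aligned_ratio(5)[OF D p0(2)] by (simp add: \<rho>_def)
    ultimately have "even r" by (metis power_minus_odd one_neq_neg_one)
    moreover have "finite (up_to_sign ` T2) \<and> card (up_to_sign ` T2) \<le> m"
    proof (rule root_class_bound[OF one])
      fix p assume "p \<in> T2" "h < size p ^ r"
      then show "cmod (eta p - (- \<rho>) * xi p) * size p ^ (r - 1) \<le> h"
        using aligned_near[OF D, of p] by (auto simp: T2_def S_def)
    qed (auto simp: T2_def S_def)
    ultimately show ?thesis by simp
  qed
  have "S = T1 \<union> T2"
    using aligned_ratio_sgn_eq[OF D p0(2)] by (auto simp: T1_def T2_def \<rho>_def)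
  then have im: "up_to_sign ` S = up_to_sign ` T1 \<union> up_to_sign ` T2" by (simp add: image_Un)
  have "card (up_to_sign ` S) \<le> card (up_to_sign ` T1) + card (up_to_sign ` T2)"
    unfolding im by (rule card_Un_le)
  then show ?thesis using T1 T2 unfolding S_def[symmetric] by (auto simp: im split: if_splits)
qed

text \<open>For aligned \<open>p\<close> the equation \<eta> = \<open>ratio_sgn p\<close> * \<xi>
  amounts to one real linear equation in \<open>x\<close> and \<open>y\<close>. At a nontrivial real
  solution the form vanishes.\<close>

lemma definite_not_aligned:
  assumes D: "D > 0" and "definite_form r a"
  shows "\<not> aligned p"
proof
  assume p: "aligned p"
  note rp = aligned_ratio[OF D p]
  obtain x1 y1 where xy1: "p = (x1, y1)" by fastforce
  have cs: "cnj sqrt_D = sqrt_D" using cnj_relations(1) D by simp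
  then have "sqrt_D \<in> \<real>" by (simp only: Reals_cnj_iff)
  then obtain s where s: "sqrt_D = of_real s" by (rule Reals_cases)
  define c where "c = cmod (xi p) / cmod (eta p)"
  \<comment> \<open>The equation is equivalent to \<open>xi p * \<eta> = c * \<xi> * eta p\<close>,
    that is, \<open>l + s * d = c * (l - s * d)\<close> with the polar form \<open>l\<close> and the
    determinant \<open>d\<close> of \<open>p\<close> and \<open>(x, y)\<close>; \<open>l1\<close>
    and \<open>l2\<close> are its coefficients.\<close>
  define l1 where "l1 = (1 - c) * (2 * A * x1 + B * y1) - (1 + c) * s * y1"
  define l2 where "l2 = (1 - c) * (B * x1 + 2 * C * y1) + (1 + c) * s * x1"
  obtain x y :: real where xy: "(x, y) \<noteq> (0, 0)" "l1 * x + l2 * y = 0"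
  proof (cases "l1 = 0 \<and> l2 = 0")
    case True
    then show ?thesis using that[of 1 0] by simp
  next
    case False
    then show ?thesis using that[of l2 "- l1"] by auto
  qed
  define \<xi> where "\<xi> = \<alpha> * of_real x + \<beta> * of_real y"
  define \<eta> where "\<eta> = \<gamma> * of_real x + \<delta> * of_real y"
  define l where "l = (2 * A * x1 + B * y1) * x + (B * x1 + 2 * C * y1) * y"
  define d where "d = x1 * y - y1 * x"
  have j: "\<chi> * of_real s = jac" using chi_nz by (simp add: sqrt_D_def flip: s)
  have sum: "xi p * \<eta> + \<xi> * eta p = \<chi> * of_real l"
  proof -
    have "xi p * \<eta> + \<xi> * eta p =
        2 * (\<alpha> * \<gamma>) * (of_int x1 * of_real x) + (\<alpha> * \<delta> + \<beta> * \<gamma>) * (of_int x1 * of_real y + of_int y1 * of_real x) +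
        2 * (\<beta> * \<delta>) * (of_int y1 * of_real y)"
      by (simp add: xi_def eta_def \<xi>_def \<eta>_def xy1 algebra_simps)
    then show ?thesis unfolding quad by (simp add: l_def algebra_simps)
  qed
  have diff: "xi p * \<eta> - \<xi> * eta p = \<chi> * of_real (s * d)"
  proof -
    have "xi p * \<eta> - \<xi> * eta p = jac * of_real d"
      by (simp add: xi_def eta_def \<xi>_def \<eta>_def xy1 d_def jac_def algebra_simps)
    then show ?thesis by (simp add: j[symmetric])
  qed
  have "(1 - c) * l + (1 + c) * (s * d) = 0"
    using xy(2) by (simp add: l1_def l2_def l_def d_def algebra_simps)
  then have lin: "l + s * d = c * (l - s * d)" by (simp add: algebra_simps)
  have "2 * (xi p * \<eta>) = \<chi> * of_real (l + s * d)" "2 * (\<xi> * eta p) = \<chi> * of_real (l - s * d)"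
    unfolding of_real_add of_real_diff distrib_left right_diff_distrib sum[symmetric] diff[symmetric]
    by simp_all
  then have "2 * (xi p * \<eta>) = of_real c * (2 * (\<xi> * eta p))"
    unfolding lin by (simp add: mult_ac)
  then have "xi p * \<eta> = of_real c * \<xi> * eta p" by simp
  also have "eta p = ratio_sgn p * of_real (1 / c) * xi p"
    using rp(3) by (simp add: c_def)
  finally have "\<eta> = ratio_sgn p * \<xi>" using rp(1,2) by (simp add: c_def field_simps)
  then have "\<eta> ^ r = \<xi> ^ r" by (simp add: power_mult_distrib rp(5))
  then have "form_eval r a (of_real x) (of_real y :: complex) = 0"
    unfolding form_eq by (simp add: \<xi>_def \<eta>_def)
  moreover have "form_eval r a (of_real x) (of_real y :: complex) = of_real (form_eval r a x y)"
    by (simp add: form_eval_def)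
  ultimately have "form_eval r a x y = 0" by (metis of_real_eq_0_iff)
  then show False using assms(2) xy(1) unfolding definite_form_def by (metis less_irrefl)
qed

text \<open>No solution is aligned, hence all are small; by \<open>jac_le_sizes\<close> two
  different ones would contradict \<open>kappa_gt_one\<close>.\<close>

lemma definite_bound:
  assumes D: "D > 0" and "definite_form r a"
  shows "card (up_to_sign ` primitive_solutions r a h) \<le> 1"
proof -
  have eq: "up_to_sign p = up_to_sign q"
    if p: "p \<in> primitive_solutions r a h" and q: "q \<in> primitive_solutions r a h" for p q
  proof (rule ccontr)
    assume "up_to_sign p \<noteq> up_to_sign q"
    then have det: "point_det p q \<noteq> 0"
      using p q by (intro point_det_nonzero primitive_solutionsD)
    have le: "size x ^ r \<le> h" if "x \<in> primitive_solutions r a h" for x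
      using aligned_if_large[OF D that] definite_not_aligned[OF assms] by (meson not_le)
    have "(cmod jac / 2) ^ r \<le> (size p * size q) ^ r"
      using jac_le_sizes[OF det] by (intro power_mono) auto
    also have "\<dots> \<le> real h * real h"
      unfolding power_mult_distrib using le[OF p] le[OF q] by (intro mult_mono) (auto simp: size_nonneg)
    finally have "(cmod jac / 2) ^ r / (real h)\<^sup>2 \<le> 1" using h1 by (simp add: power2_eq_square field_simps)
    then show False using kappa_gt_one by simp
  qed
  show ?thesis
  proof (cases "finite (up_to_sign ` primitive_solutions r a h)")
    case True
    have "\<forall>c\<in>up_to_sign ` primitive_solutions r a h. \<forall>d\<in>up_to_sign ` primitive_solutions r a h. c = d"
      using eq by blast
    then show ?thesis unfolding One_nat_def card_le_Suc0_iff_eq[OF True] .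
  qed simp
qed

lemma solutions_bound:
  "finite (primitive_solutions r a h)
    \<and> (D < 0 \<longrightarrow> num_primitive_solutions r a h \<le> r * m)
    \<and> (D > 0 \<longrightarrow> num_primitive_solutions r a h \<le> (if even r then 2 else 1) * m)
    \<and> (D > 0 \<and> definite_form r a \<longrightarrow> num_primitive_solutions r a h \<le> 1)"
proof -
  have num: "num_primitive_solutions r a h = card (up_to_sign ` primitive_solutions r a h)"
    by (simp add: num_primitive_solutions_def up_to_sign_def)
  have "finite (up_to_sign ` primitive_solutions r a h)"
    using negative_discriminant_bound positive_discriminant_bound D_nz by (cases "D < 0") auto
  then have "finite (\<Union> (up_to_sign ` primitive_solutions r a h))"
    by (intro finite_Union) (auto simp: up_to_sign_def)
  moreover have "primitive_solutions r a h \<subseteq> \<Union> (up_to_sign ` primitive_solutions r a h)"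
    by (auto simp: up_to_sign_def)
  ultimately have "finite (primitive_solutions r a h)" by (rule rev_finite_subset)
  then show ?thesis
    unfolding num using negative_discriminant_bound positive_discriminant_bound definite_bound by blast
qed

end

theorem theorem1p4:
  fixes r h m :: nat and a :: "nat \<Rightarrow> int" and A B C D :: int
    and \<Delta>' \<alpha>\<^sub>1 \<alpha>\<^sub>2 :: real
  assumes "r \<ge> 5" and "h \<ge> 1" and "m \<ge> 3"
    and "diagonalizable r a"
    and "quadratic_of r a A B C"
    and "D = B\<^sup>2 - 4 * A * C"
    and "\<Delta>' = cmod (form_disc r a) / (2 ^ (r\<^sup>2 - r) * real r ^ r * real h ^ (2 * r - 2))"
    and "\<alpha>\<^sub>1 = 7 * (real r)\<^sup>2 * (real r - 1) / ((real r - 1) ^ (m - 1) - 2 * real r - 1)"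
    and "\<alpha>\<^sub>2 = (real r - 1) * ((real r)\<^sup>2 + real r + 2) / ((real r - 1) ^ (m - 1) - 2 * real r - 1)"
    and "\<Delta>' \<ge> real r powr \<alpha>\<^sub>1 * real h powr \<alpha>\<^sub>2"
  shows "finite (primitive_solutions r a h)
    \<and> (D < 0 \<longrightarrow> num_primitive_solutions r a h \<le> r * m)
    \<and> (D > 0 \<and> even r \<and> indefinite_form r a \<longrightarrow> num_primitive_solutions r a h \<le> 2 * m)
    \<and> (D > 0 \<and> odd r \<and> indefinite_form r a \<longrightarrow> num_primitive_solutions r a h \<le> m)
    \<and> (D > 0 \<and> definite_form r a \<longrightarrow> num_primitive_solutions r a h \<le> 1)"
proof -
  obtain \<alpha> \<beta> \<gamma> \<delta> \<kappa> where diag: "diagonalization r a \<alpha> \<beta> \<gamma> \<delta>"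
    and q: "\<And>x y :: complex. (\<alpha> * x + \<beta> * y) * (\<gamma> * x + \<delta> * y) =
      \<kappa> * (of_int A * x\<^sup>2 + of_int B * x * y + of_int C * y\<^sup>2)"
    using assms(5) unfolding quadratic_of_def by blast
  have quad: "\<alpha> * \<gamma> = \<kappa> * of_int A" "\<beta> * \<delta> = \<kappa> * of_int C"
    using q[of 1 0] q[of 0 1] by simp_all
  have quadB: "\<alpha> * \<delta> + \<beta> * \<gamma> = \<kappa> * of_int B"
    using q[of 1 1] quad by (simp add: algebra_simps)
  interpret F: diagonal_form r a \<alpha> \<beta> \<gamma> \<delta> \<kappa> A B C
    by unfold_locales (use assms(1) diag quad quadB in auto)
  \<comment> \<open>Primitive coefficients are needed in \<open>sqrt_D_bound\<close>. Removing the
    common divisor changes \<open>D\<close> by a positive square, so its sign is kept.\<close>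
  define d where "d = gcd A (gcd B C)"
  have d0: "d > 0"
  proof -
    have "d \<noteq> 0" using F.D_nz by (auto simp: d_def F.D_def)
    then show ?thesis unfolding d_def by (metis gcd_ge_0_int order_le_less)
  qed
  obtain A' B' C' where ABC: "A = d * A'" "B = d * B'" "C = d * C'"
    unfolding d_def by (meson dvd_def gcd_dvd1 gcd_dvd2 dvd_trans)
  have prim: "gcd A' (gcd B' C') = 1"
  proof -
    have "d = d * gcd A' (gcd B' C')"
      using d0 by (subst (1) d_def) (simp add: ABC gcd_mult_distrib_int[symmetric])
    then show ?thesis using d0 by simp
  qed
  interpret G: diagonal_form r a \<alpha> \<beta> \<gamma> \<delta> "\<kappa> * of_int d" A' B' C'
    by unfold_locales (use assms(1) diag quad quadB in \<open>auto simp: ABC\<close>)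
  have DD: "D = d\<^sup>2 * G.D"
    by (simp add: assms(6) G.D_def ABC power2_eq_square algebra_simps)
  have signs: "D < 0 \<longleftrightarrow> G.D < 0" "D > 0 \<longleftrightarrow> G.D > 0"
    unfolding DD using d0 by (simp_all add: mult_less_0_iff zero_less_mult_iff)
  let ?E = "(real r - 1) ^ (m - 1) - 2 * real r - 1"
  define \<mu> where "\<mu> = (cmod G.jac / 2) ^ r / (real h)\<^sup>2"
  have hyp: "ln \<mu> * ?E \<ge> 7 * (real r)\<^sup>2 * ln (real r) + ((real r)\<^sup>2 + real r + 2) * ln (real h)"
  proof -
    have E: "?E > 0" using assms(1,3) by (intro gap_exponent_pos) auto
    have \<mu>0: "\<mu> > 0" using G.jac_nz assms(2) by (simp add: \<mu>_def)
    \<comment> \<open>The factors \<open>2\<close> and \<open>h\<close> in the definition of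
      \<Delta>' are what \<open>cmod_form_disc\<close> lacks to become an exact power of
      \<mu>.\<close>
    have "\<Delta>' = \<mu> ^ (r - 1)"
    proof -
      have "r\<^sup>2 - r = r * (r - 1)" "2 * r - 2 = 2 * (r - 1)"
        by (simp_all add: power2_eq_square diff_mult_distrib2)
      then show ?thesis unfolding assms(7) G.cmod_form_disc \<mu>_def using assms(1)
        by (simp add: power_mult power_divide power_mult_distrib)
    qed
    then have "real r powr \<alpha>\<^sub>1 * real h powr \<alpha>\<^sub>2 \<le> \<mu> ^ (r - 1)" using assms(10) by simp
    then have "ln (real r powr \<alpha>\<^sub>1 * real h powr \<alpha>\<^sub>2) \<le> ln (\<mu> ^ (r - 1))"
      using assms(1,2) \<mu>0 by (subst ln_le_cancel_iff) auto
    then have 1: "\<alpha>\<^sub>1 * ln (real r) + \<alpha>\<^sub>2 * ln (real h) \<le> (real r - 1) * ln \<mu>"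
      using assms(1,2) \<mu>0 by (simp add: ln_mult ln_powr ln_realpow of_nat_diff)
    \<comment> \<open>The factor \<open>r - 1\<close> in \<open>\<alpha>\<^sub>1\<close> and
      \<open>\<alpha>\<^sub>2\<close> matches the exponent in \<Delta>' =
      \<open>\<mu> ^ (r - 1)\<close> and cancels at the end.\<close>
    have "(real r - 1) * (7 * (real r)\<^sup>2 * ln (real r) + ((real r)\<^sup>2 + real r + 2) * ln (real h)) =
        (\<alpha>\<^sub>1 * ln (real r) + \<alpha>\<^sub>2 * ln (real h)) * ?E"
    proof -
      have E12: "\<alpha>\<^sub>1 * ?E = 7 * (real r)\<^sup>2 * (real r - 1)"
        "\<alpha>\<^sub>2 * ?E = (real r - 1) * ((real r)\<^sup>2 + real r + 2)"
        unfolding assms(8,9) using E by simp_all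
      have "(\<alpha>\<^sub>1 * ln (real r) + \<alpha>\<^sub>2 * ln (real h)) * ?E =
          (\<alpha>\<^sub>1 * ?E) * ln (real r) + (\<alpha>\<^sub>2 * ?E) * ln (real h)" by (simp only: distrib_right mult_ac)
      then show ?thesis unfolding E12 by (simp add: algebra_simps)
    qed
    also have "\<dots> \<le> (real r - 1) * ln \<mu> * ?E" using 1 E by (intro mult_right_mono) auto
    finally show ?thesis using assms(1) by (simp add: mult.assoc)
  qed
  interpret G: thue_problem r a \<alpha> \<beta> \<gamma> \<delta> "\<kappa> * of_int d" A' B' C' h m
    by unfold_locales (use assms(1-3) prim hyp in \<open>auto simp: \<mu>_def\<close>)
  show ?thesis using G.solutions_bound unfolding signs by auto
qed

end
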